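(* Let $f:(P,\pi_P)\to(M,\pi_M)$ be a surjective, proper Poisson submersion between Poisson manifolds. If $(P,\pi_P)$ is unimodular, then $(M,\pi_M)$ is also unimodular.
   Context: All manifolds and maps are smooth. For a manifold $M$, $\mathfrak{o}_M=(\widetilde M\times\mathbb{R})/\mathbb{Z}_2$ is the orientation bundle ($\widetilde M$ the orientation double cover); elements of $\Omega^{\mathrm{top}}(M,\mathfrak{o}_M)$ are (smooth) densities. A Poisson manifold $(M,\pi)$ is unimodular if there exists a positive density $\mu\in\Omega^{\mathrm{top}}(M,\mathfrak{o}_M)$ invariant under all Hamiltonian vector fields: $\mathscr{L}_{\pi^{\sharp}(\mathrm{d}f)}\mu=0$ for all $f\in C^{\infty}(M)$. A Poisson map $f:(P,\pi_P)\to(M,\pi_M)$ is a smooth map with $f_*(\pi_{P,x})=\pi_{M,f(x)}$ for all $x\in P$; a Poisson submersion is a Poisson map that is a submersion. *)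

theory Defs
  imports "HOL-Analysis.Analysis"
begin

section \<open>Smooth functions on open subsets of the model space\<close>

text \<open>
  A manifold of dimension \<open>n \<ge> 1\<close> is modelled on \<open>real^'n\<close> with \<open>CARD('n) = n\<close>. Since index types
  are nonempty, dimension 0 is obtained from the subspace \<open>{0}\<close> of \<open>real^'n\<close>. Both cases are covered
  by a set \<open>I\<close> of coordinate indices, which for a manifold is either \<open>UNIV\<close> or \<open>{}\<close>; the model space
  consists of the vectors supported in \<open>I\<close>, and all sums over coordinates range over \<open>I\<close>.
\<close>

definition model_space :: "'n set \<Rightarrow> (real^'n) set" where
  "model_space I = {x. \<forall>i. i \<notin> I \<longrightarrow> x $ i = 0}"

definition partial_deriv :: "'n::finite \<Rightarrow> (real^'n \<Rightarrow> real) \<Rightarrow> real^'n \<Rightarrow> real" where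
  "partial_deriv j g x = deriv (\<lambda>t. g (x + t *\<^sub>R axis j 1)) 0"

primrec Ck_on :: "nat \<Rightarrow> 'n::finite set \<Rightarrow> (real^'n) set \<Rightarrow> (real^'n \<Rightarrow> real) \<Rightarrow> bool" where
  "Ck_on 0 I S g \<longleftrightarrow> continuous_on S g"
| "Ck_on (Suc k) I S g \<longleftrightarrow> continuous_on S g \<and>
     (\<forall>j\<in>I. (\<forall>x\<in>S. (\<lambda>t. g (x + t *\<^sub>R axis j 1)) differentiable (at 0)) \<and>
            Ck_on k I S (partial_deriv j g))"

definition smooth_on :: "'n::finite set \<Rightarrow> (real^'n) set \<Rightarrow> (real^'n \<Rightarrow> real) \<Rightarrow> bool" where
  "smooth_on I S g \<longleftrightarrow> (\<forall>k. Ck_on k I S g)"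


section \<open>Smooth manifolds and smooth maps\<close>

record ('a, 'n) chart =
  chart_dom :: "'a set"
  chart_map :: "'a \<Rightarrow> real^'n"

definition chart_inv :: "('a, 'n) chart \<Rightarrow> real^'n \<Rightarrow> 'a" where
  "chart_inv c = inv_into (chart_dom c) (chart_map c)"

definition chart_img :: "('a, 'n) chart \<Rightarrow> (real^'n) set" where
  "chart_img c = chart_map c ` chart_dom c"

record ('a, 'n) manifold =
  mtop :: "'a topology"
  coords :: "'n set"
  atlas :: "('a, 'n) chart set"

definition smooth_manifold :: "('a, 'n::finite) manifold \<Rightarrow> bool" where
  "smooth_manifold M \<longleftrightarrow>
     (coords M = UNIV \<or> coords M = {}) \<and>
     Hausdorff_space (mtop M) \<and> second_countable (mtop M) \<and>
     (\<Union>c\<in>atlas M. chart_dom c) = topspace (mtop M) \<and>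
     (\<forall>c\<in>atlas M.
        openin (mtop M) (chart_dom c) \<and>
        openin (top_of_set (model_space (coords M))) (chart_img c) \<and>
        homeomorphic_map (subtopology (mtop M) (chart_dom c)) (top_of_set (chart_img c))
          (chart_map c)) \<and>
     (\<forall>c\<in>atlas M. \<forall>d\<in>atlas M. \<forall>i\<in>coords M.
        smooth_on (coords M) (chart_map c ` (chart_dom c \<inter> chart_dom d))
          (\<lambda>x. chart_map d (chart_inv c x) $ i))"

text \<open>Functions on a manifold are total on the underlying type; only their values on the
  underlying space of the manifold matter.\<close>

definition smooth_functions :: "('a, 'n::finite) manifold \<Rightarrow> ('a \<Rightarrow> real) set" where
  "smooth_functions M =
     {h. \<forall>c\<in>atlas M. smooth_on (coords M) (chart_img c) (\<lambda>x. h (chart_inv c x))}"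

definition smooth_map ::
    "('a, 'm::finite) manifold \<Rightarrow> ('b, 'n::finite) manifold \<Rightarrow> ('a \<Rightarrow> 'b) \<Rightarrow> bool" where
  "smooth_map P M f \<longleftrightarrow>
     continuous_map (mtop P) (mtop M) f \<and>
     (\<forall>c\<in>atlas P. \<forall>d\<in>atlas M. \<forall>i\<in>coords M.
        smooth_on (coords P) (chart_map c ` {p \<in> chart_dom c. f p \<in> chart_dom d})
          (\<lambda>x. chart_map d (f (chart_inv c x)) $ i))"

text \<open>The entry in row \<open>i\<close> and column \<open>j\<close> of the matrix of the differential of \<open>f\<close> at \<open>p\<close> with
  respect to the charts \<open>c\<close> around \<open>p\<close> and \<open>d\<close> around \<open>f p\<close>. With \<open>f = id\<close> it is the Jacobian
  of the change of coordinates from \<open>c\<close> to \<open>d\<close>.\<close>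

definition jacobian ::
    "('a, 'm::finite) chart \<Rightarrow> ('b, 'n::finite) chart \<Rightarrow> ('a \<Rightarrow> 'b) \<Rightarrow> 'a \<Rightarrow> 'n \<Rightarrow> 'm \<Rightarrow> real" where
  "jacobian c d f p i j =
     partial_deriv j (\<lambda>x. chart_map d (f (chart_inv c x)) $ i) (chart_map c p)"

definition submersion ::
    "('a, 'm::finite) manifold \<Rightarrow> ('b, 'n::finite) manifold \<Rightarrow> ('a \<Rightarrow> 'b) \<Rightarrow> bool" where
  "submersion P M f \<longleftrightarrow> smooth_map P M f \<and>
     (\<forall>c\<in>atlas P. \<forall>d\<in>atlas M. \<forall>p\<in>chart_dom c. f p \<in> chart_dom d \<longrightarrow>
        (\<forall>w\<in>model_space (coords M). \<exists>v\<in>model_space (coords P).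
           \<forall>i\<in>coords M. (\<Sum>j\<in>coords P. jacobian c d f p i j * v $ j) = w $ i))"


section \<open>Poisson structures\<close>

text \<open>
  A tensor field is given by its components in every chart of the atlas, subject to the
  transformation law under changes of coordinates: a bivector field is
  \<open>\<pi> = 1/2 \<Sum>\<^sub>i\<^sub>j (\<pi> c p i j) \<partial>\<^sub>i \<and> \<partial>\<^sub>j\<close> in the chart \<open>c\<close>, that is,
  \<open>\<pi> c p i j = \<pi>\<^sub>p (dx\<^sup>i, dx\<^sup>j)\<close>.
\<close>

type_synonym ('a, 'n) bivector = "('a, 'n) chart \<Rightarrow> 'a \<Rightarrow> 'n \<Rightarrow> 'n \<Rightarrow> real"
type_synonym ('a, 'n) vfield = "('a, 'n) chart \<Rightarrow> 'a \<Rightarrow> 'n \<Rightarrow> real"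
type_synonym ('a, 'n) density = "('a, 'n) chart \<Rightarrow> 'a \<Rightarrow> real"

definition bivector_field :: "('a, 'n::finite) manifold \<Rightarrow> ('a, 'n) bivector \<Rightarrow> bool" where
  "bivector_field M \<pi> \<longleftrightarrow>
     (\<forall>c\<in>atlas M. \<forall>p\<in>chart_dom c. \<forall>i\<in>coords M. \<forall>j\<in>coords M. \<pi> c p i j = - \<pi> c p j i) \<and>
     (\<forall>c\<in>atlas M. \<forall>i\<in>coords M. \<forall>j\<in>coords M.
        smooth_on (coords M) (chart_img c) (\<lambda>x. \<pi> c (chart_inv c x) i j)) \<and>
     (\<forall>c\<in>atlas M. \<forall>d\<in>atlas M. \<forall>p\<in>chart_dom c \<inter> chart_dom d. \<forall>i\<in>coords M. \<forall>j\<in>coords M.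
        \<pi> d p i j = (\<Sum>k\<in>coords M. \<Sum>l\<in>coords M.
          jacobian c d id p i k * jacobian c d id p j l * \<pi> c p k l))"

definition fun_partial :: "('a, 'n::finite) chart \<Rightarrow> 'n \<Rightarrow> ('a \<Rightarrow> real) \<Rightarrow> 'a \<Rightarrow> real" where
  "fun_partial c j h p = partial_deriv j (\<lambda>x. h (chart_inv c x)) (chart_map c p)"

text \<open>The Hamiltonian vector field \<open>\<pi>\<^sup>\<sharp>(dh) = \<pi>(dh, \<cdot>)\<close>.\<close>

definition hamiltonian_vf ::
    "('a, 'n::finite) manifold \<Rightarrow> ('a, 'n) bivector \<Rightarrow> ('a \<Rightarrow> real) \<Rightarrow> ('a, 'n) vfield" where
  "hamiltonian_vf M \<pi> h c p j = (\<Sum>i\<in>coords M. \<pi> c p i j * fun_partial c i h p)"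

text \<open>The bracket \<open>{g, h} = \<pi>(dg, dh)\<close>; the value does not depend on the chart chosen at \<open>p\<close>.\<close>

definition poisson_bracket ::
    "('a, 'n::finite) manifold \<Rightarrow> ('a, 'n) bivector \<Rightarrow> ('a \<Rightarrow> real) \<Rightarrow> ('a \<Rightarrow> real) \<Rightarrow> 'a \<Rightarrow> real" where
  "poisson_bracket M \<pi> g h p =
     (let c = (SOME c. c \<in> atlas M \<and> p \<in> chart_dom c) in
        \<Sum>i\<in>coords M. \<Sum>j\<in>coords M. \<pi> c p i j * fun_partial c i g p * fun_partial c j h p)"

definition poisson_manifold :: "('a, 'n::finite) manifold \<Rightarrow> ('a, 'n) bivector \<Rightarrow> bool" where
  "poisson_manifold M \<pi> \<longleftrightarrow> smooth_manifold M \<and> bivector_field M \<pi> \<and>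
     (\<forall>f\<in>smooth_functions M. \<forall>g\<in>smooth_functions M. \<forall>h\<in>smooth_functions M.
        \<forall>p\<in>topspace (mtop M).
          poisson_bracket M \<pi> f (poisson_bracket M \<pi> g h) p +
          poisson_bracket M \<pi> g (poisson_bracket M \<pi> h f) p +
          poisson_bracket M \<pi> h (poisson_bracket M \<pi> f g) p = 0)"

text \<open>The second conjunct is \<open>f\<^sub>*(\<pi>P\<^sub>p) = \<pi>M\<^sub>f\<^sub>(\<^sub>p\<^sub>)\<close> in components.\<close>

definition poisson_map ::
    "('a, 'm::finite) manifold \<Rightarrow> ('a, 'm) bivector \<Rightarrow> ('b, 'n::finite) manifold \<Rightarrow>
     ('b, 'n) bivector \<Rightarrow> ('a \<Rightarrow> 'b) \<Rightarrow> bool" where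
  "poisson_map P \<pi>P M \<pi>M f \<longleftrightarrow> smooth_map P M f \<and>
     (\<forall>c\<in>atlas P. \<forall>d\<in>atlas M. \<forall>p\<in>chart_dom c. f p \<in> chart_dom d \<longrightarrow>
        (\<forall>i\<in>coords M. \<forall>j\<in>coords M.
           (\<Sum>k\<in>coords P. \<Sum>l\<in>coords P.
              jacobian c d f p i k * jacobian c d f p j l * \<pi>P c p k l) = \<pi>M d (f p) i j))"

definition poisson_submersion ::
    "('a, 'm::finite) manifold \<Rightarrow> ('a, 'm) bivector \<Rightarrow> ('b, 'n::finite) manifold \<Rightarrow>
     ('b, 'n) bivector \<Rightarrow> ('a \<Rightarrow> 'b) \<Rightarrow> bool" where
  "poisson_submersion P \<pi>P M \<pi>M f \<longleftrightarrow> poisson_map P \<pi>P M \<pi>M f \<and> submersion P M f"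


section \<open>Densities and unimodularity\<close>

text \<open>
  A density is a top-degree form twisted by the orientation bundle. Over the domain of a chart \<open>c\<close>
  it is \<open>\<mu> c \<bar>dx\<^sup>1 \<and> \<dots> \<and> dx\<^sup>n\<bar>\<close>, and the component changes by the absolute value of the Jacobian
  determinant. In dimension 0 the determinant is that of the empty matrix.
\<close>

definition density_factor ::
    "('a, 'n::finite) manifold \<Rightarrow> ('a, 'n) chart \<Rightarrow> ('a, 'n) chart \<Rightarrow> 'a \<Rightarrow> real" where
  "density_factor M c d p =
     (if coords M = {} then 1 else \<bar>det (\<chi> i j. jacobian c d id p i j)\<bar>)"

definition smooth_density :: "('a, 'n::finite) manifold \<Rightarrow> ('a, 'n) density \<Rightarrow> bool" where
  "smooth_density M \<mu> \<longleftrightarrow>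
     (\<forall>c\<in>atlas M. smooth_on (coords M) (chart_img c) (\<lambda>x. \<mu> c (chart_inv c x))) \<and>
     (\<forall>c\<in>atlas M. \<forall>d\<in>atlas M. \<forall>p\<in>chart_dom c \<inter> chart_dom d.
        \<mu> c p = density_factor M c d p * \<mu> d p)"

definition positive_density :: "('a, 'n::finite) manifold \<Rightarrow> ('a, 'n) density \<Rightarrow> bool" where
  "positive_density M \<mu> \<longleftrightarrow> smooth_density M \<mu> \<and> (\<forall>c\<in>atlas M. \<forall>p\<in>chart_dom c. \<mu> c p > 0)"

text \<open>
  In top degree Cartan's formula reads \<open>L\<^sub>X \<mu> = d (\<iota>\<^sub>X \<mu>)\<close>; for
  \<open>X = \<Sum>\<^sub>j X\<^sup>j \<partial>\<^sub>j\<close> and \<open>\<mu> = m \<bar>dx\<^sup>1 \<and> \<dots> \<and> dx\<^sup>n\<bar>\<close> its component is \<open>\<Sum>\<^sub>j \<partial>\<^sub>j (X\<^sup>j m)\<close>.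
\<close>

definition lie_derivative ::
    "('a, 'n::finite) manifold \<Rightarrow> ('a, 'n) vfield \<Rightarrow> ('a, 'n) density \<Rightarrow> ('a, 'n) density" where
  "lie_derivative M X \<mu> c p = (\<Sum>j\<in>coords M. fun_partial c j (\<lambda>q. X c q j * \<mu> c q) p)"

definition unimodular :: "('a, 'n::finite) manifold \<Rightarrow> ('a, 'n) bivector \<Rightarrow> bool" where
  "unimodular M \<pi> \<longleftrightarrow> (\<exists>\<mu>. positive_density M \<mu> \<and>
     (\<forall>h\<in>smooth_functions M. \<forall>c\<in>atlas M. \<forall>p\<in>chart_dom c.
        lie_derivative M (hamiltonian_vf M \<pi> h) \<mu> c p = 0))"

end

theory Submission
  imports Defs
begin

text \<open>
  Integrate an invariant positive density \<open>\<mu>\<close> on \<open>P\<close> along the fibres of \<open>f\<close>. The fibres are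
  compact, so this produces a density \<open>\<nu>\<close> on \<open>M\<close>, characterised by
  \<open>\<integral>\<^sub>M h \<nu> = \<integral>\<^sub>P (h \<circ> f) \<mu>\<close> for continuous \<open>h\<close> with compact support. It is positive because
  \<open>f\<close> is surjective, and it is invariant because brackets pull back along a Poisson map: for a smooth
  function \<open>h\<close> and a test function \<open>t\<close>,
  \<open>\<integral>\<^sub>M {h, t} \<nu> = \<integral>\<^sub>P {h \<circ> f, t \<circ> f} \<mu>\<close>, and the right-hand side is the integral of the divergence
  of a compactly supported vector field, as the Hamiltonian field of \<open>h \<circ> f\<close> preserves \<open>\<mu>\<close>.

  The work lies in the smoothness of \<open>\<nu>\<close> and in its independence of choices.

  Near a point of \<open>P\<close> the inverse function theorem turns a submersion into a coordinate projection
  (\<open>submersion_straightening\<close>). Integrating over the remaining coordinates is a parameter integral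
  over a box (\<open>integral_fibrewise\<close>, \<open>Ck_integral_param\<close>), which is as regular as its integrand. This gives
  the local push-forward \<open>submersion_pushforward\<close>; a partition of unity over a neighbourhood of a
  compact fibre adds the local pieces up (\<open>fibre_integration\<close>).

  Since \<open>\<nu>\<close> is determined by its integrals against test functions, two constructions over
  overlapping open sets agree up to the Jacobian factor of a density (\<open>fibre_density_transform\<close>).
  Hence \<open>\<nu>\<close> is smooth as soon as, for each \<open>k\<close>, some construction near each point is of class
  \<open>C\<^sup>k\<close>. All cut-off functions may therefore depend on \<open>k\<close>, and powers of
  \<open>max 0 (r\<^sup>2 - \<bar>x - x\<^sub>0\<bar>\<^sup>2)\<close> serve as bump functions.

  Integrals over \<open>P\<close> are finite sums of integrals in charts, weighted by a partition of unity.
  Change of variables makes them independent of the partition (\<open>partition_integral_indep\<close>), and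
  integration by parts in each chart yields the divergence theorem that is used above
  (\<open>partition_integral_bracket_eq_0\<close>).
\<close>

section \<open>Functions of class \<open>C\<^sup>k\<close> on open subsets of Euclidean space\<close>

abbreviation Ck :: "nat \<Rightarrow> (real^'n::finite) set \<Rightarrow> (real^'n \<Rightarrow> real) \<Rightarrow> bool" where
  "Ck k S g \<equiv> Ck_on k UNIV S g"

lemma Ck_continuous: "Ck_on k I S g \<Longrightarrow> continuous_on S g"
  by (cases k) auto

lemma Ck_SucD: "Ck_on (Suc k) I S g \<Longrightarrow> Ck_on k I S g"
  by (induction k arbitrary: g) auto

lemma Ck_le: "Ck_on k I S g \<Longrightarrow> j \<le> k \<Longrightarrow> Ck_on j I S g"
  by (induction k) (auto simp: le_Suc_eq dest: Ck_SucD simp del: Ck_on.simps(2))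

lemma Ck_subset: "Ck_on k I S g \<Longrightarrow> T \<subseteq> S \<Longrightarrow> Ck_on k I T g"
  by (induction k arbitrary: g) (auto intro: continuous_on_subset)

lemma eventually_line_in_open:
  fixes x :: "real^'n"
  assumes "open S" "x \<in> S"
  shows "eventually (\<lambda>t. x + t *\<^sub>R v \<in> S) (nhds 0)"
proof -
  have "open ((\<lambda>t. x + t *\<^sub>R v) -` S)"
    by (intro open_vimage assms continuous_intros)
  then show ?thesis
    using assms(2) by (auto simp: eventually_nhds intro!: exI[of _ "(\<lambda>t. x + t *\<^sub>R v) -` S"])
qed

lemma has_partial_cong:
  fixes x :: "real^'n"
  assumes "open S" "x \<in> S" "\<And>y. y \<in> S \<Longrightarrow> g y = h y"
  shows "((\<lambda>t. g (x + t *\<^sub>R v)) has_field_derivative d) (at 0) \<longleftrightarrow>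
         ((\<lambda>t. h (x + t *\<^sub>R v)) has_field_derivative d) (at 0)"
  using eventually_line_in_open[OF assms(1,2), of v]
  by (intro DERIV_cong_ev refl) (auto elim!: eventually_mono simp: assms(3))

lemma partial_deriv_cong:
  assumes "open S" "x \<in> S" "\<And>y. y \<in> S \<Longrightarrow> g y = h y"
  shows "partial_deriv j g x = partial_deriv j h x"
  unfolding partial_deriv_def using eventually_line_in_open[OF assms(1,2), of "axis j 1"]
  by (intro deriv_cong_ev refl) (auto elim!: eventually_mono simp: assms(3))

lemma partial_derivI:
  "((\<lambda>t. g (x + t *\<^sub>R axis j 1)) has_field_derivative d) (at 0) \<Longrightarrow> partial_deriv j g x = d"
  unfolding partial_deriv_def by (rule DERIV_imp_deriv)

lemma Ck_cong:
  assumes "open S" "\<And>x. x \<in> S \<Longrightarrow> g x = h x"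
  shows "Ck_on k I S g \<longleftrightarrow> Ck_on k I S h"
  using assms(2)
proof (induction k arbitrary: g h)
  case 0
  then show ?case by (simp cong: continuous_on_cong)
next
  case (Suc k)
  have 1: "continuous_on S g = continuous_on S h"
    using Suc.prems by (simp cong: continuous_on_cong)
  have 2: "(\<lambda>t. g (x + t *\<^sub>R axis j 1)) differentiable at 0 \<longleftrightarrow>
      (\<lambda>t. h (x + t *\<^sub>R axis j 1)) differentiable at 0" if "x \<in> S" for x j
    using has_partial_cong[OF assms(1) that, of g h] Suc.prems by (simp add: real_differentiable_def)
  have 3: "Ck_on k I S (partial_deriv j g) = Ck_on k I S (partial_deriv j h)" for j
    using partial_deriv_cong[OF assms(1) _ Suc.prems] by (intro Suc.IH) auto
  show ?case using 1 2 3 by simp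
qed

text \<open>
  Being of class \<open>C\<^sup>k\<close> on \<open>S\<close> only constrains the germs at the points of \<open>S\<close>, so it may be checked
  on neighbourhoods.
\<close>

lemma Ck_local:
  fixes S :: "(real^'n) set"
  assumes "\<And>x. x \<in> S \<Longrightarrow> \<exists>T. open T \<and> x \<in> T \<and> Ck_on k I T g"
  shows "Ck_on k I S g"
  using assms
proof (induction k arbitrary: g)
  case 0
  have "continuous (at x within S) g" if "x \<in> S" for x
    using 0[OF that] continuous_on_eq_continuous_at continuous_at_imp_continuous_at_within
    by (metis Ck_on.simps(1))
  then show ?case by (simp add: continuous_on_eq_continuous_within)
next
  case (Suc k)
  have "continuous (at x within S) g" if "x \<in> S" for x
    using Suc.prems[OF that] continuous_on_eq_continuous_at continuous_at_imp_continuous_at_within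
    by (metis Ck_on.simps(2))
  then have "continuous_on S g" by (simp add: continuous_on_eq_continuous_within)
  moreover have "(\<lambda>t. g (x + t *\<^sub>R axis j 1)) differentiable at 0" if "x \<in> S" "j \<in> I" for x j
    using Suc.prems[OF that(1)] that(2) by auto
  moreover have "Ck_on k I S (partial_deriv j g)" if "j \<in> I" for j
    using Suc.prems that by (intro Suc.IH) fastforce
  ultimately show ?case by auto
qed

text \<open>
  The introduction rule behind all closure properties below: it suffices to name the partial
  derivatives and to know that they are of class \<open>C\<^sup>k\<close>, which is where induction hypotheses apply.
\<close>

lemma Ck_SucI:
  fixes g :: "real^'n \<Rightarrow> real"
  assumes "open S" "continuous_on S g"
    and der: "\<And>j x. x \<in> S \<Longrightarrow> ((\<lambda>t. g (x + t *\<^sub>R axis j 1)) has_field_derivative g' j x) (at 0)"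
    and "\<And>j. Ck k S (g' j)"
  shows "Ck (Suc k) S g"
proof -
  have "Ck k S (partial_deriv j g)" for j
    using Ck_cong[OF assms(1), of "partial_deriv j g" "g' j"] der assms(4) by (metis partial_derivI)
  then show ?thesis
    using assms by (auto simp: real_differentiable_def)
qed

lemma Ck_has_partial:
  assumes "Ck (Suc k) S g" "x \<in> S"
  shows "((\<lambda>t. g (x + t *\<^sub>R axis j 1)) has_field_derivative partial_deriv j g x) (at 0)"
  using assms by (auto simp: partial_deriv_def real_differentiable_def DERIV_deriv_iff_real_differentiable)

lemma Ck_partial: "Ck (Suc k) S g \<Longrightarrow> Ck k S (partial_deriv j g)"
  by simp

text \<open>
  The classical criterion for Frechet differentiability: the increment is split into steps parallel to
  the coordinate axes, and the mean value theorem is applied to each step.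
\<close>

lemma has_derivative_partials:
  fixes g :: "real^'n \<Rightarrow> real"
  assumes S: "open S" "x \<in> S"
    and der: "\<And>j y. y \<in> S \<Longrightarrow> ((\<lambda>t. g (y + t *\<^sub>R axis j 1)) has_field_derivative g' j y) (at 0)"
    and cont: "\<And>j. continuous_on S (g' j)"
  shows "(g has_derivative (\<lambda>v. \<Sum>j\<in>UNIV. v $ j * g' j x)) (at x)"
proof -
  \<comment> \<open>the part of the increment along the coordinate axes in \<open>I\<close>\<close>
  define pr where "pr I v = (\<chi> i. if i \<in> I then v $ i else (0::real))" for I :: "'n set" and v
  have pr_le: "norm (pr I v) \<le> norm v" for I v
    by (intro norm_le_componentwise_cart) (simp add: pr_def)
  have "\<exists>d>0. \<forall>y. norm (y - x) < d \<longrightarrow> norm (g y - g x - (\<Sum>j\<in>UNIV. (y - x) $ j * g' j x)) \<le> e * norm (y - x)"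
    if "e > 0" for e
  proof -
    define e' where "e' = e / real CARD('n)"
    have e': "e' > 0" using that by (simp add: e'_def)
    have "\<forall>\<^sub>F y in nhds x. y \<in> S \<and> (\<forall>j\<in>UNIV. dist (g' j y) (g' j x) < e')"
    proof (intro eventually_conj eventually_ball_finite ballI finite)
      show "\<forall>\<^sub>F y in nhds x. y \<in> S" using S by (simp add: eventually_nhds_in_open)
      fix j
      have "(g' j \<longlongrightarrow> g' j x) (nhds x)"
        using cont[of j] S by (simp add: continuous_on_eq_continuous_at isCont_def tendsto_at_iff_tendsto_nhds)
      then show "\<forall>\<^sub>F y in nhds x. dist (g' j y) (g' j x) < e'"
        using e' by (rule tendstoD)
    qed
    then obtain d where d: "d > 0"
      "\<And>y j. dist y x < d \<Longrightarrow> y \<in> S \<and> dist (g' j y) (g' j x) < e'"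
      by (auto simp: eventually_nhds_metric)
    have main: "\<bar>g (x + pr I v) - g x - (\<Sum>j\<in>I. v $ j * g' j x)\<bar> \<le> real (card I) * (e' * norm v)"
      if v: "norm v < d" for v and I :: "'n set"
      using finite[of I]
    proof (induction I rule: finite_induct)
      case empty
      then show ?case by (simp add: pr_def zero_vec_def[symmetric])
    next
      case (insert i I)
      have pri: "pr (insert i I) v = pr I v + v $ i *\<^sub>R axis i 1"
        using insert.hyps by (auto simp: pr_def vec_eq_iff axis_def)
      have seg: "norm (pr I v + t *\<^sub>R axis i 1) < d" if "\<bar>t\<bar> \<le> \<bar>v $ i\<bar>" for t
      proof -
        have "norm (pr I v + t *\<^sub>R axis i 1) \<le> norm v"
          using insert.hyps that by (intro norm_le_componentwise_cart) (auto simp: pr_def axis_def)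
        then show ?thesis using v by simp
      qed
      define \<phi> where "\<phi> t = g (x + pr I v + t *\<^sub>R axis i 1) - t * g' i x" for t
      have der\<phi>: "(\<phi> has_field_derivative (g' i (x + pr I v + t *\<^sub>R axis i 1) - g' i x)) (at t)"
        if "\<bar>t\<bar> \<le> \<bar>v $ i\<bar>" for t
      proof -
        let ?y = "x + pr I v + t *\<^sub>R axis i 1"
        have "?y \<in> S" using d(2)[of ?y] seg[OF that] by (simp add: dist_norm algebra_simps)
        from der[OF this, of i]
        have "((\<lambda>s. g (?y + (s - t) *\<^sub>R axis i 1)) has_field_derivative g' i ?y) (at t)"
          using DERIV_shift[of "\<lambda>s. g (?y + (s - t) *\<^sub>R axis i 1)" "g' i ?y" 0 t]
          by (simp add: add.commute)
        then have "((\<lambda>s. g (x + pr I v + s *\<^sub>R axis i 1)) has_field_derivative g' i ?y) (at t)"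
          by (simp add: algebra_simps)
        then show ?thesis unfolding \<phi>_def by (auto intro!: derivative_eq_intros)
      qed
      have "norm (\<phi> (v $ i) - \<phi> 0) \<le> e' * norm (v $ i - 0)"
      proof (rule field_differentiable_bound[of "{- \<bar>v $ i\<bar>..\<bar>v $ i\<bar>}"])
        fix t assume "t \<in> {- \<bar>v $ i\<bar>..\<bar>v $ i\<bar>}"
        then have t: "\<bar>t\<bar> \<le> \<bar>v $ i\<bar>" by auto
        show "(\<phi> has_field_derivative (g' i (x + pr I v + t *\<^sub>R axis i 1) - g' i x)) (at t within {- \<bar>v $ i\<bar>..\<bar>v $ i\<bar>})"
          using der\<phi>[OF t] by (rule has_field_derivative_at_within)
        show "norm (g' i (x + pr I v + t *\<^sub>R axis i 1) - g' i x) \<le> e'"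
          using d(2)[of "x + pr I v + t *\<^sub>R axis i 1" i] seg[OF t]
          by (simp add: dist_norm algebra_simps less_imp_le)
      qed auto
      also have "\<dots> \<le> e' * norm v"
        using component_le_norm_cart[of v i] e' by simp
      finally have "\<bar>g (x + pr (insert i I) v) - g (x + pr I v) - v $ i * g' i x\<bar> \<le> e' * norm v"
        by (simp add: \<phi>_def pri algebra_simps)
      with insert show ?case by (simp add: algebra_simps)
    qed
    have "norm (g y - g x - (\<Sum>j\<in>UNIV. (y - x) $ j * g' j x)) \<le> e * norm (y - x)"
      if "norm (y - x) < d" for y
    proof -
      have "pr UNIV (y - x) = y - x" by (simp add: pr_def vec_eq_iff)
      then show ?thesis using main[OF that, of UNIV] by (simp add: e'_def)
    qed
    then show ?thesis using d(1) by blast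
  qed
  moreover have "bounded_linear (\<lambda>v. \<Sum>j\<in>UNIV. v $ j * g' j x)"
    by (intro bounded_linear_sum bounded_linear_mult_const bounded_linear_vec_nth)
  ultimately show ?thesis
    by (simp add: has_derivative_at_alt)
qed

lemma Ck_has_derivative:
  fixes g :: "real^'n \<Rightarrow> real"
  assumes "Ck (Suc k) S g" "open S" "x \<in> S"
  shows "(g has_derivative (\<lambda>v. \<Sum>j\<in>UNIV. v $ j * partial_deriv j g x)) (at x)"
  using assms Ck_has_partial[OF assms(1)] Ck_continuous[OF Ck_partial[OF assms(1)]]
  by (intro has_derivative_partials[of S]) auto

lemma has_derivative_has_partial:
  fixes g :: "real^'n \<Rightarrow> real"
  assumes "(g has_derivative g') (at x)"
  shows "((\<lambda>t. g (x + t *\<^sub>R v)) has_field_derivative g' v) (at 0)"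
proof -
  have "((\<lambda>t. x + t *\<^sub>R v) has_derivative (\<lambda>t. t *\<^sub>R v)) (at 0)"
    by (auto intro!: derivative_eq_intros)
  then have "((\<lambda>t. g (x + t *\<^sub>R v)) has_derivative (\<lambda>t. g' (t *\<^sub>R v))) (at 0)"
    using assms has_derivative_compose[of "\<lambda>t. x + t *\<^sub>R v" _ 0 UNIV g g'] by simp
  moreover have "(\<lambda>t. g' (t *\<^sub>R v)) = (*) (g' v)"
    using linear_scale[OF has_derivative_linear[OF assms]] by (auto simp: mult.commute)
  ultimately show ?thesis by (simp add: has_field_derivative_def)
qed

lemma Ck_const: "Ck_on k I S (\<lambda>x. c)"
proof (induction k arbitrary: c)
  case (Suc k)
  have "partial_deriv j (\<lambda>x::real^'a. c) = (\<lambda>x. 0)" for j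
    by (auto simp: partial_deriv_def)
  then show ?case using Suc by simp
qed simp

lemma Ck_coord:
  assumes "open S"
  shows "Ck k S (\<lambda>x. x $ i)"
proof (cases k)
  case (Suc l)
  have "Ck (Suc l) S (\<lambda>x. x $ i)"
  proof (rule Ck_SucI[OF assms])
    show "((\<lambda>t. (x + t *\<^sub>R axis j 1) $ i) has_field_derivative (if i = j then 1 else 0)) (at 0)" for x j
      by (auto simp: axis_def intro!: derivative_eq_intros)
  qed (auto intro!: continuous_intros Ck_const)
  then show ?thesis using Suc by simp
qed (auto intro!: continuous_intros)

lemma Ck_add:
  assumes S: "open S" and "Ck k S f" "Ck k S g"
  shows "Ck k S (\<lambda>x. f x + g x)"
  using assms(2,3)
proof (induction k arbitrary: f g)
  case (Suc k)
  show ?case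
  proof (rule Ck_SucI[OF S])
    show "((\<lambda>t. f (x + t *\<^sub>R axis j 1) + g (x + t *\<^sub>R axis j 1)) has_field_derivative
        partial_deriv j f x + partial_deriv j g x) (at 0)" if "x \<in> S" for x j
      using Suc.prems that by (intro DERIV_add Ck_has_partial)
    show "Ck k S (\<lambda>x. partial_deriv j f x + partial_deriv j g x)" for j
      using Suc.prems by (intro Suc.IH Ck_partial)
  qed (intro continuous_on_add Suc.prems[THEN Ck_continuous])
qed (auto intro!: continuous_on_add continuous_on_mult)

lemma has_partial_mult:
  assumes "((\<lambda>t. f (x + t *\<^sub>R v)) has_field_derivative d) (at (0::real))"
    "((\<lambda>t. g (x + t *\<^sub>R v)) has_field_derivative e) (at 0)"
  shows "((\<lambda>t. f (x + t *\<^sub>R v) * g (x + t *\<^sub>R v) :: real) has_field_derivative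
        d * g x + e * f (x::real^'n)) (at 0)"
  using DERIV_mult[OF assms] by simp

lemma Ck_mult:
  assumes S: "open S" and "Ck k S f" "Ck k S g"
  shows "Ck k S (\<lambda>x. f x * g x)"
  using assms(2,3)
proof (induction k arbitrary: f g)
  case (Suc k)
  show ?case
  proof (rule Ck_SucI[OF S])
    show "((\<lambda>t. f (x + t *\<^sub>R axis j 1) * g (x + t *\<^sub>R axis j 1)) has_field_derivative
        partial_deriv j f x * g x + partial_deriv j g x * f x) (at 0)" if "x \<in> S" for x j
      using Suc.prems that by (intro has_partial_mult Ck_has_partial)
    show "Ck k S (\<lambda>x. partial_deriv j f x * g x + partial_deriv j g x * f x)" for j
      by (intro Suc.IH Ck_add[OF S] Suc.prems[THEN Ck_SucD] Suc.prems[THEN Ck_partial])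
  qed (intro continuous_on_mult Suc.prems[THEN Ck_continuous])
qed (auto intro!: continuous_on_add continuous_on_mult)

lemma Ck_sum:
  assumes "open S" "\<And>i. i \<in> A \<Longrightarrow> Ck k S (f i)"
  shows "Ck k S (\<lambda>x. \<Sum>i\<in>A. f i x)"
  using assms(2) by (induction A rule: infinite_finite_induct) (auto intro!: Ck_const Ck_add[OF assms(1)])

lemma Ck_prod:
  assumes "open S" "\<And>i. i \<in> A \<Longrightarrow> Ck k S (f i)"
  shows "Ck k S (\<lambda>x. \<Prod>i\<in>A. f i x)"
  using assms(2) by (induction A rule: infinite_finite_induct) (auto intro!: Ck_const Ck_mult[OF assms(1)])

lemma Ck_minus:
  assumes "open S" "Ck k S f"
  shows "Ck k S (\<lambda>x. - f x)"
  using Ck_mult[OF assms(1) Ck_const[of _ _ _ "-1"] assms(2)] by simp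

lemma Ck_diff:
  assumes "open S" "Ck k S f" "Ck k S g"
  shows "Ck k S (\<lambda>x. f x - g x)"
  using Ck_add[OF assms(1,2) Ck_minus[OF assms(1,3)]] by simp

lemma Ck_power:
  assumes "open S" "Ck k S f"
  shows "Ck k S (\<lambda>x. f x ^ n)"
  by (induction n) (auto intro!: Ck_const Ck_mult assms)

lemma Ck_inverse:
  assumes S: "open S" and nz: "\<And>x. x \<in> S \<Longrightarrow> f x \<noteq> 0" and "Ck k S f"
  shows "Ck k S (\<lambda>x. inverse (f x))"
  using assms(3)
proof (induction k)
  case (Suc k)
  show ?case
  proof (rule Ck_SucI[OF S])
    show "((\<lambda>t. inverse (f (x + t *\<^sub>R axis j 1))) has_field_derivative
        - (inverse (f x) * partial_deriv j f x * inverse (f x))) (at 0)" if "x \<in> S" for x j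
      using DERIV_inverse'[OF Ck_has_partial[OF Suc.prems that, of j]] nz[OF that] by simp
    show "Ck k S (\<lambda>x. - (inverse (f x) * partial_deriv j f x * inverse (f x)))" for j
      by (intro Ck_minus[OF S] Ck_mult[OF S] Suc.IH Suc.prems[THEN Ck_SucD] Suc.prems[THEN Ck_partial])
  qed (intro continuous_on_inverse Suc.prems[THEN Ck_continuous] ballI nz)
qed (use nz in \<open>auto intro!: continuous_on_inverse\<close>)

lemma Ck_divide:
  assumes "open S" "\<And>x. x \<in> S \<Longrightarrow> g x \<noteq> 0" "Ck k S f" "Ck k S g"
  shows "Ck k S (\<lambda>x. f x / g x)"
  using Ck_mult[OF assms(1,3) Ck_inverse[OF assms(1,2,4)]] by (simp add: divide_inverse)

text \<open>
  The sign of a nowhere vanishing continuous function is locally constant.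
\<close>

lemma Ck_abs:
  assumes S: "open S" and nz: "\<And>x. x \<in> S \<Longrightarrow> f x \<noteq> 0" and f: "Ck k S f"
  shows "Ck k S (\<lambda>x. \<bar>f x\<bar>)"
proof (rule Ck_local)
  fix x assume x: "x \<in> S"
  have o: "open {x\<in>S. 0 < f x}" "open {x\<in>S. f x < 0}"
    using continuous_open_preimage[OF Ck_continuous[OF f] S, of "{0<..}"]
      continuous_open_preimage[OF Ck_continuous[OF f] S, of "{..<0}"]
    by (auto simp: vimage_def Int_def)
  show "\<exists>T. open T \<and> x \<in> T \<and> Ck k T (\<lambda>x. \<bar>f x\<bar>)"
  proof (cases "f x > 0")
    case True
    have "Ck k {x\<in>S. 0 < f x} (\<lambda>x. \<bar>f x\<bar>)"
      using Ck_cong[OF o(1), of "\<lambda>x. \<bar>f x\<bar>" f k UNIV] Ck_subset[OF f, of "{x\<in>S. 0 < f x}"] by auto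
    then show ?thesis using True x o(1) by blast
  next
    case False
    have "Ck k {x\<in>S. f x < 0} (\<lambda>x. \<bar>f x\<bar>)"
      using Ck_cong[OF o(2), of "\<lambda>x. \<bar>f x\<bar>" "\<lambda>x. - f x" k UNIV]
        Ck_subset[OF Ck_minus[OF S f], of "{x\<in>S. f x < 0}"] by auto
    then show ?thesis using False x o(2) nz[OF x] by (intro exI[of _ "{x\<in>S. f x < 0}"]) auto
  qed
qed

text \<open>
  The two branches of \<open>u \<mapsto> max 0 u ^ (k + 2)\<close> have the same derivative at \<open>0\<close>, where they meet.
\<close>

lemma DERIV_max_0_power:
  "((\<lambda>u::real. max 0 u ^ Suc (Suc k)) has_field_derivative real (Suc (Suc k)) * max 0 u ^ Suc k) (at u)"
proof -
  have *: "(\<lambda>u::real. max 0 u ^ Suc (Suc k)) = (\<lambda>u. if u \<in> {0..} then u ^ Suc (Suc k) else 0)"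
    by (auto simp: fun_eq_iff max_def)
  have pow: "((\<lambda>u. u ^ Suc (Suc k)) has_vector_derivative (2 + real k) * u ^ Suc k) (at u within A)" for u :: real and A
    using DERIV_pow[of "Suc (Suc k)" u A] by (simp add: algebra_simps has_real_derivative_iff_has_vector_derivative)
  have "((\<lambda>u::real. if u \<in> {0..} then u ^ Suc (Suc k) else 0) has_vector_derivative
     (if u \<in> {0..} then real (Suc (Suc k)) * u ^ Suc k else 0)) (at u within UNIV)"
    by (rule has_vector_derivative_If_within_closures[where T = "{..0}" and S = "{0..}"])
      (auto intro: pow simp del: power_Suc simp: ivl_disj_un_one(7) Int_atLeastAtMost)
  moreover have "(if u \<in> {0..} then real (Suc (Suc k)) * u ^ Suc k else 0) = real (Suc (Suc k)) * max 0 u ^ Suc k"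
    by (auto simp: max_def)
  ultimately show ?thesis
    by (simp only: * has_real_derivative_iff_has_vector_derivative)
qed

text \<open>
  Differentiation lowers the exponent by one, so a power of the positive part is of class \<open>C\<^sup>k\<close> if the
  exponent exceeds \<open>k\<close>.
\<close>

lemma Ck_max_0_power:
  assumes S: "open S" and "Ck k S f"
  shows "Ck k S (\<lambda>x. max 0 (f x) ^ Suc k)"
  using assms(2)
proof (induction k)
  case (Suc k)
  show ?case
  proof (rule Ck_SucI[OF S])
    show "((\<lambda>t. max 0 (f (x + t *\<^sub>R axis j 1)) ^ Suc (Suc k)) has_field_derivative
        real (Suc (Suc k)) * max 0 (f x) ^ Suc k * partial_deriv j f x) (at 0)" if "x \<in> S" for x j
      using DERIV_chain2[OF DERIV_max_0_power Ck_has_partial[OF Suc.prems that, of j], of k] by simp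
    show "Ck k S (\<lambda>x. real (Suc (Suc k)) * max 0 (f x) ^ Suc k * partial_deriv j f x)" for j
      by (intro Ck_mult[OF S] Ck_const Suc.IH Suc.prems[THEN Ck_SucD] Suc.prems[THEN Ck_partial])
  qed (intro continuous_on_power continuous_on_max continuous_on_const Suc.prems[THEN Ck_continuous])
qed (auto intro!: continuous_on_power continuous_on_max continuous_on_const)

lemma has_derivative_vec_components:
  fixes \<phi> :: "real^'m \<Rightarrow> real^'n"
  assumes "\<And>i. ((\<lambda>x. \<phi> x $ i) has_derivative (\<lambda>v. \<phi>' v $ i)) (at x)"
  shows "(\<phi> has_derivative \<phi>') (at x)"
proof -
  have "(\<phi> has_derivative \<phi>') (at x within UNIV)"
    unfolding has_derivative_componentwise_within[of \<phi>]
    using assms by (auto simp: Basis_vec_def inner_axis)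
  then show ?thesis by simp
qed

lemma Ck_has_derivative_vec:
  fixes \<phi> :: "real^'m \<Rightarrow> real^'n"
  assumes "\<And>i. Ck (Suc k) S (\<lambda>x. \<phi> x $ i)" "open S" "x \<in> S"
  shows "(\<phi> has_derivative (\<lambda>v. (\<chi> i j. partial_deriv j (\<lambda>x. \<phi> x $ i) x) *v v)) (at x)"
  using Ck_has_derivative[OF assms(1-3)]
  by (intro has_derivative_vec_components) (simp add: matrix_vector_mult_def mult.commute)

lemma has_partial_compose:
  fixes \<phi> :: "real^'m \<Rightarrow> real^'n" and g :: "real^'n \<Rightarrow> real"
  assumes "\<And>i. Ck (Suc k) S (\<lambda>x. \<phi> x $ i)" "open S" "x \<in> S"
    and "Ck (Suc l) T g" "open T" "\<phi> x \<in> T"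
  shows "((\<lambda>t. g (\<phi> (x + t *\<^sub>R axis j 1))) has_field_derivative
     (\<Sum>i\<in>UNIV. partial_deriv j (\<lambda>x. \<phi> x $ i) x * partial_deriv i g (\<phi> x))) (at 0)"
proof -
  have "((\<lambda>x. g (\<phi> x)) has_derivative (\<lambda>v. \<Sum>i\<in>UNIV.
     ((\<chi> i j. partial_deriv j (\<lambda>x. \<phi> x $ i) x) *v v) $ i * partial_deriv i g (\<phi> x))) (at x)"
    using has_derivative_compose[OF Ck_has_derivative_vec[OF assms(1-3)] Ck_has_derivative[OF assms(4-6)]] by simp
  from has_derivative_has_partial[OF this, of "axis j 1"]
  show ?thesis by (simp add: matrix_vector_mult_basis column_def)
qed

text \<open>
  By the chain rule the partial derivatives of \<open>g \<circ> \<phi>\<close> are sums of products of partial derivatives of \<open>\<phi>\<close>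
  with functions \<open>(\<partial>\<^sub>i g) \<circ> \<phi>\<close>, to which the induction hypothesis applies.
\<close>

lemma Ck_compose:
  fixes \<phi> :: "real^'m \<Rightarrow> real^'n" and g :: "real^'n \<Rightarrow> real"
  assumes S: "open S" and T: "open T" and im: "\<And>x. x \<in> S \<Longrightarrow> \<phi> x \<in> T"
    and "\<And>i. Ck k S (\<lambda>x. \<phi> x $ i)" "Ck k T g"
  shows "Ck k S (\<lambda>x. g (\<phi> x))"
  using assms(4,5)
proof (induction k arbitrary: g)
  case 0
  have "continuous_on S \<phi>"
    using 0(1) by (simp add: continuous_on_componentwise[of S \<phi>] Basis_vec_def inner_axis)
  then show ?case using 0(2) im by (auto intro!: continuous_on_compose2[of T g S \<phi>])
next
  case (Suc k)
  show ?case
  proof (rule Ck_SucI[OF S])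
    have "continuous_on S \<phi>"
      using Suc.prems(1) by (simp add: continuous_on_componentwise[of S \<phi>] Basis_vec_def inner_axis)
    then show "continuous_on S (\<lambda>x. g (\<phi> x))"
      using Suc.prems(2) im by (auto intro!: continuous_on_compose2[of T g S \<phi>])
    show "((\<lambda>t. g (\<phi> (x + t *\<^sub>R axis j 1))) has_field_derivative
     (\<Sum>i\<in>UNIV. partial_deriv j (\<lambda>x. \<phi> x $ i) x * partial_deriv i g (\<phi> x))) (at 0)" if "x \<in> S" for x j
      using Suc.prems that S T im by (intro has_partial_compose)
    have "Ck k S (\<lambda>x. partial_deriv i g (\<phi> x))" for i
      using Suc.prems by (intro Suc.IH[of "partial_deriv i g"] Ck_partial) (auto intro: Ck_SucD simp del: Ck_on.simps(2))
    then show "Ck k S (\<lambda>x. \<Sum>i\<in>UNIV. partial_deriv j (\<lambda>x. \<phi> x $ i) x * partial_deriv i g (\<phi> x))" for j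
      by (intro Ck_sum[OF S] Ck_mult[OF S] Suc.prems(1)[THEN Ck_partial])
  qed
qed

lemma Ck_det:
  fixes A :: "real^'m \<Rightarrow> real^'n^'n"
  assumes "open S" "\<And>i j. Ck k S (\<lambda>x. A x $ i $ j)"
  shows "Ck k S (\<lambda>x. det (A x))"
  unfolding det_def by (intro Ck_sum[OF assms(1)] Ck_mult[OF assms(1)] Ck_prod[OF assms(1)] Ck_const assms(2))

section \<open>Integrals of continuous functions with compact support\<close>

text \<open>
  Outside \<open>S\<close> the function may take arbitrary values: it is its extension by zero that has compact
  support.
\<close>

definition Cc_on :: "'a::euclidean_space set \<Rightarrow> ('a \<Rightarrow> real) \<Rightarrow> bool" where
  "Cc_on S w \<longleftrightarrow> continuous_on S w \<and> (\<exists>K. compact K \<and> K \<subseteq> S \<and> (\<forall>x\<in>S - K. w x = 0))"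

lemma Cc_onI:
  "continuous_on S w \<Longrightarrow> compact K \<Longrightarrow> K \<subseteq> S \<Longrightarrow> (\<And>x. x \<in> S \<Longrightarrow> x \<notin> K \<Longrightarrow> w x = 0) \<Longrightarrow> Cc_on S w"
  by (auto simp: Cc_on_def)

lemma Cc_on_mult:
  assumes "continuous_on S v" "Cc_on S w"
  shows "Cc_on S (\<lambda>x. v x * w x)"
  using assms by (auto simp: Cc_on_def intro!: continuous_on_mult)

lemma Cc_on_add:
  assumes "Cc_on S v" "Cc_on S w"
  shows "Cc_on S (\<lambda>x. v x + w x)"
proof -
  obtain K L where "compact K" "K \<subseteq> S" "\<forall>x\<in>S - K. v x = 0" "compact L" "L \<subseteq> S" "\<forall>x\<in>S - L. w x = 0"
    using assms by (auto simp: Cc_on_def)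
  then show ?thesis
    using assms by (intro Cc_onI[of _ _ "K \<union> L"]) (auto simp: Cc_on_def intro!: continuous_on_add)
qed

lemma Cc_on_sum:
  assumes "\<And>i. i \<in> A \<Longrightarrow> Cc_on S (w i)"
  shows "Cc_on S (\<lambda>x. \<Sum>i\<in>A. w i x)"
proof -
  have "Cc_on S (\<lambda>x. 0)" by (rule Cc_onI[of _ _ "{}"]) auto
  then show ?thesis
    using assms by (induction A rule: infinite_finite_induct) (auto intro!: Cc_on_add)
qed

lemma continuous_on_zero_extension:
  fixes w :: "'a::euclidean_space \<Rightarrow> real"
  assumes "open S" "Cc_on S w"
  shows "continuous_on UNIV (\<lambda>x. if x \<in> S then w x else 0)"
proof -
  obtain K where K: "compact K" "K \<subseteq> S" "\<forall>x\<in>S - K. w x = 0"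
    using assms by (auto simp: Cc_on_def)
  have "continuous_on (S \<union> - K) (\<lambda>x. if x \<in> S then w x else 0)"
  proof (rule continuous_on_open_Un[OF assms(1)])
    show "open (- K)" using K(1) by (simp add: compact_imp_closed open_Compl)
    show "continuous_on S (\<lambda>x. if x \<in> S then w x else 0)"
      using assms by (simp add: Cc_on_def cong: continuous_on_cong)
    have "continuous_on (- K) (\<lambda>x. 0::real)" by simp
    then show "continuous_on (- K) (\<lambda>x. if x \<in> S then w x else 0)"
      by (rule continuous_on_eq) (use K in auto)
  qed
  moreover have "S \<union> - K = UNIV" using K by auto
  ultimately show ?thesis by simp
qed

lemma Cc_on_zero_extension:
  fixes w :: "'a::euclidean_space \<Rightarrow> real"
  assumes "open S" "Cc_on S w"
  shows "Cc_on UNIV (\<lambda>x. if x \<in> S then w x else 0)"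
  using continuous_on_zero_extension[OF assms] assms by (auto simp: Cc_on_def)

lemma Cc_on_integrable_lborel:
  fixes w :: "'a::euclidean_space \<Rightarrow> real"
  assumes "Cc_on UNIV w"
  shows "integrable lborel w"
proof -
  obtain K where K: "compact K" "\<forall>x. x \<notin> K \<longrightarrow> w x = 0"
    using assms by (auto simp: Cc_on_def)
  have "integrable lborel (\<lambda>x. indicator K x *\<^sub>R w x)"
    using assms K by (intro borel_integrable_compact) (auto simp: Cc_on_def intro: continuous_on_subset)
  also have "(\<lambda>x. indicator K x *\<^sub>R w x) = w"
    by (rule ext) (use K in \<open>auto simp: indicator_def\<close>)
  finally show ?thesis .
qed

lemma Cc_on_absolutely_integrable:
  fixes w :: "'a::euclidean_space \<Rightarrow> real"
  assumes "open S" "Cc_on S w"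
  shows "w absolutely_integrable_on S"
proof -
  have i: "integrable lborel (\<lambda>x. if x \<in> S then w x else 0)"
    using Cc_on_integrable_lborel[OF Cc_on_zero_extension[OF assms]] .
  then have "integrable lebesgue (\<lambda>x. if x \<in> S then w x else 0)"
    by (subst integrable_completion) auto
  moreover have "(\<lambda>x. if x \<in> S then w x else 0) = (\<lambda>x. indicator S x *\<^sub>R w x)"
    by auto
  ultimately show ?thesis by (simp add: set_integrable_def)
qed

lemma Cc_on_integrable:
  fixes w :: "'a::euclidean_space \<Rightarrow> real"
  assumes "open S" "Cc_on S w"
  shows "w integrable_on S"
  using Cc_on_absolutely_integrable[OF assms] by (rule set_lebesgue_integral_eq_integral)

lemma Cc_on_subset:
  assumes "Cc_on S w" "S \<subseteq> T" "open S" "\<And>x. x \<in> T - S \<Longrightarrow> w x = 0"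
  shows "Cc_on T w"
proof -
  obtain K where K: "compact K" "K \<subseteq> S" "\<forall>x\<in>S - K. w x = 0"
    using assms by (auto simp: Cc_on_def)
  have "continuous_on T (\<lambda>x. if x \<in> S then w x else 0)"
    using continuous_on_zero_extension[OF assms(3,1)] continuous_on_subset by blast
  then have "continuous_on T w"
    by (rule continuous_on_eq) (use assms in auto)
  then show ?thesis
    using K assms by (intro Cc_onI[of _ _ K]) auto
qed

lemma Ck_zero_extension:
  fixes w :: "real^'n \<Rightarrow> real"
  assumes "open S" "Ck k S w" "compact K" "K \<subseteq> S" "\<And>x. x \<in> S \<Longrightarrow> x \<notin> K \<Longrightarrow> w x = 0"
  shows "Ck k UNIV (\<lambda>x. if x \<in> S then w x else 0)"
proof (rule Ck_local)
  fix x :: "real^'n"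
  have c: "open (- K)" using assms(3) by (simp add: compact_imp_closed open_Compl)
  show "\<exists>T. open T \<and> x \<in> T \<and> Ck k T (\<lambda>x. if x \<in> S then w x else 0)"
  proof (cases "x \<in> S")
    case True
    have "Ck k S (\<lambda>x. if x \<in> S then w x else 0)"
      using assms(2) by (subst Ck_cong[OF assms(1), of _ w]) auto
    then show ?thesis using True assms(1) by blast
  next
    case False
    have "Ck k (- K) (\<lambda>x. if x \<in> S then w x else 0)"
      using assms(5) by (subst Ck_cong[OF c, of _ "\<lambda>x. 0"]) (auto intro: Ck_const)
    then show ?thesis using False assms(4) c by blast
  qed
qed

lemma integral_eq_integral_UNIV:
  fixes f :: "'a::euclidean_space \<Rightarrow> real"
  assumes "\<And>x. x \<notin> S \<Longrightarrow> f x = 0"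
  shows "integral S f = integral UNIV f"
proof -
  have "(\<lambda>x. if x \<in> S then f x else 0) = f" using assms by auto
  then show ?thesis using integral_restrict_UNIV[of S f] by simp
qed

lemma integral_translation_UNIV:
  fixes u :: "'a::euclidean_space \<Rightarrow> real"
  assumes "Cc_on UNIV u"
  shows "integral UNIV (\<lambda>x. u (x + c)) = integral UNIV u" "(\<lambda>x. u (x + c)) integrable_on UNIV"
proof -
  have m: "u \<in> borel_measurable borel"
    using assms by (auto simp: Cc_on_def intro: borel_measurable_continuous_onI)
  have i: "integrable lborel u" by (rule Cc_on_integrable_lborel[OF assms])
  have "integrable (distr lborel borel ((+) c)) u" using i by (simp add: lborel_distr_plus)
  then have i2: "integrable lborel (\<lambda>x. u (x + c))"
    using m by (subst (asm) integrable_distr_eq) (auto simp: add.commute)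
  have "integral\<^sup>L (distr lborel borel ((+) c)) u = (\<integral>x. u (c + x) \<partial>lborel)"
    using m by (intro integral_distr) auto
  then show "integral UNIV (\<lambda>x. u (x + c)) = integral UNIV u"
    using i i2 by (simp add: lborel_distr_plus integral_lborel add.commute)
  show "(\<lambda>x. u (x + c)) integrable_on UNIV" using i2 by (rule integrable_on_lborel)
qed

text \<open>
  By translation invariance \<open>t \<mapsto> \<integral> u (x + t e\<^sub>j) dx\<close> is constant; differentiating under the integral sign
  at \<open>t = 0\<close> gives \<open>\<integral> \<partial>\<^sub>j u = 0\<close>.
\<close>

lemma integral_partial_deriv_UNIV:
  fixes u :: "real^'n \<Rightarrow> real"
  assumes u: "Ck (Suc 0) UNIV u" and K: "compact K" "\<And>x. x \<notin> K \<Longrightarrow> u x = 0"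
  shows "integral UNIV (partial_deriv j u) = 0"
proof -
  obtain B where B: "\<And>x. x \<in> K \<Longrightarrow> norm x \<le> B"
    using compact_imp_bounded[OF K(1)] by (auto simp: bounded_iff)
  \<comment> \<open>A margin of \<open>1\<close> around the support, so that translations by less than \<open>1\<close> stay in the box.\<close>
  define a b where "a = (\<chi> i::'n. - (B + 1))" and "b = (\<chi> i::'n. B + 1)"
  have inbox: "x \<in> cbox a b" if "norm x \<le> B + 1" for x
  proof -
    have "- (B + 1) \<le> x $ i \<and> x $ i \<le> B + 1" for i
      using component_le_norm_cart[of x i] that by linarith
    then show ?thesis by (simp add: mem_box_cart a_def b_def)
  qed
  have Cc: "Cc_on UNIV u" using K Ck_continuous[OF u] by (intro Cc_onI[of _ _ K]) auto
  have pz: "partial_deriv j u x = 0" if "x \<notin> K" for x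
    using partial_deriv_cong[of "- K" x u "\<lambda>x. 0" j] K that
    by (auto simp: compact_imp_closed open_Compl partial_deriv_def)
  let ?F = "\<lambda>t. integral (cbox a b) (\<lambda>x. u (x + t *\<^sub>R axis j 1))"
  have F: "?F t = integral UNIV u" if "t \<in> ball 0 1" for t
  proof -
    have "integral (cbox a b) (\<lambda>x. u (x + t *\<^sub>R axis j 1)) = integral UNIV (\<lambda>x. u (x + t *\<^sub>R axis j 1))"
    proof (rule integral_eq_integral_UNIV, rule ccontr)
      fix x assume x: "x \<notin> cbox a b" "u (x + t *\<^sub>R axis j 1) \<noteq> 0"
      then have "norm (x + t *\<^sub>R axis j 1) \<le> B" using B K by blast
      moreover have "norm x \<le> norm (x + t *\<^sub>R axis j 1) + norm (t *\<^sub>R axis j (1::real))"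
        by (metis add_diff_cancel_right' norm_triangle_ineq4)
      moreover have "norm (t *\<^sub>R axis j (1::real)) \<le> 1" using that by (simp add: dist_norm)
      ultimately show False using inbox[of x] x by simp
    qed
    then show ?thesis using integral_translation_UNIV(1)[OF Cc] by simp
  qed
  have "(?F has_field_derivative integral (cbox a b) (\<lambda>x. partial_deriv j u (x + 0 *\<^sub>R axis j 1))) (at 0 within ball 0 1)"
  proof (rule leibniz_rule_field_derivative)
    fix t x
    have "((\<lambda>s. u ((x + t *\<^sub>R axis j 1) + s *\<^sub>R axis j 1)) has_field_derivative
        partial_deriv j u (x + t *\<^sub>R axis j 1)) (at 0)"
      by (rule Ck_has_partial[OF u]) simp
    then have "((\<lambda>s. u ((x + t *\<^sub>R axis j 1) + (s - t) *\<^sub>R axis j 1)) has_field_derivative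
        partial_deriv j u (x + t *\<^sub>R axis j 1)) (at t)"
      using DERIV_shift[of "\<lambda>s. u ((x + t *\<^sub>R axis j 1) + (s - t) *\<^sub>R axis j 1)" "partial_deriv j u (x + t *\<^sub>R axis j 1)" 0 t]
      by (simp add: add.commute)
    then show "((\<lambda>s. u (x + s *\<^sub>R axis j 1)) has_field_derivative partial_deriv j u (x + t *\<^sub>R axis j 1)) (at t within ball 0 1)"
      by (simp add: algebra_simps has_field_derivative_at_within)
  next
    fix t :: real
    show "(\<lambda>x. u (x + t *\<^sub>R axis j 1)) integrable_on cbox a b"
      by (intro integrable_continuous continuous_on_compose2[OF Ck_continuous[OF u], of _ "\<lambda>x. x + t *\<^sub>R axis j 1"])
        (auto intro!: continuous_intros)
  next
    have "continuous_on UNIV (partial_deriv j u)" using Ck_continuous[OF Ck_partial[OF u]] .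
    then show "continuous_on (ball 0 1 \<times> cbox a b) (\<lambda>(t, x). partial_deriv j u (x + t *\<^sub>R axis j 1))"
      unfolding split_def
      by (rule continuous_on_compose2) (auto intro!: continuous_intros)
  qed auto
  then have d1: "(?F has_field_derivative integral (cbox a b) (partial_deriv j u)) (at 0)"
    by (subst (asm) at_within_open) auto
  have "(?F has_field_derivative 0) (at 0)"
    by (rule has_field_derivative_transform_within_open[of "\<lambda>_. integral UNIV u" _ _ "ball 0 1"]) (use F in auto)
  with d1 have "integral (cbox a b) (partial_deriv j u) = 0"
    using DERIV_unique by blast
  moreover have "integral (cbox a b) (partial_deriv j u) = integral UNIV (partial_deriv j u)"
  proof (rule integral_eq_integral_UNIV, rule ccontr)
    fix x assume "x \<notin> cbox a b" "partial_deriv j u x \<noteq> 0"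
    then show False using inbox[of x] B[of x] pz[of x] by force
  qed
  ultimately show ?thesis by simp
qed

text \<open>
  The divergence theorem for one coordinate, in the form in which it is used in charts.
\<close>

lemma integral_partial_deriv_eq_0:
  fixes u :: "real^'n \<Rightarrow> real"
  assumes S: "open S" and u: "Ck (Suc 0) S u" and K: "compact K" "K \<subseteq> S" "\<And>x. x \<in> S \<Longrightarrow> x \<notin> K \<Longrightarrow> u x = 0"
  shows "integral S (partial_deriv j u) = 0"
proof -
  let ?u = "\<lambda>x. if x \<in> S then u x else 0"
  have "integral UNIV (partial_deriv j ?u) = 0"
    using Ck_zero_extension[OF S u K] K by (intro integral_partial_deriv_UNIV[of _ K]) auto
  moreover have "partial_deriv j ?u x = (if x \<in> S then partial_deriv j u x else 0)" for x
  proof (cases "x \<in> S")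
    case True
    then show ?thesis using partial_deriv_cong[OF S True, of ?u u j] by simp
  next
    case False
    then have "partial_deriv j ?u x = partial_deriv j (\<lambda>x. 0) x"
      using K by (intro partial_deriv_cong[of "- K"]) (auto simp: compact_imp_closed open_Compl)
    then show ?thesis using False by (simp add: partial_deriv_def)
  qed
  then have "partial_deriv j ?u = (\<lambda>x. if x \<in> S then partial_deriv j u x else 0)" by auto
  ultimately show ?thesis by (simp add: integral_restrict_UNIV)
qed

section \<open>Integration over the fibres of a coordinate projection\<close>

text \<open>
  A symmetric involution that permutes the standard basis maps boxes to boxes with the same side
  lengths, hence preserves Lebesgue measure.
\<close>

lemma lborel_distr_basis_involution:
  fixes T :: "'a::euclidean_space \<Rightarrow> 'a"
  assumes [measurable]: "T \<in> borel_measurable borel" and inv: "\<And>x. T (T x) = x"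
    and adj: "\<And>x y. T x \<bullet> y = x \<bullet> T y"
    and bas: "\<And>b. b \<in> Basis \<Longrightarrow> T b \<in> Basis"
  shows "distr lborel borel T = lborel"
proof (rule lborel_eqI[symmetric])
  fix l u :: 'a assume le: "\<And>b. b \<in> Basis \<Longrightarrow> l \<bullet> b \<le> u \<bullet> b"
  have bij: "bij_betw T Basis Basis"
    by (rule bij_betwI[of _ _ _ T]) (use inv bas in auto)
  have "T -` box l u = box (T l) (T u)"
  proof -
    have "T x \<in> box l u \<longleftrightarrow> x \<in> box (T l) (T u)" for x
    proof -
      have "T x \<in> box l u \<longleftrightarrow> (\<forall>b\<in>T ` Basis. l \<bullet> b < T x \<bullet> b \<and> T x \<bullet> b < u \<bullet> b)"
        using bij by (simp add: mem_box bij_betw_def)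
      also have "\<dots> \<longleftrightarrow> x \<in> box (T l) (T u)"
        using adj inv by (simp add: mem_box)
      finally show ?thesis .
    qed
    then show ?thesis by auto
  qed
  then have "emeasure (distr lborel borel T) (box l u) = emeasure lborel (box (T l) (T u))"
    by (subst emeasure_distr) auto
  also have "\<dots> = (\<Prod>b\<in>Basis. (T u - T l) \<bullet> b)"
    using le bas by (intro emeasure_lborel_box) (auto simp: adj)
  also have "(\<Prod>b\<in>Basis. (T u - T l) \<bullet> b) = (\<Prod>b\<in>Basis. (u - l) \<bullet> T b)"
    by (simp add: inner_diff_left adj)
  also have "\<dots> = (\<Prod>b\<in>Basis. (u - l) \<bullet> b)"
    using prod.reindex_bij_betw[OF bij] .
  finally show "emeasure (distr lborel borel T) (box l u) = ennreal (\<Prod>b\<in>Basis. (u - l) \<bullet> b)" by simp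
qed simp

text \<open>
  An injection \<open>\<sigma>\<close> of index sets selects coordinates of \<open>\<real>\<^sup>m\<close>. Then \<open>coord_proj \<sigma>\<close> reads off the
  selected coordinates, and \<open>coord_merge \<sigma> x y\<close> is \<open>y\<close> with its selected coordinates overwritten by
  those of \<open>x\<close>; the fibre of \<open>coord_proj \<sigma>\<close> over \<open>x\<close> is the range of \<open>coord_merge \<sigma> x\<close>. Keeping all
  coordinates of \<open>y\<close> avoids a type for the complementary indices, of which there may be none.
\<close>

definition coord_proj :: "('n \<Rightarrow> 'm) \<Rightarrow> real^'m \<Rightarrow> real^'n" where
  "coord_proj \<sigma> z = (\<chi> i. z $ \<sigma> i)"

definition coord_merge :: "('n \<Rightarrow> 'm) \<Rightarrow> real^'n \<Rightarrow> real^'m \<Rightarrow> real^'m" where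
  "coord_merge \<sigma> x y = (\<chi> k. if k \<in> range \<sigma> then x $ (inv \<sigma> k) else y $ k)"

lemma coord_proj_nth [simp]: "coord_proj \<sigma> z $ i = z $ \<sigma> i" by (simp add: coord_proj_def)

lemma coord_merge_nth_range [simp]: "inj \<sigma> \<Longrightarrow> coord_merge \<sigma> x y $ \<sigma> i = x $ i"
  by (simp add: coord_merge_def)

lemma coord_merge_nth_compl [simp]: "k \<notin> range \<sigma> \<Longrightarrow> coord_merge \<sigma> x y $ k = y $ k"
  by (simp add: coord_merge_def)

lemma coord_proj_merge [simp]: "inj \<sigma> \<Longrightarrow> coord_proj \<sigma> (coord_merge \<sigma> x y) = x"
  by (simp add: vec_eq_iff)

lemma coord_merge_eqI:
  assumes "inj \<sigma>" "\<And>i. x $ i = z $ \<sigma> i" "\<And>k. k \<notin> range \<sigma> \<Longrightarrow> y $ k = z $ k"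
  shows "coord_merge \<sigma> x y = z"
  unfolding vec_eq_iff
proof
  fix k show "coord_merge \<sigma> x y $ k = z $ k"
    using assms by (cases "k \<in> range \<sigma>") auto
qed

lemma coord_merge_proj [simp]: "inj \<sigma> \<Longrightarrow> coord_merge \<sigma> (coord_proj \<sigma> z) z = z"
  by (rule coord_merge_eqI) auto

lemma coord_merge_merge [simp]: "inj \<sigma> \<Longrightarrow> coord_merge \<sigma> x (coord_merge \<sigma> x' y) = coord_merge \<sigma> x y"
  by (rule coord_merge_eqI) auto

lemma coord_merge_shift: "inj \<sigma> \<Longrightarrow> coord_merge \<sigma> (x + t *\<^sub>R axis j 1) y = coord_merge \<sigma> x y + t *\<^sub>R axis (\<sigma> j) 1"
  by (rule coord_merge_eqI) (auto simp: axis_def inj_eq)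

lemma continuous_on_coord_proj [continuous_intros]:
  "continuous_on S f \<Longrightarrow> continuous_on S (\<lambda>x. coord_proj \<sigma> (f x))"
  unfolding coord_proj_def by (intro continuous_intros)

lemma continuous_on_coord_proj_id: "continuous_on S (coord_proj \<sigma>)"
  using continuous_on_coord_proj[OF continuous_on_id, of S \<sigma>] .

lemma continuous_on_coord_merge [continuous_intros]:
  assumes "continuous_on S f" "continuous_on S g"
  shows "continuous_on S (\<lambda>x. coord_merge \<sigma> (f x) (g x))"
proof -
  have "continuous_on S (\<lambda>x. if k \<in> range \<sigma> then f x $ (inv \<sigma> k) else g x $ k)" for k
    by (cases "k \<in> range \<sigma>") (use assms in \<open>auto intro!: continuous_intros\<close>)
  then show ?thesis unfolding coord_merge_def by (rule continuous_on_vec_lambda)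
qed

text \<open>
  The map exchanges the coordinates of \<open>x\<close> with the selected coordinates of \<open>y\<close>.
\<close>

lemma lborel_distr_merge:
  fixes \<sigma> :: "'n::finite \<Rightarrow> 'm::finite"
  assumes "inj \<sigma>"
  shows "distr lborel borel (\<lambda>(x, y). (coord_proj \<sigma> y, coord_merge \<sigma> x y)) = (lborel :: ((real^'n) \<times> (real^'m)) measure)"
proof (rule lborel_distr_basis_involution)
  let ?T = "\<lambda>(x :: real^'n, y :: real^'m). (coord_proj \<sigma> y, coord_merge \<sigma> x y)"
  show "?T \<in> borel_measurable borel"
    unfolding split_def by (intro borel_measurable_continuous_onI continuous_intros)
  show "?T (?T p) = p" for p
    using assms by (cases p) simp
  show "?T p \<bullet> q = p \<bullet> ?T q" for p q
  proof -
    obtain x y x' y' where pq: "p = (x, y)" "q = (x', y')" by (cases p, cases q) auto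
    have m: "coord_merge \<sigma> x y \<bullet> y' = (\<Sum>i\<in>UNIV. x $ i * y' $ \<sigma> i) + (\<Sum>k\<in>- range \<sigma>. y $ k * y' $ k)"
      for x :: "real^'n" and y y' :: "real^'m"
    proof -
      have "coord_merge \<sigma> x y \<bullet> y' = (\<Sum>k\<in>range \<sigma> \<union> - range \<sigma>. coord_merge \<sigma> x y $ k * y' $ k)"
        by (simp add: inner_vec_def)
      also have "\<dots> = (\<Sum>k\<in>range \<sigma>. coord_merge \<sigma> x y $ k * y' $ k) + (\<Sum>k\<in>- range \<sigma>. coord_merge \<sigma> x y $ k * y' $ k)"
        by (rule sum.union_disjoint) auto
      also have "(\<Sum>k\<in>range \<sigma>. coord_merge \<sigma> x y $ k * y' $ k) = (\<Sum>i\<in>UNIV. x $ i * y' $ \<sigma> i)"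
        using assms by (simp add: sum.reindex)
      finally show ?thesis by simp
    qed
    have "?T p \<bullet> q = coord_proj \<sigma> y \<bullet> x' + coord_merge \<sigma> x y \<bullet> y'" by (simp add: pq)
    also have "\<dots> = x \<bullet> coord_proj \<sigma> y' + coord_merge \<sigma> x' y' \<bullet> y"
      unfolding m by (simp add: inner_vec_def mult.commute)
    finally show ?thesis by (simp add: pq inner_commute)
  qed
  show "?T b \<in> Basis" if b: "b \<in> Basis" for b
  proof -
    consider i where "b = (axis i 1, 0)" | i where "b = (0, axis (\<sigma> i) 1)" | k where "k \<notin> range \<sigma>" "b = (0, axis k 1)"
    proof -
      from b consider i where "b = (axis i 1, 0)" | k where "b = (0, axis k 1)"
        by (auto simp: Basis_prod_def Basis_vec_def)
      then show ?thesis using that by (cases; blast)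
    qed
    then show ?thesis
    proof cases
      case 1
      then have "coord_merge \<sigma> (axis i 1) 0 = axis (\<sigma> i) 1"
        using assms by (intro coord_merge_eqI) (auto simp: axis_def inj_eq)
      moreover have "coord_proj \<sigma> 0 = 0" by (simp add: vec_eq_iff)
      ultimately show ?thesis using 1 by (simp add: Basis_prod_def axis_in_Basis_iff)
    next
      case 2
      then have "coord_merge \<sigma> 0 (axis (\<sigma> i) 1) = 0"
        using assms by (intro coord_merge_eqI) (auto simp: axis_def inj_eq)
      moreover have "coord_proj \<sigma> (axis (\<sigma> i) 1) = axis i 1" using assms by (auto simp: vec_eq_iff axis_def inj_eq)
      ultimately show ?thesis using 2 by (simp add: Basis_prod_def axis_in_Basis_iff)
    next
      case 3
      then have "coord_merge \<sigma> 0 (axis k 1) = axis k 1"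
        using assms by (intro coord_merge_eqI) (auto simp: axis_def)
      moreover have "coord_proj \<sigma> (axis k 1) = 0" using 3 by (auto simp: vec_eq_iff axis_def)
      ultimately show ?thesis using 3 by (simp add: Basis_prod_def axis_in_Basis_iff)
    qed
  qed
qed

text \<open>
  Fubini's theorem for the fibres of \<open>coord_proj \<sigma>\<close>. The selected coordinates of \<open>y\<close> have no influence on
  \<open>coord_merge \<sigma> x y\<close>; letting them range over a unit cube contributes the factor \<open>1\<close>, so the inner
  integral is an integral over the fibre.
\<close>

lemma integral_fibrewise:
  fixes \<sigma> :: "'n::finite \<Rightarrow> 'm::finite" and b :: "real^'m \<Rightarrow> real"
  assumes inj: "inj \<sigma>" and b: "Cc_on UNIV b"
    and lo: "\<And>i. lo $ \<sigma> i = 0" and hi: "\<And>i. hi $ \<sigma> i = 1"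
    and supp: "\<And>z k. b z \<noteq> 0 \<Longrightarrow> k \<notin> range \<sigma> \<Longrightarrow> lo $ k \<le> z $ k \<and> z $ k \<le> hi $ k"
  shows "integral UNIV b = integral UNIV (\<lambda>x. integral (cbox lo hi) (\<lambda>y. b (coord_merge \<sigma> x y)))"
proof -
  have [measurable]: "b \<in> borel_measurable borel"
    using b by (auto simp: Cc_on_def intro: borel_measurable_continuous_onI)
  have contb: "continuous_on UNIV b" using b by (simp add: Cc_on_def)
  \<comment> \<open>\<open>F\<close> has integral \<open>\<integral> b\<close> over the product space, and the exchange of coordinates \<open>?T\<close> turns its
      integral into the iterated one.\<close>
  define C where "C = cbox (0::real^'n) (\<chi> i. 1)"
  define F :: "(real^'n) \<times> (real^'m) \<Rightarrow> real" where "F = (\<lambda>(x, y). indicator C x * b y)"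
  let ?T = "\<lambda>(x :: real^'n, y :: real^'m). (coord_proj \<sigma> y, coord_merge \<sigma> x y)"
  have T[measurable]: "?T \<in> borel_measurable borel"
    unfolding split_def by (intro borel_measurable_continuous_onI continuous_intros)
  have C: "C \<in> sets borel" "emeasure lborel C = 1"
    by (auto simp: C_def emeasure_lborel_cbox_eq Basis_vec_def inner_axis intro!: prod.neutral)
  have iC: "integrable lborel (indicator C :: _ \<Rightarrow> real)"
    using C by (intro integrable_real_indicator) auto
  have ib: "integrable lborel b" by (rule Cc_on_integrable_lborel[OF b])
  have Fm: "F \<in> borel_measurable (lborel \<Otimes>\<^sub>M lborel)"
    unfolding F_def using C by measurable
  have iF: "integrable (lborel \<Otimes>\<^sub>M lborel) F"
  proof (rule lborel_pair.Fubini_integrable[OF Fm])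
    show "integrable lborel (\<lambda>x. \<integral>y. norm (F (x, y)) \<partial>lborel)"
      using iC by (simp add: F_def abs_mult)
    show "AE x in lborel. integrable lborel (\<lambda>y. F (x, y))"
      using ib by (simp add: F_def)
  qed
  have "integral\<^sup>L (lborel \<Otimes>\<^sub>M lborel) F = (\<integral>x. \<integral>y. F (x, y) \<partial>lborel \<partial>lborel)"
    by (rule lborel_pair.integral_fst'[OF iF, symmetric])
  also have "\<dots> = integral\<^sup>L lborel b"
    using C by (simp add: F_def measure_def)
  finally have F1: "integral\<^sup>L lborel F = integral\<^sup>L lborel b" by (simp add: lborel_prod)
  have Fm': "F \<in> borel_measurable borel" using Fm by (simp add: lborel_prod)
  have FT: "integral\<^sup>L lborel (\<lambda>p. F (?T p)) = integral\<^sup>L lborel F"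
    using integral_distr[of ?T lborel borel F] Fm' T by (simp add: lborel_distr_merge[OF inj])
  have iFT: "integrable lborel (\<lambda>p. F (?T p))"
    using integrable_distr_eq[of ?T lborel borel F] Fm' T iF by (simp add: lborel_distr_merge[OF inj] lborel_prod)
  have box: "F (?T (x, y)) = indicator (cbox lo hi) y *\<^sub>R b (coord_merge \<sigma> x y)" for x y
  proof -
    have "coord_proj \<sigma> y \<in> C \<longleftrightarrow> y \<in> cbox lo hi" if nz: "b (coord_merge \<sigma> x y) \<noteq> 0"
    proof -
      have "lo $ k \<le> y $ k \<and> y $ k \<le> hi $ k" if "k \<notin> range \<sigma>" for k
        using supp[OF nz that] that by simp
      moreover have "y \<in> cbox lo hi \<longleftrightarrow> (\<forall>k\<in>range \<sigma> \<union> - range \<sigma>. lo $ k \<le> y $ k \<and> y $ k \<le> hi $ k)"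
        by (simp add: mem_box_cart)
      ultimately have "y \<in> cbox lo hi \<longleftrightarrow> (\<forall>i. lo $ \<sigma> i \<le> y $ \<sigma> i \<and> y $ \<sigma> i \<le> hi $ \<sigma> i)"
        unfolding ball_Un by blast
      then show ?thesis by (simp add: C_def mem_box_cart lo hi)
    qed
    then show ?thesis by (auto simp: F_def indicator_def)
  qed
  have inner: "(\<integral>y. F (?T (x, y)) \<partial>lborel) = integral (cbox lo hi) (\<lambda>y. b (coord_merge \<sigma> x y))" for x
  proof -
    have "set_integrable lborel (cbox lo hi) (\<lambda>y. b (coord_merge \<sigma> x y))"
      unfolding set_integrable_def
      by (intro borel_integrable_compact compact_cbox continuous_on_compose2[OF contb, of _ "coord_merge \<sigma> x"])
        (auto intro!: continuous_intros)
    then show ?thesis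
      unfolding box using set_borel_integral_eq_integral(2)[of "cbox lo hi" "\<lambda>y. b (coord_merge \<sigma> x y)"]
      by (simp add: set_lebesgue_integral_def)
  qed
  have iFT': "integrable (lborel \<Otimes>\<^sub>M lborel) (\<lambda>p. F (?T p))" using iFT by (simp add: lborel_prod)
  have "integral\<^sup>L lborel (\<lambda>p. F (?T p)) = (\<integral>x. \<integral>y. F (?T (x, y)) \<partial>lborel \<partial>lborel)"
    using lborel_pair.integral_fst'[OF iFT'] by (simp add: lborel_prod)
  also have "\<dots> = (\<integral>x. integral (cbox lo hi) (\<lambda>y. b (coord_merge \<sigma> x y)) \<partial>lborel)"
    using inner by simp
  also have "\<dots> = integral UNIV (\<lambda>x. integral (cbox lo hi) (\<lambda>y. b (coord_merge \<sigma> x y)))"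
    using lborel_pair.integrable_fst'[OF iFT'] inner by (intro integral_lborel[symmetric]) simp
  finally show ?thesis using F1 FT ib by (simp add: integral_lborel)
qed

text \<open>
  A partial derivative of the parameter integral is the parameter integral of a partial derivative, so
  the regularity of the integrand passes to the integral by induction.
\<close>

lemma Ck_integral_param:
  fixes \<sigma> :: "'n::finite \<Rightarrow> 'm::finite" and a :: "real^'m \<Rightarrow> real"
  assumes inj: "inj \<sigma>" and V: "open V" and "Ck k {z. coord_proj \<sigma> z \<in> V} a"
  shows "Ck k V (\<lambda>x. integral (cbox lo hi) (\<lambda>y. a (coord_merge \<sigma> x y)))"
  using assms(3)
proof (induction k arbitrary: a)
  case 0
  then have a: "continuous_on {z. coord_proj \<sigma> z \<in> V} a" by simp
  have "continuous_on (V \<times> cbox lo hi) (\<lambda>(x, y). a (coord_merge \<sigma> x y))"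
    unfolding split_def by (rule continuous_on_compose2[OF a]) (use inj in \<open>auto intro!: continuous_intros\<close>)
  then show ?case by (simp add: integral_continuous_on_param)
next
  case (Suc k)
  have c: "continuous_on (V \<times> cbox lo hi) (\<lambda>(x, y). a (coord_merge \<sigma> x y))"
    unfolding split_def
    by (rule continuous_on_compose2[OF Ck_continuous[OF Suc.prems]]) (use inj in \<open>auto intro!: continuous_intros\<close>)
  show ?case
  proof (rule Ck_SucI[OF V])
    show "continuous_on V (\<lambda>x. integral (cbox lo hi) (\<lambda>y. a (coord_merge \<sigma> x y)))"
      using c by (rule integral_continuous_on_param)
    show "Ck k V (\<lambda>x. integral (cbox lo hi) (\<lambda>y. partial_deriv (\<sigma> j) a (coord_merge \<sigma> x y)))" for j
      by (rule Suc.IH[OF Ck_partial[OF Suc.prems]])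
    fix x j assume x: "x \<in> V"
    obtain d where d: "d > 0" "\<And>t::real. \<bar>t\<bar> < d \<Longrightarrow> x + t *\<^sub>R axis j 1 \<in> V"
      using eventually_line_in_open[OF V x, of "axis j 1"] by (auto simp: eventually_nhds_metric)
    have "((\<lambda>t. integral (cbox lo hi) (\<lambda>y. a (coord_merge \<sigma> (x + t *\<^sub>R axis j 1) y))) has_field_derivative
       integral (cbox lo hi) (\<lambda>y. partial_deriv (\<sigma> j) a (coord_merge \<sigma> (x + 0 *\<^sub>R axis j 1) y))) (at 0 within ball 0 d)"
    proof (rule leibniz_rule_field_derivative)
      fix t :: real and y assume t: "t \<in> ball 0 d"
      let ?z = "coord_merge \<sigma> (x + t *\<^sub>R axis j 1) y"
      have "((\<lambda>s. a (?z + s *\<^sub>R axis (\<sigma> j) 1)) has_field_derivative partial_deriv (\<sigma> j) a ?z) (at 0)"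
        using d(2)[of t] t inj by (intro Ck_has_partial[OF Suc.prems]) auto
      then have "((\<lambda>s. a (?z + (s - t) *\<^sub>R axis (\<sigma> j) 1)) has_field_derivative partial_deriv (\<sigma> j) a ?z) (at t)"
        using DERIV_shift[of "\<lambda>s. a (?z + (s - t) *\<^sub>R axis (\<sigma> j) 1)" "partial_deriv (\<sigma> j) a ?z" 0 t]
        by (simp add: add.commute)
      then show "((\<lambda>t. a (coord_merge \<sigma> (x + t *\<^sub>R axis j 1) y)) has_field_derivative partial_deriv (\<sigma> j) a ?z) (at t within ball 0 d)"
        by (simp add: coord_merge_shift[OF inj] algebra_simps has_field_derivative_at_within)
    next
      fix t :: real assume t: "t \<in> ball 0 d"
      have "continuous_on (cbox lo hi) (\<lambda>y. (x + t *\<^sub>R axis j 1, y))"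
        by (intro continuous_intros)
      moreover have "(\<lambda>y. (x + t *\<^sub>R axis j 1, y)) ` cbox lo hi \<subseteq> V \<times> cbox lo hi"
        using d(2)[of t] t by auto
      ultimately have "continuous_on (cbox lo hi) (\<lambda>y. a (coord_merge \<sigma> (x + t *\<^sub>R axis j 1) y))"
        using continuous_on_compose2[OF c] by fastforce
      then show "(\<lambda>y. a (coord_merge \<sigma> (x + t *\<^sub>R axis j 1) y)) integrable_on cbox lo hi"
        by (rule integrable_continuous)
    next
      show "continuous_on (ball 0 d \<times> cbox lo hi) (\<lambda>(t, y). partial_deriv (\<sigma> j) a (coord_merge \<sigma> (x + t *\<^sub>R axis j 1) y))"
        unfolding split_def
        by (rule continuous_on_compose2[OF Ck_continuous[OF Ck_partial[OF Suc.prems]]])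
           (use inj d(2) in \<open>auto intro!: continuous_intros\<close>)
    qed (use d in auto)
    then show "((\<lambda>t. integral (cbox lo hi) (\<lambda>y. a (coord_merge \<sigma> (x + t *\<^sub>R axis j 1) y))) has_field_derivative
       integral (cbox lo hi) (\<lambda>y. partial_deriv (\<sigma> j) a (coord_merge \<sigma> x y))) (at 0)"
      using d(1) by (subst (asm) at_within_open) auto
  qed
qed

text \<open>
  The change of variables formula for scalar functions, obtained from the one for vectors of
  length \<open>1\<close>.
\<close>

lemma integral_change_of_variables_real:
  fixes w :: "real^'m::{finite,wellorder} \<Rightarrow> real" and g :: "real^'m::_ \<Rightarrow> real^'m::_"
  assumes S: "open S"
    and der: "\<And>x. x \<in> S \<Longrightarrow> (g has_derivative g' x) (at x)"
    and inj: "inj_on g S"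
    and w: "w absolutely_integrable_on (g ` S)"
  shows "integral (g ` S) w = integral S (\<lambda>x. \<bar>det (matrix (g' x))\<bar> * w (g x))"
proof -
  have "integral (g ` S) (\<lambda>x. vec (w x) :: real^1) = integral S (\<lambda>x. \<bar>det (matrix (g' x))\<bar> *\<^sub>R (vec (w (g x)) :: real^1))"
  proof (rule integral_change_of_variables)
    show "S \<in> sets lebesgue" using S by (simp add: borel_open sets_completionI_sets)
    show "(g has_derivative g' x) (at x within S)" if "x \<in> S" for x
      using der[OF that] by (rule has_derivative_at_withinI)
    show "(\<lambda>x. vec (w x) :: real^1) absolutely_integrable_on g ` S \<or>
      (\<lambda>x. \<bar>det (matrix (g' x))\<bar> *\<^sub>R (vec (w (g x)) :: real^1)) absolutely_integrable_on S"
      using w by (simp add: absolutely_integrable_on_1_iff)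
  qed (use inj in auto)
  then show ?thesis
    by (simp add: integral_on_1_eq vec_eq_iff)
qed

section \<open>The inverse function theorem and submersions\<close>

definition jac :: "(real^'m::finite \<Rightarrow> real^'n::finite) \<Rightarrow> real^'m \<Rightarrow> real^'m^'n" where
  "jac \<Phi> x = (\<chi> i j. partial_deriv j (\<lambda>x. \<Phi> x $ i) x)"

lemma has_derivative_jac:
  fixes \<Phi> :: "real^'m \<Rightarrow> real^'n"
  assumes "\<And>i. Ck (Suc k) S (\<lambda>x. \<Phi> x $ i)" "open S" "x \<in> S"
  shows "(\<Phi> has_derivative ((*v) (jac \<Phi> x))) (at x)"
  using Ck_has_derivative_vec[OF assms] by (simp add: jac_def)

lemma continuous_on_components:
  fixes \<Phi> :: "'a::topological_space \<Rightarrow> real^'n"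
  assumes "\<And>i. continuous_on S (\<lambda>x. \<Phi> x $ i)"
  shows "continuous_on S \<Phi>"
proof -
  have "continuous_on S (\<lambda>x. \<chi> i. \<Phi> x $ i)" by (rule continuous_on_vec_lambda) (rule assms)
  then show ?thesis by simp
qed

text \<open>
  By Cramer's rule the partial derivatives of the local inverse \<open>\<Psi>\<close> are rational functions of the
  entries of the Jacobian matrix of \<open>\<Phi>\<close>, evaluated along \<open>\<Psi>\<close>. Hence \<open>\<Psi>\<close> is of class \<open>C\<^sup>k\<^sup>+\<^sup>1\<close> once it
  is of class \<open>C\<^sup>k\<close>.
\<close>

lemma Ck_inverse_function:
  fixes \<Phi> :: "real^'m \<Rightarrow> real^'m"
  assumes W: "open W" "x0 \<in> W" and \<Phi>: "\<And>k i. Ck k W (\<lambda>x. \<Phi> x $ i)" and det: "det (jac \<Phi> x0) \<noteq> 0"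
  obtains W' \<Psi> where "open W'" "x0 \<in> W'" "W' \<subseteq> W" "open (\<Phi> ` W')" "\<And>x. x \<in> W' \<Longrightarrow> \<Psi> (\<Phi> x) = x"
    "\<And>x. x \<in> W' \<Longrightarrow> det (jac \<Phi> x) \<noteq> 0" "\<And>k i. Ck k (\<Phi> ` W') (\<lambda>z. \<Psi> z $ i)"
proof -
  define f' where "f' x = Blinfun ((*v) (jac \<Phi> x))" for x
  have f'_apply: "blinfun_apply (f' x) v = jac \<Phi> x *v v" for x v
    unfolding f'_def by (simp add: bounded_linear_Blinfun_apply matrix_vector_mul_bounded_linear)
  have contJ: "continuous_on W (\<lambda>x. jac \<Phi> x $ i $ j)" for i j
    using Ck_continuous[OF Ck_partial[OF \<Phi>]] by (simp add: jac_def)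
  have "invertible (jac \<Phi> x0)" using det by (simp add: invertible_det_nz)
  then obtain B where B: "B ** jac \<Phi> x0 = mat 1" by (auto simp: invertible_def)
  obtain U' V \<Psi> g' where U': "open U'" "U' \<subseteq> W" "x0 \<in> U'" "open V" "homeomorphism U' V \<Phi> \<Psi>"
    and g': "\<And>y. y \<in> V \<Longrightarrow> (\<Psi> has_derivative (g' y)) (at y)"
      "\<And>y. y \<in> V \<Longrightarrow> g' y = inv (blinfun_apply (f' (\<Psi> y)))"
      "\<And>y. y \<in> V \<Longrightarrow> bij (blinfun_apply (f' (\<Psi> y)))"
  proof (rule inverse_function_theorem[of W \<Phi> f' x0 "Blinfun ((*v) B)"])
    show "(\<Phi> has_derivative blinfun_apply (f' x)) (at x)" if "x \<in> W" for x
      using has_derivative_jac[of 0, OF \<Phi> W(1) that] by (simp add: f'_apply[abs_def] fun_eq_iff)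
    show "continuous_on W f'"
    proof (rule continuous_on_blinfun_componentwise)
      fix b :: "real^'m" assume "b \<in> Basis"
      show "continuous_on W (\<lambda>x. blinfun_apply (f' x) b)"
        unfolding f'_apply matrix_vector_mult_def
        by (intro continuous_on_vec_lambda continuous_on_sum continuous_on_mult continuous_on_const contJ)
    qed
    show "Blinfun ((*v) B) o\<^sub>L f' x0 = id_blinfun"
      by (rule blinfun_eqI)
         (simp add: f'_apply bounded_linear_Blinfun_apply matrix_vector_mul_bounded_linear matrix_vector_mul_assoc B)
  qed (use W in auto)
  have V: "V = \<Phi> ` U'" and \<Psi>: "\<And>x. x \<in> U' \<Longrightarrow> \<Psi> (\<Phi> x) = x" "\<And>y. y \<in> V \<Longrightarrow> \<Psi> y \<in> U'" "continuous_on V \<Psi>"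
    using U'(5) by (auto simp: homeomorphism_def)
  have detV: "det (jac \<Phi> (\<Psi> y)) \<noteq> 0" if "y \<in> V" for y
  proof -
    have "inj ((*v) (jac \<Phi> (\<Psi> y)))"
      using g'(3)[OF that] by (simp add: f'_apply[abs_def] bij_def)
    then show ?thesis by (metis invertible_det_nz invertible_left_inverse matrix_left_invertible_injective)
  qed
  have Ck\<Psi>: "Ck k V (\<lambda>z. \<Psi> z $ i)" for k i
  proof (induction k arbitrary: i)
    case 0
    show ?case using \<Psi>(3) by (auto intro!: continuous_intros)
  next
    case (Suc k)
    \<comment> \<open>Cramer's rule for entry \<open>i\<close> of the solution of \<open>jac \<Phi> (\<Psi> y) *v v = axis j 1\<close>\<close>
    define D where "D j y = det (\<chi> a b. if b = i then axis j 1 $ a else jac \<Phi> (\<Psi> y) $ a $ b) / det (jac \<Phi> (\<Psi> y))"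
      for j y
    show ?case
    proof (rule Ck_SucI[OF U'(4)])
      show "continuous_on V (\<lambda>z. \<Psi> z $ i)" using \<Psi>(3) by (auto intro!: continuous_intros)
      have entry: "Ck k V (\<lambda>y. jac \<Phi> (\<Psi> y) $ a $ b)" for a b
        using \<Psi>(2) U'(2) Suc.IH Ck_partial[OF \<Phi>] U'(4) W(1)
        by (intro Ck_compose[of V W \<Psi> k "\<lambda>x. jac \<Phi> x $ a $ b"]) (auto simp: jac_def)
      show "Ck k V (D j)" for j
        unfolding D_def
      proof (intro Ck_divide Ck_det U'(4) entry detV)
        show "Ck k V (\<lambda>x. (\<chi> a b. if b = i then axis j 1 $ a else jac \<Phi> (\<Psi> x) $ a $ b) $ a $ b)" for a b
          by (cases "b = i") (auto intro: entry Ck_const)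
      qed
      fix j y assume y: "y \<in> V"
      have "((\<lambda>z. \<Psi> z $ i) has_derivative (\<lambda>v. g' y v $ i)) (at y)"
        using g'(1)[OF y] by (rule bounded_linear.has_derivative[OF bounded_linear_vec_nth])
      then have d: "((\<lambda>t. \<Psi> (y + t *\<^sub>R axis j 1) $ i) has_field_derivative g' y (axis j 1) $ i) (at 0)"
        by (rule has_derivative_has_partial)
      have "jac \<Phi> (\<Psi> y) *v g' y (axis j 1) = axis j 1"
        using g'(2,3)[OF y] by (simp add: f'_apply[symmetric] surj_f_inv_f bij_is_surj)
      then have "g' y (axis j 1) $ i = D j y"
        unfolding cramer[OF detV[OF y]] by (simp add: D_def)
      with d show "((\<lambda>t. \<Psi> (y + t *\<^sub>R axis j 1) $ i) has_field_derivative D j y) (at 0)" by simp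
    qed
  qed
  have detU: "det (jac \<Phi> x) \<noteq> 0" if "x \<in> U'" for x
    using detV[of "\<Phi> x"] \<Psi>(1)[OF that] V that by auto
  show ?thesis
    by (rule that[of U' \<Psi>]) (use U' V \<Psi>(1) detU Ck\<Psi> in auto)
qed

text \<open>
  The columns of a surjective matrix span, so some of them form a basis.
\<close>

lemma surjective_imp_invertible_minor:
  fixes A :: "'n::finite \<Rightarrow> 'm::finite \<Rightarrow> real"
  assumes surj: "\<And>w::real^'n. \<exists>v::real^'m. \<forall>i. (\<Sum>j\<in>UNIV. A i j * v $ j) = w $ i"
  obtains \<sigma> where "inj \<sigma>" "det (\<chi> i j. A i (\<sigma> j)) \<noteq> 0"
proof -
  define col where "col k = (\<chi> i. A i k)" for k
  have "w \<in> span (range col)" for w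
  proof -
    obtain v :: "real^'m" where "\<forall>i. (\<Sum>j\<in>UNIV. A i j * v $ j) = w $ i" using surj by blast
    then have "w = (\<Sum>j\<in>UNIV. v $ j *\<^sub>R col j)"
      by (simp add: vec_eq_iff col_def mult.commute)
    then show ?thesis by (simp only:) (intro span_sum span_scale span_base rangeI)
  qed
  then have sp: "span (range col) = UNIV" by auto
  obtain B where B: "B \<subseteq> range col" "independent B" "range col \<subseteq> span B"
    using maximal_independent_subset[of "range col"] by blast
  have spB: "span B = UNIV"
    using sp B(3) span_mono span_span by (metis top.extremum_uniqueI)
  then have "card B = CARD('n)"
    using dim_eq_card[of B UNIV] B(2) by (simp add: dim_UNIV)
  moreover have "finite B" using B(2) by (rule independent_imp_finite)
  ultimately obtain h where h: "bij_betw h (UNIV :: 'n set) B"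
    using finite_same_card_bij[of "UNIV :: 'n set" B] by auto
  then have "\<forall>j. \<exists>k. col k = h j" using B(1) by (metis bij_betwE rangeE subsetD UNIV_I)
  then obtain \<sigma> where \<sigma>: "\<And>j. col (\<sigma> j) = h j" by metis
  show ?thesis
  proof
    show "inj \<sigma>" using h \<sigma> by (metis bij_betw_def inj_def)
    have "columns (\<chi> i j. A i (\<sigma> j)) = B"
      using h \<sigma> by (auto simp: columns_def column_def col_def bij_betw_def image_def)
    then have "invertible (\<chi> i j. A i (\<sigma> j))"
      using spB by (simp add: invertible_right_inverse matrix_right_invertible_span_columns span_vec_eq)
    then show "det (\<chi> i j. A i (\<sigma> j)) \<noteq> 0" by (simp add: invertible_det_nz)
  qed
qed

text \<open>
  Replacing the coordinates selected by an invertible minor of the Jacobian matrix by the components of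
  \<open>F\<close> gives a map with invertible derivative, through which \<open>F\<close> is the projection \<open>coord_proj \<sigma>\<close>.
\<close>

lemma submersion_straightening:
  fixes F :: "real^'m \<Rightarrow> real^'n"
  assumes W: "open W" "x0 \<in> W" and F: "\<And>k i. Ck k W (\<lambda>x. F x $ i)"
    and surj: "\<And>w::real^'n. \<exists>v::real^'m. \<forall>i. (\<Sum>j\<in>UNIV. jac F x0 $ i $ j * v $ j) = w $ i"
  obtains \<sigma> where "inj \<sigma>" "\<And>k i. Ck k W (\<lambda>x. coord_merge \<sigma> (F x) x $ i)"
    "det (jac (\<lambda>x. coord_merge \<sigma> (F x) x) x0) \<noteq> 0"
proof -
  obtain \<sigma> :: "'n \<Rightarrow> 'm" where \<sigma>: "inj \<sigma>" "det (\<chi> i j. jac F x0 $ i $ \<sigma> j) \<noteq> 0"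
    using surjective_imp_invertible_minor[of "\<lambda>i j. jac F x0 $ i $ j"] surj by auto
  let ?\<Phi> = "\<lambda>x. coord_merge \<sigma> (F x) x"
  have rows: "(\<lambda>x. ?\<Phi> x $ \<sigma> i) = (\<lambda>x. F x $ i)" "k \<notin> range \<sigma> \<Longrightarrow> (\<lambda>x. ?\<Phi> x $ k) = (\<lambda>x. x $ k)" for i k
    using \<sigma>(1) by auto
  have ck: "Ck k W (\<lambda>x. ?\<Phi> x $ i)" for k i
    by (cases "i \<in> range \<sigma>") (auto simp: rows F Ck_coord[OF W(1)])
  have "v = 0" if v: "jac ?\<Phi> x0 *v v = 0" for v
  proof -
    have v0: "v $ k = 0" if "k \<notin> range \<sigma>" for k
    proof -
      have "partial_deriv j (\<lambda>x. x $ k) x0 = (if j = k then 1 else 0)" for j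
        by (intro partial_derivI) (auto simp: axis_def intro!: derivative_eq_intros)
      then have "(jac ?\<Phi> x0 *v v) $ k = v $ k"
        by (simp add: matrix_vector_mult_def jac_def rows(2)[OF that] if_distrib[where f="\<lambda>x. x * _"] cong: if_cong)
      with v show ?thesis by simp
    qed
    have "(\<Sum>j\<in>UNIV. jac F x0 $ i $ \<sigma> j * v $ \<sigma> j) = 0" for i
    proof -
      have "0 = (jac ?\<Phi> x0 *v v) $ \<sigma> i" using v by simp
      also have "\<dots> = (\<Sum>j\<in>UNIV. jac F x0 $ i $ j * v $ j)"
        by (simp add: matrix_vector_mult_def jac_def rows(1))
      also have "\<dots> = (\<Sum>j\<in>range \<sigma>. jac F x0 $ i $ j * v $ j)"
        by (rule sum.mono_neutral_right) (auto simp: v0)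
      also have "\<dots> = (\<Sum>j\<in>UNIV. jac F x0 $ i $ \<sigma> j * v $ \<sigma> j)"
        using \<sigma>(1) by (simp add: sum.reindex)
      finally show ?thesis by simp
    qed
    then have "(\<chi> i j. jac F x0 $ i $ \<sigma> j) *v (coord_proj \<sigma> v) = 0"
      by (simp add: vec_eq_iff matrix_vector_mult_def)
    then have "coord_proj \<sigma> v = 0"
      using \<sigma>(2) by (metis invertible_det_nz invertible_left_inverse matrix_left_invertible_ker)
    then have "v $ \<sigma> i = 0" for i by (metis coord_proj_nth zero_index)
    then show ?thesis using v0 unfolding vec_eq_iff by (metis rangeE zero_index)
  qed
  then have "det (jac ?\<Phi> x0) \<noteq> 0"
    by (metis invertible_det_nz invertible_left_inverse matrix_left_invertible_ker)
  with \<sigma>(1) ck show ?thesis by (rule that)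
qed

text \<open>
  Nonnegative densities on \<open>W\<close> whose support is compact in \<open>W\<close> over \<open>V\<close> have a push-forward along \<open>F\<close> over \<open>V\<close> of
  the same regularity. One set \<open>W\<close> serves all \<open>V\<close>, because \<open>V\<close> is found only
  after finitely many such sets have been chosen to cover a fibre.
\<close>

definition pushes_forward :: "(real^'m::finite \<Rightarrow> real^'n::finite) \<Rightarrow> (real^'m) set \<Rightarrow> bool" where
  "pushes_forward F W \<longleftrightarrow> (\<forall>k V w K. open V \<longrightarrow> Ck k {x\<in>W. F x \<in> V} w \<longrightarrow> compact K \<longrightarrow> K \<subseteq> W \<longrightarrow>
     (\<forall>x\<in>W. F x \<in> V \<longrightarrow> x \<notin> K \<longrightarrow> w x = 0) \<longrightarrow> (\<forall>x\<in>W. F x \<in> V \<longrightarrow> 0 \<le> w x) \<longrightarrow>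
     (\<exists>g. Ck k V g \<and>
       (\<forall>h. Cc_on V h \<longrightarrow> integral V (\<lambda>y. h y * g y) = integral {x\<in>W. F x \<in> V} (\<lambda>x. h (F x) * w x)) \<and>
       (\<forall>y\<in>V. 0 \<le> g y) \<and> (\<forall>x\<in>W. F x \<in> V \<longrightarrow> 0 < w x \<longrightarrow> 0 < g (F x))))"

text \<open>
  Straighten \<open>F\<close> to a coordinate projection by \<open>\<Phi>\<close>, transport the density to \<open>a\<close>, and integrate \<open>a\<close>
  over the remaining coordinates. The support condition keeps \<open>a\<close> regular on all of the preimage of \<open>V\<close> when
  it is extended by zero.
\<close>

lemma submersion_pushforward:
  fixes F :: "real^'m::{finite,wellorder} \<Rightarrow> real^'n"
  assumes W: "open W" "x0 \<in> W" and F: "\<And>k i. Ck k W (\<lambda>x. F x $ i)"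
    and surj: "\<And>w::real^'n. \<exists>v::real^'m::_. \<forall>i. (\<Sum>j\<in>UNIV. jac F x0 $ i $ j * v $ j) = w $ i"
  obtains W' where "open W'" "x0 \<in> W'" "W' \<subseteq> W"
    "pushes_forward F W'"
proof -
  obtain \<sigma> :: "'n \<Rightarrow> 'm" where \<sigma>: "inj \<sigma>" and ck: "\<And>k i. Ck k W (\<lambda>x. coord_merge \<sigma> (F x) x $ i)"
    and det: "det (jac (\<lambda>x. coord_merge \<sigma> (F x) x) x0) \<noteq> 0"
    by (rule submersion_straightening[OF W F surj]) (rule that)
  define \<Phi> where "\<Phi> x = coord_merge \<sigma> (F x) x" for x
  have \<Phi>_eq: "(\<lambda>x. coord_merge \<sigma> (F x) x) = \<Phi>" by (simp add: \<Phi>_def fun_eq_iff)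
  have ck0: "Ck k W (\<lambda>x. \<Phi> x $ i)" for k i using ck by (simp add: \<Phi>_def)
  have det0: "det (jac \<Phi> x0) \<noteq> 0" using det by (simp add: \<Phi>_eq)
  obtain W' \<Psi> where W': "open W'" "x0 \<in> W'" "W' \<subseteq> W" and U: "open (\<Phi> ` W')"
    and \<Psi>: "\<And>x. x \<in> W' \<Longrightarrow> \<Psi> (\<Phi> x) = x"
    and det: "\<And>x. x \<in> W' \<Longrightarrow> det (jac \<Phi> x) \<noteq> 0" and ck\<Psi>: "\<And>k i. Ck k (\<Phi> ` W') (\<lambda>z. \<Psi> z $ i)"
    by (rule Ck_inverse_function[OF W ck0 det0]) (rule that)
  have ck\<Phi>: "Ck k W' (\<lambda>x. \<Phi> x $ i)" for k i
    using Ck_subset[OF ck W'(3)] by (simp add: \<Phi>_def)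
  have proj\<Phi> [simp]: "coord_proj \<sigma> (\<Phi> x) = F x" for x
    using \<sigma> by (simp add: \<Phi>_def)
  have cont\<Phi>: "continuous_on W' \<Phi>"
    using ck\<Phi>[of 0] by (intro continuous_on_components) auto
  have contF: "continuous_on W' F"
    using Ck_subset[OF F W'(3), of 0] by (intro continuous_on_components) auto
  show ?thesis
  proof (rule that[OF W'], unfold pushes_forward_def, intro allI impI)
    fix k V w K
    assume V: "open V" and w: "Ck k {x\<in>W'. F x \<in> V} w" and K: "compact K" "K \<subseteq> W'"
      and "\<forall>x\<in>W'. F x \<in> V \<longrightarrow> x \<notin> K \<longrightarrow> w x = 0" "\<forall>x\<in>W'. F x \<in> V \<longrightarrow> 0 \<le> w x"
    then have w0: "\<And>x. x \<in> W' \<Longrightarrow> F x \<in> V \<Longrightarrow> x \<notin> K \<Longrightarrow> w x = 0"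
      and wpos: "\<And>x. x \<in> W' \<Longrightarrow> F x \<in> V \<Longrightarrow> 0 \<le> w x"
      by blast+
    define T where "T = {x\<in>W'. F x \<in> V}"
    define PV where "PV = {z. coord_proj \<sigma> z \<in> V}"
    have oT: "open T"
      using continuous_open_preimage[OF contF W'(1) V] by (simp add: T_def vimage_def Int_def)
    have oPV: "open PV"
      unfolding PV_def using open_vimage[OF V, of "coord_proj \<sigma>"]
      by (simp add: vimage_def continuous_on_coord_proj_id)
    have im: "\<Phi> ` T = \<Phi> ` W' \<inter> PV" by (auto simp: T_def PV_def)
    have oim: "open (\<Phi> ` T)" using U oPV im by auto
    have KK: "compact (\<Phi> ` K)"
      using K cont\<Phi> by (intro compact_continuous_image) (auto intro: continuous_on_subset)
    define a where "a z = (if z \<in> \<Phi> ` W' then w (\<Psi> z) / \<bar>det (jac \<Phi> (\<Psi> z))\<bar> else 0)" for z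
    have a\<Phi>: "a (\<Phi> x) = w x / \<bar>det (jac \<Phi> x)\<bar>" if "x \<in> W'" for x
      using that \<Psi> by (auto simp: a_def)
    have a0: "a z = 0" if "z \<in> PV" "z \<notin> \<Phi> ` K" for z
    proof (cases "z \<in> \<Phi> ` W'")
      case True
      then obtain x where x: "x \<in> W'" "z = \<Phi> x" by auto
      then show ?thesis using that w0[of x] a\<Phi>[of x] by (auto simp: PV_def)
    qed (simp add: a_def)
    have apos: "0 \<le> a z" if "z \<in> PV" for z
      using that wpos \<Psi> by (auto simp: a_def PV_def)
    have cka: "Ck k PV a"
    proof (rule Ck_local)
      fix z assume z: "z \<in> PV"
      show "\<exists>T. open T \<and> z \<in> T \<and> Ck k T a"
      proof (cases "z \<in> \<Phi> ` W'")
        case True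
        have d: "Ck k T (\<lambda>x. \<bar>det (jac \<Phi> x)\<bar>)"
        proof (intro Ck_abs Ck_det oT)
          show "Ck k T (\<lambda>x. jac \<Phi> x $ i $ j)" for i j
            using Ck_subset[OF Ck_partial[OF ck\<Phi>], of T] by (auto simp: jac_def T_def)
        qed (use det in \<open>auto simp: T_def\<close>)
        have "Ck k T (\<lambda>x. w x / \<bar>det (jac \<Phi> x)\<bar>)"
          using w det by (intro Ck_divide oT d) (auto simp: T_def)
        then have "Ck k (\<Phi> ` T) (\<lambda>z. w (\<Psi> z) / \<bar>det (jac \<Phi> (\<Psi> z))\<bar>)"
          using \<Psi> Ck_subset[OF ck\<Psi>, of "\<Phi> ` T"] im
          by (intro Ck_compose[of "\<Phi> ` T" T \<Psi> k "\<lambda>x. w x / \<bar>det (jac \<Phi> x)\<bar>"] oT oim) (auto simp: T_def PV_def)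
        then have "Ck k (\<Phi> ` T) a"
          using im by (subst Ck_cong[OF oim, of a]) (auto simp: a_def)
        then show ?thesis using oim True z im by blast
      next
        case False
        have o: "open (- (\<Phi> ` K) \<inter> PV)" using KK oPV by (simp add: compact_imp_closed open_Compl open_Int)
        have "Ck k (- (\<Phi> ` K) \<inter> PV) a"
          by (subst Ck_cong[OF o, of a "\<lambda>_. 0"]) (auto simp: a0 Ck_const)
        then show ?thesis using o False z K by blast
      qed
    qed
    from compact_imp_bounded[OF KK] obtain B where "0 < B \<and> (\<forall>z\<in>\<Phi> ` K. norm z \<le> B)"
      unfolding bounded_pos by (rule exE)
    then have B: "\<And>z. z \<in> \<Phi> ` K \<Longrightarrow> norm z \<le> B" "0 < B" by blast+
    have Bc: "\<bar>z $ i\<bar> \<le> B" if "z \<in> \<Phi> ` K" for z i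
      using B(1)[OF that] component_le_norm_cart[of z i] by linarith
    \<comment> \<open>the unit cube in the selected coordinates, a cube containing the support of \<open>a\<close> in the others\<close>
    define lo hi :: "real^'m::_" where "lo = (\<chi> k. if k \<in> range \<sigma> then 0 else - B)"
      and "hi = (\<chi> k. if k \<in> range \<sigma> then 1 else B)"
    define g where "g x = integral (cbox lo hi) (\<lambda>y. a (coord_merge \<sigma> x y))" for x
    have ckg: "Ck k V g"
      unfolding g_def using cka by (intro Ck_integral_param \<sigma> V) (simp add: PV_def)
    have fib: "integral V (\<lambda>y. h y * g y) = integral T (\<lambda>x. h (F x) * w x)" if h: "Cc_on V h" for h
    proof -
      obtain L where L: "compact L" "L \<subseteq> V" "\<forall>x\<in>V - L. h x = 0" and hc: "continuous_on V h"
        using h by (auto simp: Cc_on_def)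
      define b where "b z = (if z \<in> PV then h (coord_proj \<sigma> z) * a z else 0)" for z
      have cL: "compact (\<Phi> ` K \<inter> {z. coord_proj \<sigma> z \<in> L})"
      proof (rule compact_Int_closed[OF KK])
        show "closed {z :: real^'m::_. coord_proj \<sigma> z \<in> L}"
          using closed_vimage[of L "coord_proj \<sigma>"] L(1)
          by (simp add: vimage_def compact_imp_closed continuous_on_coord_proj_id)
      qed
      have ha: "continuous_on PV (\<lambda>z. h (coord_proj \<sigma> z) * a z)"
        by (intro continuous_on_mult Ck_continuous[OF cka] continuous_on_compose2[OF hc, of _ "coord_proj \<sigma>"])
           (auto simp: PV_def continuous_on_coord_proj_id)
      have z0: "h (coord_proj \<sigma> z) * a z = 0" if "z \<in> PV" "z \<notin> \<Phi> ` K \<inter> {z. coord_proj \<sigma> z \<in> L}" for z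
        using that a0[of z] L(3) by (auto simp: PV_def)
      have "Cc_on PV (\<lambda>z. h (coord_proj \<sigma> z) * a z)"
        using ha cL z0 L(2) by (intro Cc_onI[OF ha cL]) (auto simp: PV_def)
      then have Ccb: "Cc_on UNIV b"
        unfolding b_def by (rule Cc_on_zero_extension[OF oPV])
      have CcT: "Cc_on (\<Phi> ` T) (\<lambda>z. h (coord_proj \<sigma> z) * a z)"
      proof (rule Cc_onI[OF _ cL])
        show "continuous_on (\<Phi> ` T) (\<lambda>z. h (coord_proj \<sigma> z) * a z)"
          using ha im by (auto intro: continuous_on_subset)
        show "\<Phi> ` K \<inter> {z. coord_proj \<sigma> z \<in> L} \<subseteq> \<Phi> ` T"
          using L(2) K(2) by (auto simp: im PV_def)
      qed (use z0 im in auto)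
      have "integral V (\<lambda>y. h y * g y) = integral UNIV (\<lambda>x. if x \<in> V then h x * g x else 0)"
        by (simp add: integral_restrict_UNIV)
      also have "\<dots> = integral UNIV (\<lambda>x. integral (cbox lo hi) (\<lambda>y. b (coord_merge \<sigma> x y)))"
        by (intro arg_cong[where f = "integral UNIV"] ext) (auto simp: b_def PV_def \<sigma> g_def)
      also have "\<dots> = integral UNIV b"
      proof (rule integral_fibrewise[OF \<sigma> Ccb, symmetric])
        fix z i assume "b z \<noteq> 0" and i: "i \<notin> range \<sigma>"
        then have "z \<in> \<Phi> ` K" using a0 by (auto simp: b_def split: if_splits)
        then show "lo $ i \<le> z $ i \<and> z $ i \<le> hi $ i" using Bc[of z i] i by (auto simp: lo_def hi_def abs_le_iff)
      qed (auto simp: lo_def hi_def)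
      also have "\<dots> = integral (\<Phi> ` T) b"
        by (rule integral_eq_integral_UNIV[symmetric]) (auto simp: b_def im a_def)
      also have "\<dots> = integral (\<Phi> ` T) (\<lambda>z. h (coord_proj \<sigma> z) * a z)"
        by (rule integral_cong) (auto simp: b_def im)
      also have "\<dots> = integral T (\<lambda>x. \<bar>det (matrix ((*v) (jac \<Phi> x)))\<bar> * (h (coord_proj \<sigma> (\<Phi> x)) * a (\<Phi> x)))"
      proof (rule integral_change_of_variables_real[OF oT])
        show "(\<Phi> has_derivative (*v) (jac \<Phi> x)) (at x)" if "x \<in> T" for x
          using that by (intro has_derivative_jac[of 0, OF ck\<Phi> W'(1)]) (auto simp: T_def)
        show "inj_on \<Phi> T"
          using \<Psi> by (intro inj_on_inverseI[of T \<Psi>]) (auto simp: T_def)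
        show "(\<lambda>z. h (coord_proj \<sigma> z) * a z) absolutely_integrable_on \<Phi> ` T"
          using CcT by (rule Cc_on_absolutely_integrable[OF oim])
      qed
      also have "\<dots> = integral T (\<lambda>x. h (F x) * w x)"
        using det by (intro integral_cong) (auto simp: a\<Phi> T_def)
      finally show ?thesis .
    qed
    have mem: "coord_merge \<sigma> y z \<in> PV" if "y \<in> V" for y z
      using that \<sigma> by (simp add: PV_def)
    have cont: "continuous_on (cbox lo hi) (\<lambda>z. a (coord_merge \<sigma> y z))" if "y \<in> V" for y
      by (rule continuous_on_compose2[OF Ck_continuous[OF cka]]) (use mem[OF that] in \<open>auto intro!: continuous_intros\<close>)
    have gpos: "0 \<le> g y" if "y \<in> V" for y
      unfolding g_def using apos mem[OF that] cont[OF that]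
      by (intro integral_nonneg integrable_continuous) auto
    have "0 < g (F x)" if x: "x \<in> W'" "F x \<in> V" "0 < w x" for x
    proof -
      have xK: "x \<in> K" using w0[OF x(1,2)] x(3) by auto
      \<comment> \<open>a point of the box that represents \<open>\<Phi> x\<close> in its fibre\<close>
      define y where "y = coord_merge \<sigma> 0 (\<Phi> x)"
      have y: "coord_merge \<sigma> (F x) y = \<Phi> x" using \<sigma> by (simp add: y_def \<Phi>_def)
      have "lo $ i \<le> y $ i \<and> y $ i \<le> hi $ i" for i
      proof (cases "i \<in> range \<sigma>")
        case True
        then show ?thesis using \<sigma> by (auto simp: lo_def hi_def y_def)
      next
        case False
        then show ?thesis using Bc[of "\<Phi> x" i] xK by (auto simp: lo_def hi_def y_def abs_le_iff)
      qed
      then have ybox: "y \<in> cbox lo hi" by (simp add: mem_box_cart)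
      have ne: "box lo hi \<noteq> {}" using B(2) by (auto simp: interval_ne_empty_cart lo_def hi_def)
      have "g (F x) \<noteq> 0"
      proof
        assume "g (F x) = 0"
        then have "((\<lambda>z. a (coord_merge \<sigma> (F x) z)) has_integral 0) (cbox lo hi)"
          unfolding g_def using integrable_continuous[OF cont[OF x(2)]] by (metis integrable_integral)
        then have "a (coord_merge \<sigma> (F x) y) = 0"
          by (intro has_integral_0_cbox_imp_0[OF cont[OF x(2)] _ _ ne ybox]) (use apos mem[OF x(2)] in auto)
        then show False using y a\<Phi>[OF x(1)] det[OF x(1)] x(3) by simp
      qed
      then show ?thesis using gpos[OF x(2)] by simp
    qed
    then show "\<exists>g. Ck k V g \<and>
         (\<forall>h. Cc_on V h \<longrightarrow> integral V (\<lambda>y. h y * g y) = integral {x\<in>W'. F x \<in> V} (\<lambda>x. h (F x) * w x)) \<and>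
         (\<forall>y\<in>V. 0 \<le> g y) \<and> (\<forall>x\<in>W'. F x \<in> V \<longrightarrow> 0 < w x \<longrightarrow> 0 < g (F x))"
      using ckg fib gpos by (intro exI[of _ g]) (auto simp: T_def)
  qed
qed

section \<open>Charts and functions of class \<open>C\<^sup>k\<close> on a manifold\<close>

text \<open>
  All coordinates are in use, that is, the dimension is positive.
\<close>

locale full_manifold =
  fixes M :: "('a, 'n::finite) manifold"
  assumes smooth_manifold: "smooth_manifold M" and coords [simp]: "coords M = UNIV"
begin

lemma Hausdorff: "Hausdorff_space (mtop M)"
  using smooth_manifold by (simp add: smooth_manifold_def)

lemma charts_cover: "p \<in> topspace (mtop M) \<Longrightarrow> \<exists>c\<in>atlas M. p \<in> chart_dom c"
  using smooth_manifold by (auto simp: smooth_manifold_def)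

lemma openin_dom: "c \<in> atlas M \<Longrightarrow> openin (mtop M) (chart_dom c)"
  using smooth_manifold by (simp add: smooth_manifold_def)

lemma dom_subset: "c \<in> atlas M \<Longrightarrow> chart_dom c \<subseteq> topspace (mtop M)"
  using openin_dom openin_subset by blast

lemma chart_homeomorphic:
  "c \<in> atlas M \<Longrightarrow> homeomorphic_map (subtopology (mtop M) (chart_dom c)) (top_of_set (chart_img c)) (chart_map c)"
  using smooth_manifold by (simp add: smooth_manifold_def)

lemma open_img: "c \<in> atlas M \<Longrightarrow> open (chart_img c)"
  using smooth_manifold by (auto simp: smooth_manifold_def model_space_def)

lemma inj_chart: "c \<in> atlas M \<Longrightarrow> inj_on (chart_map c) (chart_dom c)"
  using homeomorphic_imp_injective_map[OF chart_homeomorphic, of c] dom_subset[of c]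
  by (simp add: inf.absorb2)

lemma inv_chart [simp]: "c \<in> atlas M \<Longrightarrow> p \<in> chart_dom c \<Longrightarrow> chart_inv c (chart_map c p) = p"
  unfolding chart_inv_def using inj_chart by (rule inv_into_f_f)

lemma map_in_img [simp]: "p \<in> chart_dom c \<Longrightarrow> chart_map c p \<in> chart_img c"
  by (simp add: chart_img_def)

lemma inv_in_dom [simp]: "x \<in> chart_img c \<Longrightarrow> chart_inv c x \<in> chart_dom c"
  unfolding chart_inv_def chart_img_def by (rule inv_into_into)

lemma map_inv [simp]: "x \<in> chart_img c \<Longrightarrow> chart_map c (chart_inv c x) = x"
  unfolding chart_inv_def chart_img_def by (rule f_inv_into_f)

lemma image_Int_eq: "c \<in> atlas M \<Longrightarrow> chart_map c ` (chart_dom c \<inter> U) = {x \<in> chart_img c. chart_inv c x \<in> U}"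
  by (force simp: chart_img_def)

lemma open_image:
  assumes "c \<in> atlas M" "openin (mtop M) U"
  shows "open (chart_map c ` (chart_dom c \<inter> U))"
proof -
  have "openin (subtopology (mtop M) (chart_dom c)) (chart_dom c \<inter> U)"
    using assms(2) by (rule openin_subtopology_Int2)
  then have "openin (top_of_set (chart_img c)) (chart_map c ` (chart_dom c \<inter> U))"
    using homeomorphic_imp_open_map[OF chart_homeomorphic[OF assms(1)]] by (simp add: open_map_def)
  then show ?thesis
    using open_img[OF assms(1)] openin_open_trans by blast
qed

lemma continuous_chart:
  assumes "c \<in> atlas M"
  shows "continuous_map (subtopology (mtop M) (chart_dom c)) euclidean (chart_map c)"
  using homeomorphic_imp_continuous_map[OF chart_homeomorphic[OF assms]]
  by (simp add: continuous_map_in_subtopology)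

lemma continuous_inv:
  assumes "c \<in> atlas M"
  shows "continuous_map (top_of_set (chart_img c)) (mtop M) (chart_inv c)"
  unfolding continuous_map_def
proof (intro conjI allI impI)
  show "chart_inv c \<in> topspace (top_of_set (chart_img c)) \<rightarrow> topspace (mtop M)"
    using dom_subset[OF assms] by (auto dest: inv_in_dom)
  fix U assume "openin (mtop M) U"
  from open_image[OF assms this]
  have "openin (top_of_set (chart_img c)) {x \<in> chart_img c. chart_inv c x \<in> U}"
    unfolding image_Int_eq[OF assms] by (intro open_subset) auto
  then show "openin (top_of_set (chart_img c)) {x \<in> topspace (top_of_set (chart_img c)). chart_inv c x \<in> U}"
    by simp
qed

lemma compact_image:
  assumes "c \<in> atlas M" "compactin (mtop M) K" "K \<subseteq> chart_dom c"
  shows "compact (chart_map c ` K)"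
proof -
  have "compactin (subtopology (mtop M) (chart_dom c)) K"
    using assms by (simp add: compactin_subtopology)
  from image_compactin[OF this continuous_chart[OF assms(1)]] show ?thesis by simp
qed

lemma compactin_inv_image:
  assumes "c \<in> atlas M" "compact T" "T \<subseteq> chart_img c"
  shows "compactin (mtop M) (chart_inv c ` T)"
  using image_compactin[OF _ continuous_inv[OF assms(1)]] assms(2,3) by (simp add: compactin_subtopology)

lemma openin_chart_preimage:
  assumes "c \<in> atlas M" "open T"
  shows "openin (mtop M) {p \<in> chart_dom c. chart_map c p \<in> T}"
proof -
  have "openin (subtopology (mtop M) (chart_dom c)) {p \<in> chart_dom c. chart_map c p \<in> T}"
    using openin_continuous_map_preimage[OF continuous_chart[OF assms(1)], of T] assms(2) dom_subset[OF assms(1)]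
    by (simp add: inf.absorb2)
  then show ?thesis using openin_dom[OF assms(1)] openin_trans_full by blast
qed

lemma openin_Compl_compact: "compactin (mtop M) K \<Longrightarrow> openin (mtop M) (topspace (mtop M) - K)"
  using compactin_imp_closedin[OF Hausdorff] by blast

lemma transition_Ck:
  assumes "c \<in> atlas M" "d \<in> atlas M"
  shows "Ck k (chart_map c ` (chart_dom c \<inter> chart_dom d)) (\<lambda>x. chart_map d (chart_inv c x) $ i)"
  using smooth_manifold assms by (simp add: smooth_manifold_def smooth_on_def)

end

text \<open>
  A function on a manifold is represented by a total function; only its values on
  \<open>U \<inter> topspace (mtop M)\<close> matter.
\<close>

definition Ck_fun :: "('a, 'n::finite) manifold \<Rightarrow> nat \<Rightarrow> 'a set \<Rightarrow> ('a \<Rightarrow> real) \<Rightarrow> bool" where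
  "Ck_fun M k U u \<longleftrightarrow>
     (\<forall>c\<in>atlas M. Ck k (chart_map c ` (chart_dom c \<inter> U)) (\<lambda>x. u (chart_inv c x)))"

definition supp_in :: "('a, 'n::finite) manifold \<Rightarrow> nat \<Rightarrow> 'a set \<Rightarrow> ('a \<Rightarrow> real) \<Rightarrow> bool" where
  "supp_in M k U u \<longleftrightarrow> Ck_fun M k U u \<and>
     (\<exists>K. compactin (mtop M) K \<and> K \<subseteq> U \<and> (\<forall>p\<in>topspace (mtop M) - K. u p = 0))"

context full_manifold
begin

lemma Ck_fun_chart_img: "Ck_fun M k U u \<Longrightarrow> c \<in> atlas M \<Longrightarrow> Ck k (chart_map c ` (chart_dom c \<inter> U)) (\<lambda>x. u (chart_inv c x))"
  by (simp add: Ck_fun_def)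

lemma Ck_fun_subset: "Ck_fun M k U u \<Longrightarrow> V \<subseteq> U \<Longrightarrow> Ck_fun M k V u"
  by (auto simp: Ck_fun_def intro: Ck_subset)

lemma Ck_fun_le: "Ck_fun M k U u \<Longrightarrow> l \<le> k \<Longrightarrow> Ck_fun M l U u"
  by (auto simp: Ck_fun_def intro: Ck_le)

lemma Ck_fun_cong:
  assumes "openin (mtop M) U" "\<And>p. p \<in> U \<Longrightarrow> u p = v p"
  shows "Ck_fun M k U u \<longleftrightarrow> Ck_fun M k U v"
  unfolding Ck_fun_def
proof (intro ball_cong refl Ck_cong)
  fix c x assume c: "c \<in> atlas M"
  show "open (chart_map c ` (chart_dom c \<inter> U))" using c assms(1) by (rule open_image)
  show "x \<in> chart_map c ` (chart_dom c \<inter> U) \<Longrightarrow> u (chart_inv c x) = v (chart_inv c x)"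
    using assms(2) c by (auto simp: image_Int_eq)
qed

lemma Ck_fun_local:
  assumes "\<And>p. p \<in> U \<Longrightarrow> p \<in> topspace (mtop M) \<Longrightarrow> \<exists>N. openin (mtop M) N \<and> p \<in> N \<and> Ck_fun M k N u"
  shows "Ck_fun M k U u"
  unfolding Ck_fun_def
proof (intro ballI Ck_local)
  fix c x assume c: "c \<in> atlas M" and "x \<in> chart_map c ` (chart_dom c \<inter> U)"
  then obtain p where p: "p \<in> chart_dom c" "p \<in> U" "x = chart_map c p" by auto
  then obtain N where "openin (mtop M) N" "p \<in> N" "Ck_fun M k N u"
    using assms[of p] dom_subset[OF c] by auto
  then show "\<exists>T. open T \<and> x \<in> T \<and> Ck k T (\<lambda>x. u (chart_inv c x))"
    using c p open_image by (intro exI[of _ "chart_map c ` (chart_dom c \<inter> N)"]) (auto simp: Ck_fun_def)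
qed

text \<open>
  One chart suffices, since the transition functions are smooth.
\<close>

lemma Ck_fun_chartI:
  assumes c: "c \<in> atlas M" and N: "openin (mtop M) N" "N \<subseteq> chart_dom c"
    and u: "Ck k (chart_map c ` N) (\<lambda>x. u (chart_inv c x))"
  shows "Ck_fun M k N u"
  unfolding Ck_fun_def
proof
  fix d assume d: "d \<in> atlas M"
  let ?S = "chart_map d ` (chart_dom d \<inter> N)"
  have oS: "open ?S" and oT: "open (chart_map c ` N)"
    using open_image[OF d N(1)] open_image[OF c N(1)] N(2) by (auto simp: Int_absorb1 inf.absorb2)
  have "Ck k ?S (\<lambda>x. u (chart_inv c (chart_map c (chart_inv d x))))"
  proof (rule Ck_compose[OF oS oT, of "\<lambda>x. chart_map c (chart_inv d x)" k "\<lambda>x. u (chart_inv c x)"])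
    show "chart_map c (chart_inv d x) \<in> chart_map c ` N" if "x \<in> ?S" for x
      using that d by auto
    show "Ck k ?S (\<lambda>x. chart_map c (chart_inv d x) $ i)" for i
      by (rule Ck_subset[OF transition_Ck[OF d c]]) (use N(2) in auto)
  qed (rule u)
  then show "Ck k ?S (\<lambda>x. u (chart_inv d x))"
    by (subst Ck_cong[OF oS]) (use c d N(2) in auto)
qed

lemma Ck_fun_const: "Ck_fun M k U (\<lambda>p. a)"
  by (simp add: Ck_fun_def Ck_const)

lemma Ck_fun_add: "openin (mtop M) U \<Longrightarrow> Ck_fun M k U u \<Longrightarrow> Ck_fun M k U v \<Longrightarrow> Ck_fun M k U (\<lambda>p. u p + v p)"
  by (auto simp: Ck_fun_def intro!: Ck_add open_image)

lemma Ck_fun_mult: "openin (mtop M) U \<Longrightarrow> Ck_fun M k U u \<Longrightarrow> Ck_fun M k U v \<Longrightarrow> Ck_fun M k U (\<lambda>p. u p * v p)"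
  by (auto simp: Ck_fun_def intro!: Ck_mult open_image)

lemma Ck_fun_sum: "openin (mtop M) U \<Longrightarrow> (\<And>i. i \<in> A \<Longrightarrow> Ck_fun M k U (u i)) \<Longrightarrow> Ck_fun M k U (\<lambda>p. \<Sum>i\<in>A. u i p)"
  by (auto simp: Ck_fun_def intro!: Ck_sum open_image)

lemma Ck_fun_divide:
  assumes "openin (mtop M) U" "Ck_fun M k U u" "Ck_fun M k U v" "\<And>p. p \<in> U \<Longrightarrow> v p \<noteq> 0"
  shows "Ck_fun M k U (\<lambda>p. u p / v p)"
  unfolding Ck_fun_def
proof
  fix c assume c: "c \<in> atlas M"
  show "Ck k (chart_map c ` (chart_dom c \<inter> U)) (\<lambda>x. u (chart_inv c x) / v (chart_inv c x))"
    using assms(4) c by (intro Ck_divide open_image[OF c assms(1)] Ck_fun_chart_img[OF assms(2) c] Ck_fun_chart_img[OF assms(3) c]) auto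
qed

text \<open>
  The manifold is a Hausdorff space, so the complement of \<open>K\<close> is open, and there the function vanishes.
\<close>

lemma Ck_fun_vanishing:
  assumes K: "compactin (mtop M) K" and U: "openin (mtop M) U" "Ck_fun M k U u"
    and W: "openin (mtop M) W" "W \<inter> K \<subseteq> U" and z: "\<And>p. p \<in> W - K \<Longrightarrow> u p = 0"
  shows "Ck_fun M k W u"
proof (rule Ck_fun_local)
  fix p assume p: "p \<in> W" "p \<in> topspace (mtop M)"
  show "\<exists>N. openin (mtop M) N \<and> p \<in> N \<and> Ck_fun M k N u"
  proof (cases "p \<in> K")
    case True
    then show ?thesis using U W(2) p by blast
  next
    case False
    have o: "openin (mtop M) (W \<inter> (topspace (mtop M) - K))"
      using W(1) openin_Compl_compact[OF K] by (rule openin_Int)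
    have "Ck_fun M k (W \<inter> (topspace (mtop M) - K)) u"
      by (subst Ck_fun_cong[OF o, of _ "\<lambda>_. 0"]) (auto simp: Ck_fun_const z)
    then show ?thesis using o False p by blast
  qed
qed

lemma supp_in_extend:
  assumes "supp_in M k U u" "openin (mtop M) U" "openin (mtop M) W" "U \<subseteq> W"
  shows "supp_in M k W u"
proof -
  obtain K where K: "compactin (mtop M) K" "K \<subseteq> U" "\<forall>p\<in>topspace (mtop M) - K. u p = 0"
    using assms(1) by (auto simp: supp_in_def)
  have "Ck_fun M k W u"
    by (rule Ck_fun_vanishing[OF K(1) assms(2) _ assms(3)])
      (use assms(1) K openin_subset[OF assms(3)] in \<open>auto simp: supp_in_def\<close>)
  then show ?thesis using K assms(4) by (auto simp: supp_in_def)
qed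

lemma supp_in_mult:
  assumes "supp_in M k U u" "openin (mtop M) U" "Ck_fun M k U v"
  shows "supp_in M k U (\<lambda>p. v p * u p)"
  using assms by (auto simp: supp_in_def intro!: Ck_fun_mult)

lemma supp_in_le: "supp_in M k U u \<Longrightarrow> l \<le> k \<Longrightarrow> supp_in M l U u"
  using Ck_fun_le by (auto simp: supp_in_def)

text \<open>
  Multiplying by a function such as a member of a partition of unity shrinks the support.
\<close>

lemma supp_in_localize:
  assumes u: "supp_in M k U u" "openin (mtop M) U" and v: "Ck_fun M k U v"
    and K: "compactin (mtop M) K" "K \<subseteq> W" "\<And>p. p \<in> U \<Longrightarrow> p \<notin> K \<Longrightarrow> v p = 0"
    and W: "openin (mtop M) W"
  shows "supp_in M k (U \<inter> W) (\<lambda>p. v p * u p)"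
proof -
  obtain L where L: "compactin (mtop M) L" "L \<subseteq> U" "\<forall>p\<in>topspace (mtop M) - L. u p = 0"
    using u(1) by (auto simp: supp_in_def)
  have "compactin (mtop M) (L \<inter> K)"
    using L(1) compactin_imp_closedin[OF Hausdorff K(1)] by (rule compact_Int_closedin)
  moreover have "Ck_fun M k (U \<inter> W) (\<lambda>p. v p * u p)"
    using supp_in_mult[OF u v] by (auto simp: supp_in_def intro: Ck_fun_subset)
  ultimately show ?thesis
    using L K by (auto simp: supp_in_def intro!: exI[of _ "L \<inter> K"])
qed

lemma fun_partial_cong:
  assumes "c \<in> atlas M" "openin (mtop M) U" "p \<in> chart_dom c \<inter> U" "\<And>q. q \<in> U \<Longrightarrow> u q = v q"
  shows "fun_partial c j u p = fun_partial c j v p"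
  unfolding fun_partial_def
  by (rule partial_deriv_cong[OF open_image[OF assms(1,2)]]) (use assms in auto)

lemma fun_partial_eq_0:
  assumes "c \<in> atlas M" "openin (mtop M) U" "p \<in> chart_dom c \<inter> U" "\<And>q. q \<in> U \<Longrightarrow> u q = a"
  shows "fun_partial c j u p = 0"
  using fun_partial_cong[OF assms(1-3), of u "\<lambda>_. a"] assms(4)
  by (simp add: fun_partial_def partial_deriv_def)

lemma Ck_fun_has_partial:
  assumes "c \<in> atlas M" "Ck_fun M (Suc k) U u" "p \<in> chart_dom c \<inter> U"
  shows "((\<lambda>t. u (chart_inv c (chart_map c p + t *\<^sub>R axis j 1))) has_field_derivative fun_partial c j u p) (at 0)"
  unfolding fun_partial_def
  using Ck_has_partial[OF Ck_fun_chart_img[OF assms(2,1)], of "chart_map c p" j] assms(3) by auto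

lemma fun_partial_mult:
  assumes "c \<in> atlas M" "Ck_fun M (Suc k) U u" "Ck_fun M (Suc k) U v" "p \<in> chart_dom c \<inter> U"
  shows "fun_partial c j (\<lambda>p. u p * v p) p = fun_partial c j u p * v p + fun_partial c j v p * u p"
proof -
  have "((\<lambda>t. u (chart_inv c (chart_map c p + t *\<^sub>R axis j 1)) * v (chart_inv c (chart_map c p + t *\<^sub>R axis j 1)))
      has_field_derivative fun_partial c j u p * v p + fun_partial c j v p * u p) (at 0)"
    using DERIV_mult[OF Ck_fun_has_partial[OF assms(1,2,4), of j] Ck_fun_has_partial[OF assms(1,3,4), of j]] assms(1,4)
    by simp
  then show ?thesis
    unfolding fun_partial_def[of c j "\<lambda>p. u p * v p"] by (rule partial_derivI)
qed

lemma fun_partial_sum: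
  assumes "c \<in> atlas M" "\<And>i. i \<in> A \<Longrightarrow> Ck_fun M (Suc k) U (u i)" "p \<in> chart_dom c \<inter> U"
  shows "fun_partial c j (\<lambda>p. \<Sum>i\<in>A. u i p) p = (\<Sum>i\<in>A. fun_partial c j (u i) p)"
  unfolding fun_partial_def[of c j "\<lambda>p. \<Sum>i\<in>A. u i p"]
  by (rule partial_derivI, rule DERIV_sum, rule Ck_fun_has_partial[OF assms(1) _ assms(3)], rule assms(2))

lemma Ck_fun_partial:
  assumes "c \<in> atlas M" "openin (mtop M) U" "Ck_fun M (Suc k) U u"
  shows "Ck k (chart_map c ` (chart_dom c \<inter> U)) (\<lambda>x. fun_partial c j u (chart_inv c x))"
proof -
  let ?S = "chart_map c ` (chart_dom c \<inter> U)"
  have "Ck k ?S (partial_deriv j (\<lambda>x. u (chart_inv c x)))"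
    by (rule Ck_partial[OF Ck_fun_chart_img[OF assms(3,1)]])
  then show ?thesis
    by (subst Ck_cong[OF open_image[OF assms(1,2)]]) (use assms(1) in \<open>auto simp: fun_partial_def\<close>)
qed

lemma smooth_functions_Ck: "h \<in> smooth_functions M \<Longrightarrow> Ck_fun M k U h"
  unfolding Ck_fun_def
proof
  fix c assume "h \<in> smooth_functions M" "c \<in> atlas M"
  then have "Ck k (chart_img c) (\<lambda>x. h (chart_inv c x))"
    by (simp add: smooth_functions_def smooth_on_def)
  then show "Ck k (chart_map c ` (chart_dom c \<inter> U)) (\<lambda>x. h (chart_inv c x))"
    by (rule Ck_subset) (auto simp: chart_img_def)
qed

lemma smooth_map_id: "smooth_map M M id"
  using smooth_manifold by (auto simp: smooth_map_def smooth_manifold_def Int_def)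

end

section \<open>Naturality of the Poisson bracket\<close>

text \<open>
  The bracket computed in the chart \<open>c\<close>. Its value does not depend on the chart
  (\<open>chart_bracket_indep\<close>), and it agrees with \<open>poisson_bracket\<close>, which computes in an arbitrarily
  selected chart.
\<close>

definition chart_bracket ::
    "('a, 'n::finite) bivector \<Rightarrow> ('a, 'n) chart \<Rightarrow> ('a \<Rightarrow> real) \<Rightarrow> ('a \<Rightarrow> real) \<Rightarrow> 'a \<Rightarrow> real" where
  "chart_bracket \<pi> c g h p =
     (\<Sum>i\<in>UNIV. \<Sum>j\<in>UNIV. \<pi> c p i j * fun_partial c i g p * fun_partial c j h p)"

text \<open>
  Pairing a bivector with pulled back covectors is pairing its push-forward with the covectors.
\<close>

lemma bivector_pushforward_pairing:
  fixes J :: "'n::finite \<Rightarrow> 'm::finite \<Rightarrow> real"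
  assumes "\<And>i j. (\<Sum>k\<in>UNIV. \<Sum>l\<in>UNIV. J i k * J j l * a k l) = b i j"
  shows "(\<Sum>k\<in>UNIV. \<Sum>l\<in>UNIV. a k l * (\<Sum>i\<in>UNIV. J i k * g i) * (\<Sum>j\<in>UNIV. J j l * h j)) =
    (\<Sum>i\<in>UNIV. \<Sum>j\<in>UNIV. b i j * g i * h j)"
proof -
  have "(\<Sum>k\<in>UNIV. \<Sum>l\<in>UNIV. a k l * (\<Sum>i\<in>UNIV. J i k * g i) * (\<Sum>j\<in>UNIV. J j l * h j)) =
    (\<Sum>k\<in>UNIV. \<Sum>l\<in>UNIV. \<Sum>i\<in>UNIV. \<Sum>j\<in>UNIV. J i k * J j l * a k l * g i * h j)"
    by (simp add: sum_distrib_left sum_distrib_right mult_ac)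
  also have "\<dots> = (\<Sum>k\<in>UNIV. \<Sum>i\<in>UNIV. \<Sum>l\<in>UNIV. \<Sum>j\<in>UNIV. J i k * J j l * a k l * g i * h j)"
    by (rule sum.cong[OF refl], rule sum.swap)
  also have "\<dots> = (\<Sum>i\<in>UNIV. \<Sum>k\<in>UNIV. \<Sum>l\<in>UNIV. \<Sum>j\<in>UNIV. J i k * J j l * a k l * g i * h j)"
    by (rule sum.swap)
  also have "\<dots> = (\<Sum>i\<in>UNIV. \<Sum>k\<in>UNIV. \<Sum>j\<in>UNIV. \<Sum>l\<in>UNIV. J i k * J j l * a k l * g i * h j)"
    by (rule sum.cong[OF refl], rule sum.cong[OF refl], rule sum.swap)
  also have "\<dots> = (\<Sum>i\<in>UNIV. \<Sum>j\<in>UNIV. \<Sum>k\<in>UNIV. \<Sum>l\<in>UNIV. J i k * J j l * a k l * g i * h j)"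
    by (rule sum.cong[OF refl], rule sum.swap)
  also have "\<dots> = (\<Sum>i\<in>UNIV. \<Sum>j\<in>UNIV. b i j * g i * h j)"
    by (simp add: assms[symmetric] sum_distrib_right)
  finally show ?thesis .
qed

locale full_smooth_map = P: full_manifold P + M: full_manifold M
  for P :: "('a, 'm::finite) manifold" and M :: "('b, 'n::finite) manifold" +
  fixes f :: "'a \<Rightarrow> 'b"
  assumes smooth_map: "smooth_map P M f"
begin

lemma continuous: "continuous_map (mtop P) (mtop M) f"
  using smooth_map by (simp add: smooth_map_def)

lemma openin_preimage: "openin (mtop M) U \<Longrightarrow> openin (mtop P) {p \<in> topspace (mtop P). f p \<in> U}"
  using continuous by (rule openin_continuous_map_preimage)

lemma local_rep_Ck:
  assumes "c \<in> atlas P" "d \<in> atlas M"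
  shows "Ck k (chart_map c ` {p \<in> chart_dom c. f p \<in> chart_dom d}) (\<lambda>x. chart_map d (f (chart_inv c x)) $ i)"
  using smooth_map assms by (simp add: smooth_map_def smooth_on_def)

lemma open_local_dom:
  assumes "c \<in> atlas P" "openin (mtop M) U"
  shows "open (chart_map c ` {p \<in> chart_dom c. f p \<in> U})"
proof -
  have "{p \<in> chart_dom c. f p \<in> U} = chart_dom c \<inter> {p \<in> topspace (mtop P). f p \<in> U}"
    using P.dom_subset[OF assms(1)] by auto
  then show ?thesis using P.open_image[OF assms(1) openin_preimage[OF assms(2)]] by simp
qed

lemma Ck_fun_comp:
  assumes U: "openin (mtop M) U" and g: "Ck_fun M k U g"
  shows "Ck_fun P k {p \<in> topspace (mtop P). f p \<in> U} (\<lambda>p. g (f p))"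
  unfolding Ck_fun_def
proof (intro ballI Ck_local)
  fix c x assume c: "c \<in> atlas P" and "x \<in> chart_map c ` (chart_dom c \<inter> {p \<in> topspace (mtop P). f p \<in> U})"
  then obtain p where p: "p \<in> chart_dom c" "f p \<in> U" "x = chart_map c p" by auto
  obtain d where d: "d \<in> atlas M" "f p \<in> chart_dom d"
    using M.charts_cover[of "f p"] p(2) openin_subset[OF U] by auto
  let ?S = "chart_map c ` {p \<in> chart_dom c. f p \<in> chart_dom d \<inter> U}"
  have oS: "open ?S" using c M.openin_dom[OF d(1)] U by (intro open_local_dom) auto
  have "Ck k ?S (\<lambda>x. g (chart_inv d (chart_map d (f (chart_inv c x)))))"
  proof (rule Ck_compose[OF oS M.open_image[OF d(1) U], of "\<lambda>x. chart_map d (f (chart_inv c x))" k "\<lambda>y. g (chart_inv d y)"])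
    show "chart_map d (f (chart_inv c x)) \<in> chart_map d ` (chart_dom d \<inter> U)" if "x \<in> ?S" for x
      using that c by auto
    show "Ck k ?S (\<lambda>x. chart_map d (f (chart_inv c x)) $ i)" for i
      by (rule Ck_subset[OF local_rep_Ck[OF c d(1)]]) auto
    show "Ck k (chart_map d ` (chart_dom d \<inter> U)) (\<lambda>y. g (chart_inv d y))"
      using g d(1) by (simp add: Ck_fun_def)
  qed
  then have "Ck k ?S (\<lambda>x. g (f (chart_inv c x)))"
    by (subst Ck_cong[OF oS]) (use c d in auto)
  then show "\<exists>T. open T \<and> x \<in> T \<and> Ck k T (\<lambda>x. g (f (chart_inv c x)))"
    using oS p d by (intro exI[of _ ?S]) auto
qed

lemma fun_partial_comp:
  assumes c: "c \<in> atlas P" and d: "d \<in> atlas M" and p: "p \<in> chart_dom c" "f p \<in> chart_dom d"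
    and U: "openin (mtop M) U" "f p \<in> U" and g: "Ck_fun M (Suc k) U g"
  shows "fun_partial c j (\<lambda>p. g (f p)) p = (\<Sum>i\<in>UNIV. jacobian c d f p i j * fun_partial d i g (f p))"
proof -
  let ?\<phi> = "\<lambda>x. chart_map d (f (chart_inv c x))"
  let ?S = "chart_map c ` {p \<in> chart_dom c. f p \<in> chart_dom d \<inter> U}"
  have oS: "open ?S" using c M.openin_dom[OF d] U by (intro open_local_dom) auto
  have x: "chart_map c p \<in> ?S" using p U by auto
  have "((\<lambda>t. g (chart_inv d (?\<phi> (chart_map c p + t *\<^sub>R axis j 1)))) has_field_derivative
     (\<Sum>i\<in>UNIV. partial_deriv j (\<lambda>x. ?\<phi> x $ i) (chart_map c p) * partial_deriv i (\<lambda>y. g (chart_inv d y)) (?\<phi> (chart_map c p)))) (at 0)"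
  proof (rule has_partial_compose[of 0 ?S _ _ 0 "chart_map d ` (chart_dom d \<inter> U)"])
    show "Ck (Suc 0) ?S (\<lambda>x. ?\<phi> x $ i)" for i
      by (rule Ck_subset[OF local_rep_Ck[OF c d]]) auto
    show "Ck (Suc 0) (chart_map d ` (chart_dom d \<inter> U)) (\<lambda>y. g (chart_inv d y))"
      using Ck_le[OF M.Ck_fun_chart_img[OF g d]] by blast
    show "?\<phi> (chart_map c p) \<in> chart_map d ` (chart_dom d \<inter> U)" using c p U by auto
  qed (use oS x M.open_image[OF d U(1)] in auto)
  then have "partial_deriv j (\<lambda>x. g (chart_inv d (?\<phi> x))) (chart_map c p) =
     (\<Sum>i\<in>UNIV. jacobian c d f p i j * fun_partial d i g (f p))"
    using c p by (intro partial_derivI) (simp add: jacobian_def fun_partial_def)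
  moreover have "partial_deriv j (\<lambda>x. g (chart_inv d (?\<phi> x))) (chart_map c p) = fun_partial c j (\<lambda>p. g (f p)) p"
    unfolding fun_partial_def by (rule partial_deriv_cong[OF oS x]) (use c d in auto)
  ultimately show ?thesis by simp
qed

text \<open>
  Brackets pull back along maps that relate the bivectors. With \<open>f = id\<close> and one bivector this is
  invariance under change of charts; for a Poisson map it is compatibility with the brackets of \<open>P\<close> and
  \<open>M\<close>.
\<close>

lemma chart_bracket_comp:
  assumes c: "c \<in> atlas P" and d: "d \<in> atlas M" and p: "p \<in> chart_dom c" "f p \<in> chart_dom d"
    and U: "openin (mtop M) U" "f p \<in> U" and g: "Ck_fun M (Suc k) U g" and h: "Ck_fun M (Suc l) U h"
    and \<pi>: "\<And>i j. (\<Sum>k\<in>UNIV. \<Sum>l\<in>UNIV. jacobian c d f p i k * jacobian c d f p j l * \<pi>P c p k l) = \<pi>M d (f p) i j"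
  shows "chart_bracket \<pi>P c (\<lambda>p. g (f p)) (\<lambda>p. h (f p)) p = chart_bracket \<pi>M d g h (f p)"
  unfolding chart_bracket_def fun_partial_comp[OF c d p U g] fun_partial_comp[OF c d p U h]
  by (rule bivector_pushforward_pairing) (rule \<pi>)

end

locale full_poisson_manifold = full_manifold +
  fixes \<pi>
  assumes bivector_field: "bivector_field M \<pi>"
begin

lemma bivector_Ck:
  assumes "c \<in> atlas M"
  shows "Ck k (chart_map c ` (chart_dom c \<inter> U)) (\<lambda>x. \<pi> c (chart_inv c x) i j)"
proof -
  have "Ck k (chart_img c) (\<lambda>x. \<pi> c (chart_inv c x) i j)"
    using bivector_field assms by (simp add: bivector_field_def smooth_on_def)
  then show ?thesis by (rule Ck_subset) (auto simp: chart_img_def)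
qed

lemma bivector_transform:
  assumes "c \<in> atlas M" "d \<in> atlas M" "p \<in> chart_dom c" "p \<in> chart_dom d"
  shows "\<pi> d p i j = (\<Sum>k\<in>UNIV. \<Sum>l\<in>UNIV. jacobian c d id p i k * jacobian c d id p j l * \<pi> c p k l)"
proof -
  have "\<forall>c\<in>atlas M. \<forall>d\<in>atlas M. \<forall>p\<in>chart_dom c \<inter> chart_dom d. \<forall>i\<in>UNIV. \<forall>j\<in>UNIV.
      \<pi> d p i j = (\<Sum>k\<in>UNIV. \<Sum>l\<in>UNIV. jacobian c d id p i k * jacobian c d id p j l * \<pi> c p k l)"
    using bivector_field unfolding bivector_field_def coords by (elim conjE)
  from this[THEN bspec, OF assms(1), THEN bspec, OF assms(2), THEN bspec, OF IntI[OF assms(3,4)],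
      THEN bspec, OF UNIV_I, THEN bspec, OF UNIV_I, of i j]
  show ?thesis .
qed

lemma chart_bracket_indep:
  assumes "c \<in> atlas M" "d \<in> atlas M" "p \<in> chart_dom c" "p \<in> chart_dom d"
    and "openin (mtop M) U" "p \<in> U" "Ck_fun M (Suc k) U g" "Ck_fun M (Suc l) U h"
  shows "chart_bracket \<pi> c g h p = chart_bracket \<pi> d g h p"
proof -
  have id: "full_smooth_map M M id"
    by (rule full_smooth_map.intro[OF full_manifold_axioms full_manifold_axioms full_smooth_map_axioms.intro[OF smooth_map_id]])
  have \<pi>: "(\<Sum>k\<in>UNIV. \<Sum>l\<in>UNIV. jacobian c d id p i k * jacobian c d id p j l * \<pi> c p k l) = \<pi> d (id p) i j" for i j
    using bivector_transform[OF assms(1-4), of i j] by (simp only: id_apply)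
  have "chart_bracket \<pi> c (\<lambda>p. g (id p)) (\<lambda>p. h (id p)) p = chart_bracket \<pi> d g h (id p)"
    by (rule full_smooth_map.chart_bracket_comp[OF id assms(1-3) _ assms(5) _ assms(7,8), where \<pi>P = \<pi> and \<pi>M = \<pi>])
      (use assms(4,6) \<pi> in \<open>simp_all only: id_apply\<close>)
  then show ?thesis by simp
qed

lemma poisson_bracket_chart:
  assumes "c \<in> atlas M" "p \<in> chart_dom c"
    and "openin (mtop M) U" "p \<in> U" "Ck_fun M (Suc k) U g" "Ck_fun M (Suc l) U h"
  shows "poisson_bracket M \<pi> g h p = chart_bracket \<pi> c g h p"
proof -
  define d where "d = (SOME c. c \<in> atlas M \<and> p \<in> chart_dom c)"
  have "d \<in> atlas M \<and> p \<in> chart_dom d"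
    unfolding d_def using assms(1,2) by (intro someI_ex[of "\<lambda>c. c \<in> atlas M \<and> p \<in> chart_dom c"]) auto
  then have "chart_bracket \<pi> d g h p = chart_bracket \<pi> c g h p"
    using assms by (intro chart_bracket_indep[where U = U]) auto
  then show ?thesis by (simp add: poisson_bracket_def d_def[symmetric] chart_bracket_def)
qed

lemma chart_bracket_Ck:
  assumes "c \<in> atlas M" "openin (mtop M) U" "Ck_fun M (Suc k) U g" "Ck_fun M (Suc k) U h"
  shows "Ck k (chart_map c ` (chart_dom c \<inter> U)) (\<lambda>x. chart_bracket \<pi> c g h (chart_inv c x))"
  unfolding chart_bracket_def using assms
  by (intro Ck_sum Ck_mult Ck_fun_partial bivector_Ck open_image)

lemma poisson_bracket_Ck:
  assumes "openin (mtop M) U" "Ck_fun M (Suc k) U g" "Ck_fun M (Suc k) U h"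
  shows "Ck_fun M k U (poisson_bracket M \<pi> g h)"
  unfolding Ck_fun_def
proof
  fix c assume c: "c \<in> atlas M"
  show "Ck k (chart_map c ` (chart_dom c \<inter> U)) (\<lambda>x. poisson_bracket M \<pi> g h (chart_inv c x))"
    using chart_bracket_Ck[OF c assms]
    by (subst Ck_cong[OF open_image[OF c assms(1)]]) (use c poisson_bracket_chart[OF c _ assms(1) _ assms(2,3)] in auto)
qed

lemma chart_bracket_eq_0:
  assumes "c \<in> atlas M" "openin (mtop M) U" "p \<in> chart_dom c \<inter> U" "\<And>q. q \<in> U \<Longrightarrow> u q = a"
  shows "chart_bracket \<pi> c g u p = 0"
  by (simp add: chart_bracket_def fun_partial_eq_0[OF assms])

lemma poisson_bracket_eq_0:
  assumes "openin (mtop M) U" "p \<in> U" "\<And>q. q \<in> U \<Longrightarrow> u q = a"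
  shows "poisson_bracket M \<pi> g u p = 0"
proof -
  define d where "d = (SOME c. c \<in> atlas M \<and> p \<in> chart_dom c)"
  have "\<exists>c. c \<in> atlas M \<and> p \<in> chart_dom c"
    using charts_cover[of p] openin_subset[OF assms(1)] assms(2) by auto
  then have "d \<in> atlas M \<and> p \<in> chart_dom d"
    unfolding d_def by (rule someI_ex)
  then have "chart_bracket \<pi> d g u p = 0"
    using assms by (intro chart_bracket_eq_0[where U = U]) auto
  then show ?thesis by (simp add: poisson_bracket_def d_def[symmetric] chart_bracket_def)
qed

lemma chart_bracket_mult:
  assumes "c \<in> atlas M" "Ck_fun M (Suc k) U u" "Ck_fun M (Suc k) U v" "p \<in> chart_dom c \<inter> U"
  shows "chart_bracket \<pi> c g (\<lambda>p. u p * v p) p = chart_bracket \<pi> c g u p * v p + chart_bracket \<pi> c g v p * u p"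
  unfolding chart_bracket_def fun_partial_mult[OF assms]
  by (simp add: sum_distrib_left sum_distrib_right sum.distrib distrib_left mult_ac)

lemma chart_bracket_sum:
  assumes "c \<in> atlas M" "\<And>i. i \<in> A \<Longrightarrow> Ck_fun M (Suc k) U (u i)" "p \<in> chart_dom c \<inter> U"
  shows "chart_bracket \<pi> c g (\<lambda>p. \<Sum>i\<in>A. u i p) p = (\<Sum>i\<in>A. chart_bracket \<pi> c g (u i) p)"
proof -
  have "(\<Sum>a\<in>A. \<Sum>i\<in>UNIV. \<Sum>j\<in>UNIV. \<pi> c p i j * fun_partial c i g p * fun_partial c j (u a) p) =
    (\<Sum>i\<in>UNIV. \<Sum>j\<in>UNIV. \<Sum>a\<in>A. \<pi> c p i j * fun_partial c i g p * fun_partial c j (u a) p)"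
    by (subst sum.swap, rule sum.cong[OF refl], rule sum.swap)
  then show ?thesis
    by (simp add: chart_bracket_def fun_partial_sum[OF assms] sum_distrib_left)
qed

end

section \<open>Integration of densities by partitions of unity\<close>

definition chart_integral :: "('a, 'n::finite) density \<Rightarrow> ('a, 'n) chart \<Rightarrow> ('a \<Rightarrow> real) \<Rightarrow> real" where
  "chart_integral \<mu> c u = integral (chart_img c) (\<lambda>x. u (chart_inv c x) * \<mu> c (chart_inv c x))"

text \<open>
  The supports are compact in the domains of the charts but may leave \<open>U\<close>: in the application \<open>U\<close> is the
  preimage of an open set, while the supports surround points of a fibre and reach beyond it. Compactness
  inside \<open>U\<close> is supplied by the functions that are integrated against the partition.
\<close>

definition partition_of_unity ::
    "('a, 'n::finite) manifold \<Rightarrow> nat \<Rightarrow> 'a set \<Rightarrow> 'i set \<Rightarrow> ('i \<Rightarrow> ('a, 'n) chart) \<Rightarrow> ('i \<Rightarrow> 'a \<Rightarrow> real) \<Rightarrow> bool" where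
  "partition_of_unity M k U B ch \<rho> \<longleftrightarrow> finite B \<and> (\<forall>p\<in>U. (\<Sum>b\<in>B. \<rho> b p) = 1) \<and>
     (\<forall>b\<in>B. ch b \<in> atlas M \<and> Ck_fun M k U (\<rho> b) \<and>
        (\<exists>K. compactin (mtop M) K \<and> K \<subseteq> chart_dom (ch b) \<and> (\<forall>p\<in>topspace (mtop M) - K. \<rho> b p = 0)))"

lemma Cc_on_partial_deriv:
  assumes S: "open S" and u: "Ck (Suc 0) S u" and K: "compact K" "K \<subseteq> S" "\<And>x. x \<in> S \<Longrightarrow> x \<notin> K \<Longrightarrow> u x = 0"
  shows "Cc_on S (partial_deriv j u)"
proof (rule Cc_onI[OF Ck_continuous[OF Ck_partial[OF u]] K(1,2)])
  fix x assume "x \<in> S" "x \<notin> K"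
  then have "partial_deriv j u x = partial_deriv j (\<lambda>x. 0) x"
    using S K by (intro partial_deriv_cong[of "S \<inter> - K"]) (auto simp: compact_imp_closed open_Compl open_Int)
  then show "partial_deriv j u x = 0" by (simp add: partial_deriv_def)
qed

locale full_density = full_manifold M for M :: "('a, 'n::{finite,wellorder}) manifold" +
  fixes \<mu> :: "('a, 'n) density"
  assumes smooth_density: "smooth_density M \<mu>"
begin

lemma density_Ck:
  assumes "c \<in> atlas M"
  shows "Ck k (chart_img c) (\<lambda>x. \<mu> c (chart_inv c x))"
  using smooth_density assms by (simp add: smooth_density_def smooth_on_def)

lemma density_transform:
  assumes "c \<in> atlas M" "d \<in> atlas M" "p \<in> chart_dom c" "p \<in> chart_dom d"
  shows "\<mu> c p = density_factor M c d p * \<mu> d p"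
proof -
  have "\<forall>c\<in>atlas M. \<forall>d\<in>atlas M. \<forall>p\<in>chart_dom c \<inter> chart_dom d. \<mu> c p = density_factor M c d p * \<mu> d p"
    using smooth_density unfolding smooth_density_def by (elim conjE)
  from this[THEN bspec, OF assms(1), THEN bspec, OF assms(2), THEN bspec, OF IntI[OF assms(3,4)]]
  show ?thesis .
qed

lemma image_open_subset:
  assumes "c \<in> atlas M" "openin (mtop M) U" "U \<subseteq> chart_dom c"
  shows "open (chart_map c ` U)" "chart_map c ` U \<subseteq> chart_img c"
  using open_image[OF assms(1,2)] assms(3) by (auto simp: Int_absorb1 chart_img_def)

lemma integrand_Cc:
  assumes c: "c \<in> atlas M" and U: "openin (mtop M) U" "U \<subseteq> chart_dom c" and u: "supp_in M 0 U u"
  shows "Cc_on (chart_map c ` U) (\<lambda>x. u (chart_inv c x) * \<mu> c (chart_inv c x))"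
    "Cc_on (chart_img c) (\<lambda>x. u (chart_inv c x) * \<mu> c (chart_inv c x))"
proof -
  obtain K where K: "compactin (mtop M) K" "K \<subseteq> U" "\<forall>p\<in>topspace (mtop M) - K. u p = 0"
    using u by (auto simp: supp_in_def)
  have "continuous_on (chart_map c ` U) (\<lambda>x. u (chart_inv c x))"
    using u c U(2) Ck_fun_chart_img[of 0 U u c] by (auto simp: supp_in_def Int_absorb1)
  moreover have "continuous_on (chart_map c ` U) (\<lambda>x. \<mu> c (chart_inv c x))"
    using Ck_continuous[OF density_Ck[OF c]] image_open_subset(2)[OF c U] by (rule continuous_on_subset)
  ultimately have cont: "continuous_on (chart_map c ` U) (\<lambda>x. u (chart_inv c x) * \<mu> c (chart_inv c x))"
    by (rule continuous_on_mult)
  have z: "u (chart_inv c x) = 0" if "x \<in> chart_img c" "x \<notin> chart_map c ` K" for x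
    using that K dom_subset[OF c] c by (metis DiffI image_eqI inv_in_dom map_inv subsetD)
  show *: "Cc_on (chart_map c ` U) (\<lambda>x. u (chart_inv c x) * \<mu> c (chart_inv c x))"
    using cont compact_image[OF c K(1)] K U z image_open_subset(2)[OF c U]
    by (intro Cc_onI[of _ _ "chart_map c ` K"]) auto
  show "Cc_on (chart_img c) (\<lambda>x. u (chart_inv c x) * \<mu> c (chart_inv c x))"
  proof (rule Cc_on_subset[OF *])
    fix x assume x: "x \<in> chart_img c - chart_map c ` U"
    then have "x \<notin> chart_map c ` K" using K(2) by auto
    then show "u (chart_inv c x) * \<mu> c (chart_inv c x) = 0" using z x by simp
  qed (use image_open_subset[OF c U] in auto)
qed

lemma chart_integral_cong:
  assumes "\<And>p. p \<in> chart_dom c \<Longrightarrow> u p = v p"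
  shows "chart_integral \<mu> c u = chart_integral \<mu> c v"
  unfolding chart_integral_def by (intro integral_cong) (auto simp: assms)

lemma chart_integral_restrict:
  assumes c: "c \<in> atlas M" and U: "U \<subseteq> chart_dom c" and z: "\<And>p. p \<in> chart_dom c \<Longrightarrow> p \<notin> U \<Longrightarrow> u p = 0"
  shows "chart_integral \<mu> c u = integral (chart_map c ` U) (\<lambda>x. u (chart_inv c x) * \<mu> c (chart_inv c x))"
proof -
  let ?f = "\<lambda>x. u (chart_inv c x) * \<mu> c (chart_inv c x)"
  have "x \<in> chart_map c ` U" if "x \<in> chart_img c" "chart_inv c x \<in> U" for x
    using that by (metis image_eqI map_inv)
  then have "(\<lambda>x. if x \<in> chart_img c then ?f x else 0) = (\<lambda>x. if x \<in> chart_map c ` U then ?f x else 0)"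
    using z[OF inv_in_dom] image_mono[OF U, of "chart_map c"] by (intro ext) (auto simp: chart_img_def[symmetric])
  then have "integral UNIV (\<lambda>x. if x \<in> chart_img c then ?f x else 0) = integral UNIV (\<lambda>x. if x \<in> chart_map c ` U then ?f x else 0)"
    by simp
  then show ?thesis unfolding chart_integral_def integral_restrict_UNIV .
qed

lemma chart_integral_sum:
  assumes c: "c \<in> atlas M" and U: "openin (mtop M) U" "U \<subseteq> chart_dom c" and A: "finite A" "\<And>i. i \<in> A \<Longrightarrow> supp_in M 0 U (u i)"
  shows "chart_integral \<mu> c (\<lambda>p. \<Sum>i\<in>A. u i p) = (\<Sum>i\<in>A. chart_integral \<mu> c (u i))"
  unfolding chart_integral_def sum_distrib_right
  using A Cc_on_integrable[OF open_img[OF c] integrand_Cc(2)[OF c U A(2)]] by (intro integral_sum) auto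

lemma chart_integral_add:
  assumes c: "c \<in> atlas M" and U: "openin (mtop M) U" "U \<subseteq> chart_dom c" and "supp_in M 0 U u" "supp_in M 0 U v"
  shows "chart_integral \<mu> c (\<lambda>p. u p + v p) = chart_integral \<mu> c u + chart_integral \<mu> c v"
  unfolding chart_integral_def distrib_right
  using Cc_on_integrable[OF open_img[OF c] integrand_Cc(2)[OF c U assms(4)]]
    Cc_on_integrable[OF open_img[OF c] integrand_Cc(2)[OF c U assms(5)]] by (rule integral_add)

text \<open>
  The transformation law of a density is the change of variables formula.
\<close>

lemma chart_integral_change_chart:
  assumes c: "c \<in> atlas M" and d: "d \<in> atlas M" and u: "supp_in M 0 (chart_dom c \<inter> chart_dom d) u"
  shows "chart_integral \<mu> c u = chart_integral \<mu> d u"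
proof -
  let ?D = "chart_dom c \<inter> chart_dom d"
  have D: "openin (mtop M) ?D" using c d by (intro openin_Int openin_dom)
  have z: "u p = 0" if "p \<in> chart_dom c \<or> p \<in> chart_dom d" "p \<notin> ?D" for p
    using u that dom_subset[OF c] dom_subset[OF d] by (auto simp: supp_in_def subset_iff)
  define T where "T x = chart_map d (chart_inv c x)" for x
  let ?S = "chart_map c ` ?D"
  have oS: "open ?S" and TS: "T ` ?S = chart_map d ` ?D"
    using image_open_subset(1)[OF c D] c by (auto simp: T_def image_image)
  have CkT: "Ck k ?S (\<lambda>x. T x $ i)" for k i
    unfolding T_def by (rule transition_Ck[OF c d])
  let ?w = "\<lambda>y. u (chart_inv d y) * \<mu> d (chart_inv d y)"
  have "chart_integral \<mu> d u = integral (T ` ?S) ?w"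
    unfolding TS by (rule chart_integral_restrict[OF d]) (use z in auto)
  also have "\<dots> = integral ?S (\<lambda>x. \<bar>det (matrix ((*v) (jac T x)))\<bar> * ?w (T x))"
  proof (rule integral_change_of_variables_real[OF oS])
    show "(T has_derivative (*v) (jac T x)) (at x)" if "x \<in> ?S" for x
      using has_derivative_jac[of 0, OF CkT oS that] .
    show "inj_on T ?S"
      using c d inj_chart[OF d] by (auto simp: inj_on_def T_def)
    show "?w absolutely_integrable_on T ` ?S"
      unfolding TS using D by (intro Cc_on_absolutely_integrable image_open_subset(1)[OF d] integrand_Cc(1)[OF d] u) auto
  qed
  also have "\<dots> = integral ?S (\<lambda>x. u (chart_inv c x) * \<mu> c (chart_inv c x))"
  proof (rule integral_cong)
    fix x assume "x \<in> ?S"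
    then obtain p where p: "p \<in> chart_dom c" "p \<in> chart_dom d" "x = chart_map c p" by auto
    have "(\<chi> i j. jacobian c d id p i j) = jac T x"
      by (simp add: vec_eq_iff jacobian_def jac_def T_def p(3))
    then have "density_factor M c d p = \<bar>det (jac T x)\<bar>"
      by (simp only: density_factor_def coords UNIV_not_empty if_False)
    then show "\<bar>det (matrix ((*v) (jac T x)))\<bar> * ?w (T x) = u (chart_inv c x) * \<mu> c (chart_inv c x)"
      using density_transform[OF c d p(1,2)] c d p by (simp add: T_def)
  qed
  also have "\<dots> = chart_integral \<mu> c u"
    by (rule chart_integral_restrict[OF c, symmetric]) (use z in auto)
  finally show ?thesis by simp
qed

lemma partition_piece:
  assumes part: "partition_of_unity M k U B ch \<rho>" and b: "b \<in> B" and U: "openin (mtop M) U"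
    and W: "openin (mtop M) W" "W \<subseteq> U" and u: "supp_in M k W u"
  shows "supp_in M k (W \<inter> chart_dom (ch b)) (\<lambda>p. \<rho> b p * u p)"
proof -
  obtain K where K: "compactin (mtop M) K" "K \<subseteq> chart_dom (ch b)" "\<forall>p\<in>topspace (mtop M) - K. \<rho> b p = 0"
    and "ch b \<in> atlas M" "Ck_fun M k U (\<rho> b)"
    using part b by (auto simp: partition_of_unity_def)
  then show ?thesis
    using openin_subset[OF W(1)] W
    by (intro supp_in_localize[OF u W(1) _ K(1,2)] openin_dom) (auto intro: Ck_fun_subset)
qed

lemma partition_sum_mult:
  assumes part: "partition_of_unity M k U B ch \<rho>" and u: "supp_in M l U u" and p: "p \<in> topspace (mtop M)"
  shows "(\<Sum>b\<in>B. \<rho> b p * u p) = u p"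
proof (cases "p \<in> U")
  case True
  then show ?thesis using part by (simp add: partition_of_unity_def sum_distrib_right[symmetric])
next
  case False
  then have "u p = 0" using u p by (auto simp: supp_in_def)
  then show ?thesis by simp
qed

lemma chart_integral_partition:
  assumes part: "partition_of_unity M 0 U B ch \<rho>" and U: "openin (mtop M) U"
    and c: "c \<in> atlas M" and u: "supp_in M 0 (U \<inter> chart_dom c) u"
  shows "chart_integral \<mu> c u = (\<Sum>b\<in>B. chart_integral \<mu> (ch b) (\<lambda>p. \<rho> b p * u p))"
proof -
  have Uc: "openin (mtop M) (U \<inter> chart_dom c)" using U c by (intro openin_Int openin_dom)
  have chb: "ch b \<in> atlas M" if "b \<in> B" for b using part that by (simp add: partition_of_unity_def)
  have piece: "supp_in M 0 (U \<inter> chart_dom c \<inter> chart_dom (ch b)) (\<lambda>p. \<rho> b p * u p)" if "b \<in> B" for b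
    using partition_piece[OF part that U Uc _ u] by auto
  have uU: "supp_in M 0 U u" using supp_in_extend[OF u Uc U] by auto
  have "chart_integral \<mu> c u = chart_integral \<mu> c (\<lambda>p. \<Sum>b\<in>B. \<rho> b p * u p)"
    by (rule chart_integral_cong) (use partition_sum_mult[OF part uU] dom_subset[OF c] in auto)
  also have "\<dots> = (\<Sum>b\<in>B. chart_integral \<mu> c (\<lambda>p. \<rho> b p * u p))"
  proof (rule chart_integral_sum[OF c openin_dom[OF c]])
    show "finite B" using part by (simp add: partition_of_unity_def)
    show "supp_in M 0 (chart_dom c) (\<lambda>p. \<rho> b p * u p)" if "b \<in> B" for b
      by (rule supp_in_extend[OF piece[OF that]]) (use Uc c chb[OF that] openin_dom in auto)
  qed simp
  also have "\<dots> = (\<Sum>b\<in>B. chart_integral \<mu> (ch b) (\<lambda>p. \<rho> b p * u p))"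
  proof (rule sum.cong[OF refl], rule chart_integral_change_chart[OF c chb])
    fix b assume b: "b \<in> B"
    show "supp_in M 0 (chart_dom c \<inter> chart_dom (ch b)) (\<lambda>p. \<rho> b p * u p)"
      by (rule supp_in_extend[OF piece[OF b]]) (use Uc c chb[OF b] openin_dom in auto)
  qed
  finally show ?thesis .
qed

text \<open>
  Both sums equal the double sum of the integrals of \<open>\<rho>' b' \<rho> b u\<close>, each of which may be computed in
  either of the two charts.
\<close>

lemma partition_integral_indep:
  assumes part: "partition_of_unity M 0 U B ch \<rho>" and part': "partition_of_unity M 0 U B' ch' \<rho>'"
    and U: "openin (mtop M) U" and u: "supp_in M 0 U u"
  shows "(\<Sum>b\<in>B. chart_integral \<mu> (ch b) (\<lambda>p. \<rho> b p * u p)) = (\<Sum>b\<in>B'. chart_integral \<mu> (ch' b) (\<lambda>p. \<rho>' b p * u p))"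
proof -
  have chb: "ch b \<in> atlas M" if "b \<in> B" for b using part that by (simp add: partition_of_unity_def)
  have chb': "ch' b \<in> atlas M" if "b \<in> B'" for b using part' that by (simp add: partition_of_unity_def)
  have piece: "supp_in M 0 (U \<inter> chart_dom (ch b)) (\<lambda>p. \<rho> b p * u p)" if "b \<in> B" for b
    using partition_piece[OF part that U U _ u] by auto
  have "(\<Sum>b\<in>B. chart_integral \<mu> (ch b) (\<lambda>p. \<rho> b p * u p)) =
      (\<Sum>b\<in>B. \<Sum>b'\<in>B'. chart_integral \<mu> (ch' b') (\<lambda>p. \<rho>' b' p * (\<rho> b p * u p)))"
    using chart_integral_partition[OF part' U chb piece] by simp
  also have "\<dots> = (\<Sum>b'\<in>B'. \<Sum>b\<in>B. chart_integral \<mu> (ch' b') (\<lambda>p. \<rho>' b' p * (\<rho> b p * u p)))"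
    by (rule sum.swap)
  also have "\<dots> = (\<Sum>b'\<in>B'. chart_integral \<mu> (ch' b') (\<lambda>p. \<rho>' b' p * u p))"
  proof (rule sum.cong[OF refl])
    fix b' assume b': "b' \<in> B'"
    have "(\<Sum>b\<in>B. chart_integral \<mu> (ch' b') (\<lambda>p. \<rho>' b' p * (\<rho> b p * u p))) =
      chart_integral \<mu> (ch' b') (\<lambda>p. \<Sum>b\<in>B. \<rho>' b' p * (\<rho> b p * u p))"
    proof (rule chart_integral_sum[OF chb'[OF b'] openin_dom[OF chb'[OF b']] order_refl, symmetric])
      show "finite B" using part by (simp add: partition_of_unity_def)
      fix b assume b: "b \<in> B"
      have o: "openin (mtop M) (U \<inter> chart_dom (ch b))" using U chb[OF b] by (intro openin_Int openin_dom)
      have "supp_in M 0 (U \<inter> chart_dom (ch b) \<inter> chart_dom (ch' b')) (\<lambda>p. \<rho>' b' p * (\<rho> b p * u p))"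
        by (rule partition_piece[OF part' b' U o _ piece[OF b]]) simp
      then show "supp_in M 0 (chart_dom (ch' b')) (\<lambda>p. \<rho>' b' p * (\<rho> b p * u p))"
        by (rule supp_in_extend) (use o openin_dom[OF chb'[OF b']] in auto)
    qed
    also have "\<dots> = chart_integral \<mu> (ch' b') (\<lambda>p. \<rho>' b' p * u p)"
      by (rule chart_integral_cong)
        (use partition_sum_mult[OF part u] dom_subset[OF chb'[OF b']] in \<open>auto simp: sum_distrib_left[symmetric]\<close>)
    finally show "(\<Sum>b\<in>B. chart_integral \<mu> (ch' b') (\<lambda>p. \<rho>' b' p * (\<rho> b p * u p))) =
      chart_integral \<mu> (ch' b') (\<lambda>p. \<rho>' b' p * u p)" .
  qed
  finally show ?thesis .
qed

end

section \<open>The divergence theorem for an invariant density\<close>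

text \<open>
  The Hamiltonian \<open>H\<close> will be the pull-back of a smooth function on the base.
\<close>

locale invariant_density = full_density M \<mu> + full_poisson_manifold M \<pi>
  for M :: "('a, 'n::{finite,wellorder}) manifold" and \<mu> \<pi> +
  fixes H :: "'a \<Rightarrow> real"
  assumes H: "H \<in> smooth_functions M"
    and invariant: "\<And>c p. c \<in> atlas M \<Longrightarrow> p \<in> chart_dom c \<Longrightarrow> lie_derivative M (hamiltonian_vf M \<pi> H) \<mu> c p = 0"
begin

text \<open>
  Writing \<open>X\<close> for the Hamiltonian field of \<open>H\<close> in coordinates, \<open>{H, w} \<mu>\<close> is the divergence of \<open>w X \<mu>\<close>
  because \<open>X \<mu>\<close> is free of divergence.
\<close>

lemma chart_integral_bracket_eq_0:
  assumes c: "c \<in> atlas M" and w: "supp_in M (Suc 0) (chart_dom c) w"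
  shows "chart_integral \<mu> c (chart_bracket \<pi> c H w) = 0"
proof -
  let ?S = "chart_img c"
  have S: "open ?S" using c by (rule open_img)
  have img: "chart_map c ` (chart_dom c \<inter> chart_dom c) = ?S" by (simp add: chart_img_def)
  have wC: "Ck_fun M (Suc 0) (chart_dom c) w" using w by (simp add: supp_in_def)
  obtain K where K: "compactin (mtop M) K" "K \<subseteq> chart_dom c" "\<forall>p\<in>topspace (mtop M) - K. w p = 0"
    using w by (auto simp: supp_in_def)
  define X where "X j x = hamiltonian_vf M \<pi> H c (chart_inv c x) j * \<mu> c (chart_inv c x)" for j x
  define u where "u j x = w (chart_inv c x) * X j x" for j x
  have CkX: "Ck (Suc 0) ?S (X j)" for j
  proof -
    have "Ck (Suc 0) ?S (\<lambda>x. hamiltonian_vf M \<pi> H c (chart_inv c x) j)"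
      using Ck_fun_partial[OF c openin_dom[OF c] smooth_functions_Ck[OF H], of "Suc 0"]
        bivector_Ck[OF c, of "Suc 0" "chart_dom c"]
      unfolding hamiltonian_vf_def img coords by (intro Ck_sum Ck_mult S)
    then show ?thesis unfolding X_def using density_Ck[OF c] by (intro Ck_mult S)
  qed
  have Ckw: "Ck (Suc 0) ?S (\<lambda>x. w (chart_inv c x))"
    using Ck_fun_chart_img[OF wC c] unfolding img .
  have Cku: "Ck (Suc 0) ?S (u j)" for j
    unfolding u_def using Ckw CkX by (rule Ck_mult[OF S])
  have Kc: "compact (chart_map c ` K)" "chart_map c ` K \<subseteq> ?S"
    using compact_image[OF c K(1,2)] K(2) by (auto simp: chart_img_def)
  have z: "u j x = 0" if "x \<in> ?S" "x \<notin> chart_map c ` K" for x j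
  proof -
    have "chart_inv c x \<in> topspace (mtop M) - K"
      using that dom_subset[OF c] by (metis DiffI image_eqI inv_in_dom map_inv subsetD)
    then show ?thesis using K(3) by (simp add: u_def)
  qed
  have pd: "partial_deriv j (u j) x = fun_partial c j w (chart_inv c x) * X j x + partial_deriv j (X j) x * w (chart_inv c x)"
    if "x \<in> ?S" for j x
    unfolding u_def
    by (rule partial_derivI)
       (use has_partial_mult[OF Ck_has_partial[OF Ckw that, of j] Ck_has_partial[OF CkX that, of j j]] that in
         \<open>simp add: fun_partial_def del: Ck_on.simps\<close>)
  have lie: "(\<Sum>j\<in>UNIV. partial_deriv j (X j) x) = 0" if "x \<in> ?S" for x
    using invariant[OF c, of "chart_inv c x"] that by (simp add: lie_derivative_def fun_partial_def X_def[abs_def])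
  have "(\<Sum>j\<in>UNIV. partial_deriv j (u j) x) = chart_bracket \<pi> c H w (chart_inv c x) * \<mu> c (chart_inv c x)" if x: "x \<in> ?S" for x
  proof -
    have "(\<Sum>j\<in>UNIV. partial_deriv j (u j) x) = (\<Sum>j\<in>UNIV. fun_partial c j w (chart_inv c x) * X j x)
       + (\<Sum>j\<in>UNIV. partial_deriv j (X j) x) * w (chart_inv c x)"
      by (simp add: pd[OF x] sum.distrib sum_distrib_right)
    also have "\<dots> = (\<Sum>j\<in>UNIV. fun_partial c j w (chart_inv c x) * X j x)" by (simp add: lie[OF x])
    also have "\<dots> = (\<Sum>j\<in>UNIV. \<Sum>i\<in>UNIV. \<pi> c (chart_inv c x) i j * fun_partial c i H (chart_inv c x) *
        fun_partial c j w (chart_inv c x)) * \<mu> c (chart_inv c x)"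
      by (simp add: X_def hamiltonian_vf_def sum_distrib_right sum_distrib_left mult_ac)
    also have "\<dots> = chart_bracket \<pi> c H w (chart_inv c x) * \<mu> c (chart_inv c x)"
      unfolding chart_bracket_def by (subst sum.swap) (rule refl)
    finally show ?thesis .
  qed
  then have "chart_integral \<mu> c (chart_bracket \<pi> c H w) = integral ?S (\<lambda>x. \<Sum>j\<in>UNIV. partial_deriv j (u j) x)"
    unfolding chart_integral_def by (intro integral_cong) simp
  also have "\<dots> = (\<Sum>j\<in>UNIV. integral ?S (partial_deriv j (u j)))"
    using Cc_on_integrable[OF S Cc_on_partial_deriv[OF S Cku Kc z]] by (intro integral_sum) auto
  also have "\<dots> = 0"
    using integral_partial_deriv_eq_0[OF S Cku Kc z] by simp
  finally show ?thesis .
qed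

text \<open>
  Integration by parts in each chart moves the bracket from \<open>u\<close> to \<open>\<rho> b\<close>. The resulting integrals of
  \<open>u {H, \<rho> b}\<close> live in different charts; after spreading each of them over the partition they combine to
  an integral of \<open>u {H, \<Sum>\<^sub>b \<rho> b} = u {H, 1} = 0\<close>.
\<close>

lemma partition_integral_bracket_eq_0:
  assumes part: "partition_of_unity M (Suc 0) U B ch \<rho>" and U: "openin (mtop M) U" and u: "supp_in M (Suc 0) U u"
  shows "(\<Sum>b\<in>B. chart_integral \<mu> (ch b) (\<lambda>p. \<rho> b p * poisson_bracket M \<pi> H u p)) = 0"
proof -
  let ?br = "poisson_bracket M \<pi> H"
  have chb: "ch b \<in> atlas M" and \<rho>: "Ck_fun M (Suc 0) U (\<rho> b)" if "b \<in> B" for b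
    using part that by (auto simp: partition_of_unity_def)
  have fin: "finite B" using part by (simp add: partition_of_unity_def)
  have part0: "partition_of_unity M 0 U B ch \<rho>"
    using part Ck_fun_le[of "Suc 0" U _ 0] by (auto simp: partition_of_unity_def)
  have HU: "Ck_fun M (Suc 0) V H" for V by (rule smooth_functions_Ck[OF H])
  obtain K where K: "compactin (mtop M) K" "K \<subseteq> U" "\<forall>p\<in>topspace (mtop M) - K. u p = 0" and uC: "Ck_fun M (Suc 0) U u"
    using u by (auto simp: supp_in_def)
  have u0: "supp_in M 0 U u" using supp_in_le[OF u] by simp
  have oK: "openin (mtop M) (topspace (mtop M) - K)" by (rule openin_Compl_compact[OF K(1)])
  have bru: "supp_in M 0 U (?br u)"
    unfolding supp_in_def
  proof (intro conjI exI[of _ K] ballI)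
    show "Ck_fun M 0 U (?br u)" using poisson_bracket_Ck[OF U HU uC] .
    show "?br u p = 0" if "p \<in> topspace (mtop M) - K" for p
      by (rule poisson_bracket_eq_0[OF oK that]) (use K in auto)
  qed (use K in auto)
  have v: "supp_in M 0 (U \<inter> chart_dom (ch b)) (\<lambda>p. ?br (\<rho> b) p * u p)" if b: "b \<in> B" for b
  proof -
    obtain L where L: "compactin (mtop M) L" "L \<subseteq> chart_dom (ch b)" "\<forall>p\<in>topspace (mtop M) - L. \<rho> b p = 0"
      using part b by (auto simp: partition_of_unity_def)
    show ?thesis
    proof (rule supp_in_localize[OF u0 U poisson_bracket_Ck[OF U HU \<rho>[OF b]] L(1,2) _ openin_dom[OF chb[OF b]]])
      fix p assume "p \<in> U" "p \<notin> L"
      then show "?br (\<rho> b) p = 0"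
        using L openin_subset[OF U] by (intro poisson_bracket_eq_0[OF openin_Compl_compact[OF L(1)]]) auto
    qed
  qed
  have o: "openin (mtop M) (U \<inter> chart_dom (ch b))" if "b \<in> B" for b
    using U chb[OF that] by (intro openin_Int openin_dom)
  have by_parts: "chart_integral \<mu> (ch b) (\<lambda>p. \<rho> b p * ?br u p) = - chart_integral \<mu> (ch b) (\<lambda>p. ?br (\<rho> b) p * u p)"
    if b: "b \<in> B" for b
  proof -
    have w: "supp_in M (Suc 0) (chart_dom (ch b)) (\<lambda>p. \<rho> b p * u p)"
      by (rule supp_in_extend[OF partition_piece[OF part b U U _ u] o[OF b] openin_dom[OF chb[OF b]]]) auto
    have "supp_in M 0 (U \<inter> chart_dom (ch b)) (\<lambda>p. \<rho> b p * ?br u p)"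
      by (rule partition_piece[OF part0 b U U _ bru]) simp
    then have "chart_integral \<mu> (ch b) (\<lambda>p. \<rho> b p * ?br u p) + chart_integral \<mu> (ch b) (\<lambda>p. ?br (\<rho> b) p * u p) =
      chart_integral \<mu> (ch b) (\<lambda>p. \<rho> b p * ?br u p + ?br (\<rho> b) p * u p)"
      using v[OF b] o[OF b] by (intro chart_integral_add[OF chb[OF b] _ _ _ , symmetric]) auto
    also have "\<dots> = chart_integral \<mu> (ch b) (chart_bracket \<pi> (ch b) H (\<lambda>p. \<rho> b p * u p))"
    proof (rule chart_integral_cong)
      fix p assume p: "p \<in> chart_dom (ch b)"
      show "\<rho> b p * ?br u p + ?br (\<rho> b) p * u p = chart_bracket \<pi> (ch b) H (\<lambda>p. \<rho> b p * u p) p"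
      proof (cases "p \<in> U")
        case True
        then show ?thesis
          using chart_bracket_mult[OF chb[OF b] \<rho>[OF b] uC, where p = p and g = H] p
            poisson_bracket_chart[OF chb[OF b] p U True HU uC] poisson_bracket_chart[OF chb[OF b] p U True HU \<rho>[OF b]]
          by simp
      next
        case False
        then have pK: "p \<in> topspace (mtop M) - K" using K(2) p dom_subset[OF chb[OF b]] by auto
        have "chart_bracket \<pi> (ch b) H (\<lambda>p. \<rho> b p * u p) p = 0"
          by (rule chart_bracket_eq_0[OF chb[OF b] oK, where a = 0]) (use p pK K(3) in auto)
        moreover have "?br u p = 0"
          by (rule poisson_bracket_eq_0[OF oK pK, where a = 0]) (use K(3) in auto)
        ultimately show ?thesis using K(3) pK by auto
      qed
    qed
    also have "\<dots> = 0" by (rule chart_integral_bracket_eq_0[OF chb[OF b] w])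
    finally show ?thesis by simp
  qed
  have sum0: "(\<Sum>b\<in>B. ?br (\<rho> b) p * u p) = 0" if p: "p \<in> topspace (mtop M)" for p
  proof (cases "p \<in> U")
    case True
    obtain c where c: "c \<in> atlas M" "p \<in> chart_dom c" using charts_cover[OF p] by blast
    have "(\<Sum>b\<in>B. ?br (\<rho> b) p) = (\<Sum>b\<in>B. chart_bracket \<pi> c H (\<rho> b) p)"
      using poisson_bracket_chart[OF c U True HU \<rho>] by (intro sum.cong) auto
    also have "\<dots> = chart_bracket \<pi> c H (\<lambda>p. \<Sum>b\<in>B. \<rho> b p) p"
      using chart_bracket_sum[OF c(1), of B 0 U \<rho> p H] \<rho> c(2) True by simp
    also have "\<dots> = 0"
      by (rule chart_bracket_eq_0[OF c(1) U, where a = 1]) (use c(2) True part in \<open>auto simp: partition_of_unity_def\<close>)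
    finally show ?thesis by (simp add: sum_distrib_right[symmetric])
  next
    case False
    then have "u p = 0" using p K by auto
    then show ?thesis by simp
  qed
  have "(\<Sum>b\<in>B. chart_integral \<mu> (ch b) (\<lambda>p. \<rho> b p * ?br u p)) =
    - (\<Sum>b\<in>B. chart_integral \<mu> (ch b) (\<lambda>p. ?br (\<rho> b) p * u p))"
    by (simp add: by_parts sum_negf)
  also have "(\<Sum>b\<in>B. chart_integral \<mu> (ch b) (\<lambda>p. ?br (\<rho> b) p * u p)) =
     (\<Sum>b\<in>B. \<Sum>a\<in>B. chart_integral \<mu> (ch a) (\<lambda>p. \<rho> a p * (?br (\<rho> b) p * u p)))"
    using chart_integral_partition[OF part0 U chb v] by simp
  also have "\<dots> = (\<Sum>a\<in>B. \<Sum>b\<in>B. chart_integral \<mu> (ch a) (\<lambda>p. \<rho> a p * (?br (\<rho> b) p * u p)))"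
    by (rule sum.swap)
  also have "\<dots> = (\<Sum>a\<in>B. chart_integral \<mu> (ch a) (\<lambda>p. \<Sum>b\<in>B. \<rho> a p * (?br (\<rho> b) p * u p)))"
  proof (rule sum.cong[OF refl], rule chart_integral_sum[OF chb openin_dom[OF chb] order_refl fin, symmetric])
    fix a b assume a: "a \<in> B" and b: "b \<in> B"
    have "supp_in M 0 (U \<inter> chart_dom (ch b) \<inter> chart_dom (ch a)) (\<lambda>p. \<rho> a p * (?br (\<rho> b) p * u p))"
      by (rule partition_piece[OF part0 a U o[OF b] _ v[OF b]]) simp
    then show "supp_in M 0 (chart_dom (ch a)) (\<lambda>p. \<rho> a p * (?br (\<rho> b) p * u p))"
      by (rule supp_in_extend) (use o[OF b] openin_dom[OF chb[OF a]] in auto)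
  qed
  also have "\<dots> = (\<Sum>a\<in>B. chart_integral \<mu> (ch a) (\<lambda>p. 0))"
  proof (intro sum.cong[OF refl] chart_integral_cong)
    fix a p assume "a \<in> B" "p \<in> chart_dom (ch a)"
    then show "(\<Sum>b\<in>B. \<rho> a p * (?br (\<rho> b) p * u p)) = 0"
      using sum0[of p] dom_subset[OF chb[of a]] by (auto simp: sum_distrib_left[symmetric])
  qed
  also have "\<dots> = 0" by (simp add: chart_integral_def)
  finally show ?thesis by simp
qed

end

section \<open>Bump functions\<close>

definition bump :: "nat \<Rightarrow> real^'n \<Rightarrow> real \<Rightarrow> real^'n \<Rightarrow> real" where
  "bump k x0 r x = max 0 (r\<^sup>2 - (\<Sum>i\<in>UNIV. (x $ i - x0 $ i)\<^sup>2)) ^ Suc k"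

lemma bump_eq: "bump k x0 r x = max 0 (r\<^sup>2 - (norm (x - x0))\<^sup>2) ^ Suc k"
proof -
  have "(norm (x - x0))\<^sup>2 = (\<Sum>i\<in>UNIV. (x $ i - x0 $ i)\<^sup>2)"
    unfolding power2_norm_eq_inner by (simp add: inner_vec_def power2_eq_square)
  then show ?thesis by (simp only: bump_def)
qed

lemma bump_nonneg: "0 \<le> bump k x0 r x"
  unfolding bump_eq by (intro zero_le_power) simp

lemma bump_pos: "x \<in> ball x0 r \<Longrightarrow> 0 < bump k x0 r x"
proof -
  assume "x \<in> ball x0 r"
  then have "(norm (x - x0))\<^sup>2 < r\<^sup>2"
    by (intro power_strict_mono) (auto simp: dist_norm norm_minus_commute)
  then show ?thesis unfolding bump_eq by (intro zero_less_power) simp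
qed

lemma bump_eq_0: "0 < r \<Longrightarrow> x \<notin> cball x0 r \<Longrightarrow> bump k x0 r x = 0"
proof -
  assume "0 < r" "x \<notin> cball x0 r"
  then have "r\<^sup>2 \<le> (norm (x - x0))\<^sup>2"
    by (intro power_mono) (auto simp: dist_norm norm_minus_commute)
  then show ?thesis by (simp add: bump_eq max_def)
qed

lemma Ck_bump:
  assumes "open S"
  shows "Ck k S (bump k x0 r)"
  unfolding bump_def
  by (intro Ck_max_0_power Ck_diff Ck_sum Ck_power Ck_coord Ck_const assms)

text \<open>
  Where \<open>D\<close> does not vanish it has constant sign on a ball, and a bump supported in that ball has a nonzero
  integral against \<open>D\<close>.
\<close>

lemma eq_0_if_integral_against_bumps_eq_0:
  fixes D :: "real^'n \<Rightarrow> real"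
  assumes S: "open S" and D: "continuous_on S D" and x0: "x0 \<in> S"
    and test: "\<And>t K. Ck k UNIV t \<Longrightarrow> compact K \<Longrightarrow> K \<subseteq> S \<Longrightarrow> (\<And>x. x \<notin> K \<Longrightarrow> t x = 0) \<Longrightarrow>
      integral S (\<lambda>x. t x * D x) = 0"
  shows "D x0 = 0"
proof (rule ccontr)
  assume nz: "D x0 \<noteq> 0"
  define s where "s = sgn (D x0)"
  have "continuous_on S (\<lambda>x. s * D x)" using D by (intro continuous_intros)
  then have o: "open {x \<in> S. 0 < s * D x}"
    using continuous_open_preimage[OF _ S, of "\<lambda>x. s * D x" "{0<..}"] by (simp add: vimage_def Int_def)
  moreover have "x0 \<in> {x \<in> S. 0 < s * D x}"
    using x0 nz by (auto simp: s_def sgn_if)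
  ultimately obtain r where r: "0 < r" "cball x0 r \<subseteq> {x \<in> S. 0 < s * D x}"
    by (meson open_contains_cball)
  let ?t = "bump k x0 r"
  define F where "F x = (if x \<in> S then ?t x * (s * D x) else 0)" for x
  have t0: "?t x = 0" if "x \<notin> cball x0 r" for x using bump_eq_0[OF r(1) that] .
  have "integral S (\<lambda>x. ?t x * D x) = 0"
    by (rule test[OF Ck_bump[OF open_UNIV] compact_cball, of x0 r]) (use r t0 in auto)
  then have "integral S (\<lambda>x. s * (?t x * D x)) = 0" by simp
  then have F0: "integral UNIV F = 0"
    unfolding F_def[abs_def] integral_restrict_UNIV by (simp add: mult_ac)
  have "Cc_on S (\<lambda>x. ?t x * (s * D x))"
  proof (rule Cc_onI[OF _ compact_cball[of x0 r]])
    show "continuous_on S (\<lambda>x. ?t x * (s * D x))"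
      using D Ck_continuous[OF Ck_bump[OF S]] by (intro continuous_intros)
  qed (use r t0 in auto)
  then have contF: "continuous_on UNIV F"
    unfolding F_def[abs_def] by (rule continuous_on_zero_extension[OF S])
  have Fnn: "0 \<le> F x" for x
  proof (cases "x \<in> cball x0 r")
    case True
    then have "0 < s * D x" using r(2) by auto
    then show ?thesis using mult_nonneg_nonneg[OF bump_nonneg[of k x0 r x], of "s * D x"] by (simp add: F_def)
  qed (simp add: F_def t0)
  define a b :: "real^'n" where "a = (\<chi> i. x0 $ i - r)" and "b = (\<chi> i. x0 $ i + r)"
  have box: "x \<in> cbox a b" if "x \<in> cball x0 r" for x
  proof -
    have "\<bar>(x - x0) $ i\<bar> \<le> r" for i
      using component_le_norm_cart[of "x - x0" i] that by (simp add: dist_norm norm_minus_commute)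
    then show ?thesis by (simp add: mem_box_cart a_def b_def abs_le_iff algebra_simps)
  qed
  have "integral (cbox a b) F = integral UNIV F"
  proof (rule integral_eq_integral_UNIV)
    fix x assume "x \<notin> cbox a b"
    then show "F x = 0" using box t0[of x] by (auto simp: F_def)
  qed
  moreover have cF: "continuous_on (cbox a b) F" using contF continuous_on_subset by blast
  ultimately have "(F has_integral 0) (cbox a b)"
    using F0 integrable_integral[OF integrable_continuous[OF cF]] by simp
  then have "F x0 = 0"
    by (rule has_integral_0_cbox_imp_0[OF cF Fnn])
      (use r(1) box[of x0] in \<open>auto simp: interval_ne_empty_cart a_def b_def\<close>)
  moreover have "0 < F x0"
    using r bump_pos[of x0 x0 r k] x0 by (auto simp: F_def subset_iff)
  ultimately show False by simp
qed

context full_manifold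
begin

text \<open>
  A bump in a chart, extended by zero, is of class \<open>C\<^sup>k\<close> on the whole manifold by
  \<open>Ck_fun_vanishing\<close>.
\<close>

lemma bump_function:
  assumes c: "c \<in> atlas M" and N: "openin (mtop M) N" "p \<in> N" "N \<subseteq> chart_dom c"
  obtains \<beta> K N' where "Ck_fun M k (topspace (mtop M)) \<beta>" "\<And>q. 0 \<le> \<beta> q" "compactin (mtop M) K" "K \<subseteq> N"
    "\<And>q. q \<notin> K \<Longrightarrow> \<beta> q = 0" "openin (mtop M) N'" "p \<in> N'" "\<And>q. q \<in> N' \<Longrightarrow> 0 < \<beta> q"
proof -
  have "open (chart_map c ` N)" using open_image[OF c N(1)] N(3) by (simp add: Int_absorb1)
  then obtain r where r: "0 < r" "cball (chart_map c p) r \<subseteq> chart_map c ` N"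
    using N(2) by (meson imageI open_contains_cball)
  have img: "chart_map c ` N \<subseteq> chart_img c" using N(3) by (auto simp: chart_img_def)
  let ?C = "cball (chart_map c p) r"
  define \<beta> where "\<beta> q = (if q \<in> chart_dom c then bump k (chart_map c p) r (chart_map c q) else 0)" for q
  define K where "K = chart_inv c ` ?C"
  have K: "compactin (mtop M) K" unfolding K_def using r(2) img by (intro compactin_inv_image[OF c]) auto
  have KN: "K \<subseteq> N" unfolding K_def using r(2) N(3) c by fastforce
  have z: "\<beta> q = 0" if "q \<notin> K" for q
  proof (cases "q \<in> chart_dom c")
    case True
    then have "chart_map c q \<notin> ?C" using that c unfolding K_def by (metis image_eqI inv_chart)
    then show ?thesis by (simp add: \<beta>_def bump_eq_0[OF r(1)])
  qed (simp add: \<beta>_def)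
  have oc: "openin (mtop M) (chart_dom c)" using c by (rule openin_dom)
  have oi: "open (chart_map c ` chart_dom c)" using open_img[OF c] by (simp add: chart_img_def)
  have "Ck k (chart_map c ` chart_dom c) (\<lambda>x. \<beta> (chart_inv c x))"
    by (subst Ck_cong[OF oi, of _ "bump k (chart_map c p) r"]) (auto simp: \<beta>_def c Ck_bump[OF oi])
  then have "Ck_fun M k (chart_dom c) \<beta>" by (rule Ck_fun_chartI[OF c oc order_refl])
  then have "Ck_fun M k (topspace (mtop M)) \<beta>"
    by (rule Ck_fun_vanishing[OF K oc]) (use KN N(3) z in auto)
  moreover have "0 \<le> \<beta> q" for q by (simp add: \<beta>_def bump_nonneg)
  moreover have "openin (mtop M) {q \<in> chart_dom c. chart_map c q \<in> ball (chart_map c p) r}"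
    using c by (rule openin_chart_preimage) simp
  moreover have "p \<in> {q \<in> chart_dom c. chart_map c q \<in> ball (chart_map c p) r}" using N r(1) by auto
  moreover have "0 < \<beta> q" if "q \<in> {q \<in> chart_dom c. chart_map c q \<in> ball (chart_map c p) r}" for q
    using that bump_pos[of "chart_map c q" "chart_map c p" r k] by (simp add: \<beta>_def)
  ultimately show ?thesis using K KN z that by blast
qed

lemma density_factor_same:
  assumes c: "c \<in> atlas M" and p: "p \<in> chart_dom c"
  shows "density_factor M c c p = 1"
proof -
  have "jacobian c c id p i j = (if i = j then 1 else 0)" for i j
  proof -
    have "jacobian c c id p i j = partial_deriv j (\<lambda>x. x $ i) (chart_map c p)"
      unfolding jacobian_def by (rule partial_deriv_cong[OF open_img[OF c]]) (use p in auto)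
    also have "\<dots> = (if i = j then 1 else 0)"
      by (intro partial_derivI) (auto simp: axis_def intro!: derivative_eq_intros)
    finally show ?thesis .
  qed
  then have "(\<chi> i j. jacobian c c id p i j) = mat 1" by (simp add: vec_eq_iff mat_def)
  then show ?thesis by (simp only: density_factor_def coords UNIV_not_empty if_False det_I abs_one)
qed

lemma partition_of_unity_subset:
  assumes "partition_of_unity M k U B ch \<rho>" "V \<subseteq> U" "l \<le> k"
  shows "partition_of_unity M l V B ch \<rho>"
proof -
  have "Ck_fun M l V u" if "Ck_fun M k U u" for u
    using that assms(2,3) Ck_fun_subset Ck_fun_le by blast
  then show ?thesis using assms(1,2) by (auto simp: partition_of_unity_def)
qed

end

section \<open>Integration along the fibres of a proper submersion\<close>

locale proper_submersion = full_smooth_map P M f + P: full_density P \<mu>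
  for P :: "('a, 'm::{finite,wellorder}) manifold" and M :: "('b, 'n::{finite,wellorder}) manifold" and f \<mu> +
  assumes density_pos: "\<And>c p. c \<in> atlas P \<Longrightarrow> p \<in> chart_dom c \<Longrightarrow> 0 < \<mu> c p"
    and submersion: "submersion P M f"
    and surjective: "f ` topspace (mtop P) = topspace (mtop M)"
    and proper: "proper_map (mtop P) (mtop M) f"
begin

definition preim :: "'b set \<Rightarrow> 'a set" where
  "preim V = {p \<in> topspace (mtop P). f p \<in> V}"

text \<open>
  Test functions on \<open>M\<close> are given in a chart over \<open>V\<close> and are supported there, so the pull-back along
  \<open>f\<close> is extended by zero off the preimage of \<open>V\<close>.
\<close>

definition pull :: "('b, 'n) chart \<Rightarrow> 'b set \<Rightarrow> (real^'n::_ \<Rightarrow> real) \<Rightarrow> 'a \<Rightarrow> real" where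
  "pull d V h p = (if f p \<in> V then h (chart_map d (f p)) else 0)"

lemma openin_preim: "openin (mtop M) V \<Longrightarrow> openin (mtop P) (preim V)"
  unfolding preim_def by (rule openin_preimage)

text \<open>
  The support is compact because \<open>f\<close> is proper.
\<close>

lemma pull_supp_in:
  assumes d: "d \<in> atlas M" and V: "openin (mtop M) V" "V \<subseteq> chart_dom d"
    and h: "Ck k (chart_map d ` V) h" and K: "compact K" "K \<subseteq> chart_map d ` V" "\<And>y. y \<in> chart_map d ` V \<Longrightarrow> y \<notin> K \<Longrightarrow> h y = 0"
  shows "supp_in P k (preim V) (pull d V h)"
proof -
  have oV: "open (chart_map d ` V)" and img: "chart_map d ` V \<subseteq> chart_img d"
    using M.open_image[OF d V(1)] V(2) by (auto simp: Int_absorb1 chart_img_def)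
  have "Ck k (chart_map d ` V) (\<lambda>y. h (chart_map d (chart_inv d y)))"
    by (subst Ck_cong[OF oV, of _ h]) (use h img in auto)
  then have "Ck_fun M k V (\<lambda>q. h (chart_map d q))" by (rule M.Ck_fun_chartI[OF d V])
  then have "Ck_fun P k (preim V) (\<lambda>p. h (chart_map d (f p)))"
    unfolding preim_def by (rule Ck_fun_comp[OF V(1)])
  then have C: "Ck_fun P k (preim V) (pull d V h)"
    by (subst P.Ck_fun_cong[OF openin_preim[OF V(1)]]) (auto simp: pull_def preim_def)
  let ?K = "chart_inv d ` K"
  have "compactin (mtop M) ?K" using K img by (intro M.compactin_inv_image[OF d]) auto
  then have "compactin (mtop P) (preim ?K)"
    unfolding preim_def by (rule compactin_proper_map_preimage[OF proper])
  moreover have "preim ?K \<subseteq> preim V"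
    using K(2) V(2) d by (fastforce simp: preim_def)
  moreover have "pull d V h p = 0" if p: "p \<in> topspace (mtop P) - preim ?K" for p
  proof (cases "f p \<in> V")
    case True
    then have "chart_map d (f p) \<notin> K"
      using p d V(2) by (auto simp: preim_def) (metis M.inv_chart image_eqI subsetD)
    then show ?thesis using True K(3) by (simp add: pull_def)
  qed (simp add: pull_def)
  ultimately show ?thesis using C by (auto simp: supp_in_def)
qed

text \<open>
  If \<open>\<rho>\<close> is a partition of unity over the preimage of \<open>V\<close>, this says that \<open>g\<close> is the component of the
  push-forward of \<open>\<mu>\<close> in the chart \<open>d\<close>.
\<close>

definition is_fibre_integral ::
    "('b, 'n) chart \<Rightarrow> 'b set \<Rightarrow> 'a set \<Rightarrow> ('a \<Rightarrow> ('a, 'm) chart) \<Rightarrow> ('a \<Rightarrow> 'a \<Rightarrow> real) \<Rightarrow> (real^'n::_ \<Rightarrow> real) \<Rightarrow> bool" where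
  "is_fibre_integral d V B ch \<rho> g \<longleftrightarrow>
     (\<forall>h. Cc_on (chart_map d ` V) h \<longrightarrow>
       integral (chart_map d ` V) (\<lambda>y. h y * g y) = (\<Sum>b\<in>B. chart_integral \<mu> (ch b) (\<lambda>p. \<rho> b p * pull d V h p)))"

text \<open>
  The choice of a partition of unity is forgotten; by \<open>fibre_density_transform\<close> the function \<open>g\<close> does not
  depend on it.
\<close>

definition fibre_density :: "('b, 'n) chart \<Rightarrow> 'b set \<Rightarrow> (real^'n::_ \<Rightarrow> real) \<Rightarrow> bool" where
  "fibre_density d V g \<longleftrightarrow> openin (mtop M) V \<and> V \<subseteq> chart_dom d \<and> continuous_on (chart_map d ` V) g \<and>
     (\<exists>B ch \<rho>. partition_of_unity P 0 (preim V) B ch \<rho> \<and> is_fibre_integral d V B ch \<rho> g)"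

text \<open>
  The property \<open>pushes_forward\<close>, transferred to the neighbourhood \<open>N\<close> of a point in a chart \<open>c\<close> of \<open>P\<close>.
\<close>

definition pushes_chart_forward :: "('a, 'm) chart \<Rightarrow> ('b, 'n) chart \<Rightarrow> 'a set \<Rightarrow> bool" where
  "pushes_chart_forward c d N \<longleftrightarrow>
     (\<forall>k V \<rho> K. openin (mtop M) V \<longrightarrow> V \<subseteq> chart_dom d \<longrightarrow> Ck_fun P k (preim V) \<rho> \<longrightarrow>
      compactin (mtop P) K \<longrightarrow> K \<subseteq> N \<longrightarrow> (\<forall>p. p \<notin> K \<longrightarrow> \<rho> p = 0) \<longrightarrow> (\<forall>p. 0 \<le> \<rho> p) \<longrightarrow>
      (\<exists>g. Ck k (chart_map d ` V) g \<and>
        (\<forall>h. Cc_on (chart_map d ` V) h \<longrightarrow>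
          integral (chart_map d ` V) (\<lambda>y. h y * g y) = chart_integral \<mu> c (\<lambda>p. \<rho> p * pull d V h p)) \<and>
        (\<forall>y\<in>chart_map d ` V. 0 \<le> g y) \<and> (\<forall>p\<in>N. f p \<in> V \<longrightarrow> 0 < \<rho> p \<longrightarrow> 0 < g (chart_map d (f p)))))"

lemma local_pushforward:
  assumes c: "c \<in> atlas P" and d: "d \<in> atlas M" and p: "p \<in> chart_dom c" "f p \<in> chart_dom d"
  obtains N where "openin (mtop P) N" "p \<in> N" "N \<subseteq> chart_dom c"
    "pushes_chart_forward c d N"
proof -
  let ?W = "chart_map c ` {p \<in> chart_dom c. f p \<in> chart_dom d}"
  define F where "F x = chart_map d (f (chart_inv c x))" for x
  have W: "open ?W" "chart_map c p \<in> ?W"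
    using open_local_dom[OF c M.openin_dom[OF d]] p by auto
  have ckF: "Ck k ?W (\<lambda>x. F x $ i)" for k i
    unfolding F_def by (rule local_rep_Ck[OF c d])
  have surj: "\<exists>v. \<forall>i. (\<Sum>j\<in>UNIV. jac F (chart_map c p) $ i $ j * v $ j) = w $ i" for w :: "real^'n::_"
  proof -
    have "\<forall>w\<in>model_space (coords M). \<exists>v\<in>model_space (coords P).
           \<forall>i\<in>coords M. (\<Sum>j\<in>coords P. jacobian c d f p i j * v $ j) = w $ i"
      using submersion c d p by (auto simp: submersion_def)
    moreover have "w \<in> model_space (coords M)" by (simp add: model_space_def)
    ultimately show ?thesis by (auto simp: jac_def F_def jacobian_def)
  qed
  obtain W' where W': "open W'" "chart_map c p \<in> W'" "W' \<subseteq> ?W" and push: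
    "pushes_forward F W'"
    by (rule submersion_pushforward[OF W ckF surj]) (rule that)
  define N where "N = {p \<in> chart_dom c. chart_map c p \<in> W'}"
  have N: "openin (mtop P) N" "p \<in> N" "N \<subseteq> chart_dom c"
    using P.openin_chart_preimage[OF c W'(1)] W'(2) p by (auto simp: N_def)
  have W'img: "x \<in> chart_img c" "chart_inv c x \<in> N" "f (chart_inv c x) \<in> chart_dom d" if "x \<in> W'" for x
    using that W'(3) c by (auto simp: N_def)
  show ?thesis
  proof (rule that[OF N], unfold pushes_chart_forward_def, intro allI impI)
    fix k V \<rho> K
    assume V: "openin (mtop M) V" "V \<subseteq> chart_dom d" and \<rho>: "Ck_fun P k (preim V) \<rho>"
      and K: "compactin (mtop P) K" "K \<subseteq> N" and z': "\<forall>p. p \<notin> K \<longrightarrow> \<rho> p = 0" and nn': "\<forall>p. 0 \<le> \<rho> p"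
    have z: "\<And>p. p \<notin> K \<Longrightarrow> \<rho> p = 0" and nn: "\<And>p. 0 \<le> \<rho> p" using z' nn' by blast+
    let ?V = "chart_map d ` V"
    let ?S = "{x\<in>W'. F x \<in> ?V}"
    have oV: "open ?V" using M.open_image[OF d V(1)] V(2) by (simp add: Int_absorb1)
    have FV: "F x \<in> ?V \<longleftrightarrow> f (chart_inv c x) \<in> V" if "x \<in> W'" for x
      using W'img(3)[OF that] d V(2) M.inj_chart[OF d] by (auto simp: F_def inj_on_def)
    have Sx: "?S = chart_map c ` {p \<in> N. f p \<in> V}"
    proof
      show "?S \<subseteq> chart_map c ` {p \<in> N. f p \<in> V}"
      proof
        fix x assume x: "x \<in> ?S"
        then have "x = chart_map c (chart_inv c x)" "chart_inv c x \<in> {p \<in> N. f p \<in> V}"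
          using W'img[of x] FV[of x] by auto
        then show "x \<in> chart_map c ` {p \<in> N. f p \<in> V}" by blast
      qed
      show "chart_map c ` {p \<in> N. f p \<in> V} \<subseteq> ?S"
        using c FV by (auto simp: N_def)
    qed
    have "{p \<in> N. f p \<in> V} = chart_dom c \<inter> (N \<inter> preim V)"
      using N(3) P.dom_subset[OF c] by (auto simp: preim_def)
    then have oS: "open ?S"
      unfolding Sx using P.open_image[OF c openin_Int[OF N(1) openin_preim[OF V(1)]]] by simp
    define w where "w x = \<rho> (chart_inv c x) * \<mu> c (chart_inv c x)" for x
    have Ssub: "?S \<subseteq> chart_map c ` (chart_dom c \<inter> preim V)" "?S \<subseteq> chart_img c"
      using N(3) P.dom_subset[OF c] W'img(1) unfolding Sx preim_def by (auto simp: chart_img_def)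
    have Ckw: "Ck k ?S w"
      unfolding w_def
      by (intro Ck_mult[OF oS] Ck_subset[OF P.Ck_fun_chart_img[OF \<rho> c] Ssub(1)] Ck_subset[OF P.density_Ck[OF c] Ssub(2)])
    have KW: "chart_map c ` K \<subseteq> W'" using K(2) by (auto simp: N_def)
    have w0: "w x = 0" if "x \<in> W'" "x \<notin> chart_map c ` K" for x
    proof -
      have "chart_inv c x \<notin> K" using that W'img(1) by (metis P.map_inv image_eqI)
      then show ?thesis by (simp add: w_def z)
    qed
    obtain g where g: "Ck k ?V g" "\<forall>h. Cc_on ?V h \<longrightarrow> integral ?V (\<lambda>y. h y * g y) = integral ?S (\<lambda>x. h (F x) * w x)"
      "\<forall>y\<in>?V. 0 \<le> g y" "\<forall>x\<in>W'. F x \<in> ?V \<longrightarrow> 0 < w x \<longrightarrow> 0 < g (F x)"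
    proof -
      have "\<exists>g. Ck k ?V g \<and> (\<forall>h. Cc_on ?V h \<longrightarrow> integral ?V (\<lambda>y. h y * g y) = integral ?S (\<lambda>x. h (F x) * w x)) \<and>
        (\<forall>y\<in>?V. 0 \<le> g y) \<and> (\<forall>x\<in>W'. F x \<in> ?V \<longrightarrow> 0 < w x \<longrightarrow> 0 < g (F x))"
      proof (rule push[unfolded pushes_forward_def, rule_format, OF oV Ckw P.compact_image[OF c K(1)] KW])
        show "K \<subseteq> chart_dom c" using K(2) N(3) by blast
        show "0 \<le> w x" if "x \<in> W'" for x
          unfolding w_def using nn density_pos[OF c, of "chart_inv c x"] W'img[OF that] N(3) by (simp add: less_imp_le subset_iff)
      qed (use w0 in auto)
      then show ?thesis using that by blast
    qed
    have "integral ?S (\<lambda>x. h (F x) * w x) = chart_integral \<mu> c (\<lambda>p. \<rho> p * pull d V h p)" for h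
    proof -
      have "chart_integral \<mu> c (\<lambda>p. \<rho> p * pull d V h p) =
        integral ?S (\<lambda>x. \<rho> (chart_inv c x) * pull d V h (chart_inv c x) * \<mu> c (chart_inv c x))"
        unfolding Sx
      proof (rule P.chart_integral_restrict[OF c])
        show "{p \<in> N. f p \<in> V} \<subseteq> chart_dom c" using N(3) by auto
        fix p assume "p \<in> chart_dom c" "p \<notin> {p \<in> N. f p \<in> V}"
        then have "p \<notin> K \<or> f p \<notin> V" using K(2) by auto
        then show "\<rho> p * pull d V h p = 0" using z by (auto simp: pull_def)
      qed
      also have "\<dots> = integral ?S (\<lambda>x. h (F x) * w x)"
        using FV by (intro integral_cong) (auto simp: pull_def w_def F_def mult_ac)
      finally show ?thesis by simp
    qed
    moreover have "0 < g (chart_map d (f p))" if p: "p \<in> N" "f p \<in> V" "0 < \<rho> p" for p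
    proof -
      have pc: "p \<in> chart_dom c" "chart_map c p \<in> W'" using p(1) by (auto simp: N_def)
      have "F (chart_map c p) = chart_map d (f p)" using pc c by (simp add: F_def)
      moreover have "0 < w (chart_map c p)" using pc c p(3) density_pos[OF c pc(1)] by (simp add: w_def)
      ultimately show ?thesis using g(4) pc(2) p(2) by (metis imageI)
    qed
    ultimately show "\<exists>g. Ck k ?V g \<and>
        (\<forall>h. Cc_on ?V h \<longrightarrow>
          integral ?V (\<lambda>y. h y * g y) = chart_integral \<mu> c (\<lambda>p. \<rho> p * pull d V h p)) \<and>
        (\<forall>y\<in>?V. 0 \<le> g y) \<and> (\<forall>p\<in>N. f p \<in> V \<longrightarrow> 0 < \<rho> p \<longrightarrow> 0 < g (chart_map d (f p)))"
      using g(1-3) by (intro exI[of _ g]) auto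
  qed
qed

text \<open>
  Finitely many neighbourhoods, on each of which \<open>\<mu>\<close> can be pushed forward, cover the compact fibre over
  \<open>q\<close>. Since \<open>f\<close> is closed, they contain the preimage of a neighbourhood \<open>V\<close> of \<open>q\<close>. Over \<open>V\<close>, bump functions
  divided by their sum form a partition of unity, and the push-forwards of its members add up to \<open>g\<close>. Positivity
  holds because every fibre over \<open>V\<close> contains a point, at which some bump is positive.
\<close>

lemma fibre_integration:
  assumes d: "d \<in> atlas M" and q: "q \<in> chart_dom d"
  obtains V g B ch \<rho> where "openin (mtop M) V" "q \<in> V" "V \<subseteq> chart_dom d"
    "partition_of_unity P k (preim V) B ch \<rho>" "Ck k (chart_map d ` V) g" "\<And>y. y \<in> chart_map d ` V \<Longrightarrow> 0 < g y"
    "is_fibre_integral d V B ch \<rho> g"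
proof -
  have qM: "q \<in> topspace (mtop M)" using M.dom_subset[OF d] q by auto
  define Fq where "Fq = {p \<in> topspace (mtop P). f p = q}"
  have cFq: "compactin (mtop P) Fq"
    using proper qM by (simp add: proper_map_def Fq_def)
  \<comment> \<open>The data attached to a point \<open>p\<close> of the fibre: a chart \<open>c\<close>, a set \<open>N\<close> over which densities can be
      pushed forward, a bump \<open>\<beta>\<close> supported in \<open>K\<close>, and a neighbourhood \<open>N'\<close> of \<open>p\<close> where \<open>\<beta>\<close> is positive.\<close>
  define Q where "Q p c N \<beta> K N' \<longleftrightarrow> c \<in> atlas P \<and> N \<subseteq> chart_dom c \<and> pushes_chart_forward c d N \<and>
      Ck_fun P k (topspace (mtop P)) \<beta> \<and> (\<forall>q. 0 \<le> \<beta> q) \<and> compactin (mtop P) K \<and> K \<subseteq> N \<and>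
      (\<forall>q. q \<notin> K \<longrightarrow> \<beta> q = 0) \<and> openin (mtop P) N' \<and> p \<in> N' \<and> (\<forall>q\<in>N'. 0 < \<beta> q)" for p c N \<beta> K N'
  have "\<exists>c N \<beta> K N'. Q p c N \<beta> K N'" if p: "p \<in> Fq" for p
  proof -
    obtain c where c: "c \<in> atlas P" "p \<in> chart_dom c" using P.charts_cover[of p] p by (auto simp: Fq_def)
    have fp: "f p \<in> chart_dom d" using p q by (simp add: Fq_def)
    obtain N where N: "openin (mtop P) N" "p \<in> N" "N \<subseteq> chart_dom c" and push:
      "pushes_chart_forward c d N"
      by (rule local_pushforward[OF c(1) d c(2) fp]) (rule that)
    show ?thesis
    proof (rule P.bump_function[OF c(1) N, of k])
      fix \<beta> K N'
      assume b: "Ck_fun P k (topspace (mtop P)) \<beta>" "\<And>q. 0 \<le> \<beta> q" "compactin (mtop P) K" "K \<subseteq> N"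
        "\<And>q. q \<notin> K \<Longrightarrow> \<beta> q = 0" "openin (mtop P) N'" "p \<in> N'" "\<And>q. q \<in> N' \<Longrightarrow> 0 < \<beta> q"
      have "Q p c N \<beta> K N'"
        unfolding Q_def using b c(1) N(3) push by blast
      then show ?thesis by blast
    qed
  qed
  then obtain ch N \<beta> K N' where Q: "\<And>p. p \<in> Fq \<Longrightarrow> Q p (ch p) (N p) (\<beta> p) (K p) (N' p)"
    by metis
  have N': "openin (mtop P) (N' p)" "p \<in> N' p" if "p \<in> Fq" for p
    using Q[OF that] unfolding Q_def by blast+
  have "\<exists>\<F>. finite \<F> \<and> \<F> \<subseteq> N' ` Fq \<and> Fq \<subseteq> \<Union>\<F>"
    by (rule compactinD[OF cFq]) (use N' in auto)
  then obtain \<F> where "finite \<F>" "\<F> \<subseteq> N' ` Fq" "Fq \<subseteq> \<Union>\<F>" by blast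
  then obtain A where A: "finite A" "A \<subseteq> Fq" "Fq \<subseteq> \<Union>(N' ` A)"
    by (metis finite_subset_image)
  have QA: "ch a \<in> atlas P" "N a \<subseteq> chart_dom (ch a)" "Ck_fun P k (topspace (mtop P)) (\<beta> a)" "\<And>p. 0 \<le> \<beta> a p"
    "compactin (mtop P) (K a)" "K a \<subseteq> N a" "\<And>p. p \<notin> K a \<Longrightarrow> \<beta> a p = 0" "\<And>p. p \<in> N' a \<Longrightarrow> 0 < \<beta> a p" if "a \<in> A" for a
    using Q[of a] that A(2) unfolding Q_def by blast+
  have Qp: "pushes_chart_forward (ch a) d (N a)" if "a \<in> A" for a
    using Q[of a] that A(2) unfolding Q_def by blast
  have "openin (mtop P) (\<Union>(N' ` A))" using A(2) N' by (intro openin_Union) auto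
  moreover have "Fq \<subseteq> \<Union>(N' ` A)" by (rule A(3))
  ultimately obtain V0 where V0: "openin (mtop M) V0" "q \<in> V0" "{p \<in> topspace (mtop P). f p \<in> V0} \<subseteq> \<Union>(N' ` A)"
    using proper_imp_closed_map[OF proper, unfolded closed_map_fibre_neighbourhood, THEN conjunct2, rule_format,
        of "\<Union>(N' ` A)" q] qM unfolding Fq_def by blast
  define V where "V = V0 \<inter> chart_dom d"
  have V: "openin (mtop M) V" "q \<in> V" "V \<subseteq> chart_dom d"
    using V0 q M.openin_dom[OF d] by (auto simp: V_def)
  have oV: "open (chart_map d ` V)" using M.open_image[OF d V(1)] V(3) by (simp add: Int_absorb1)
  have oP: "openin (mtop P) (preim V)" by (rule openin_preim[OF V(1)])
  define s where "s p = (\<Sum>a\<in>A. \<beta> a p)" for p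
  have s: "0 < s p" if p: "p \<in> preim V" for p
  proof -
    obtain a where a: "a \<in> A" "p \<in> N' a" using p V0(3) by (auto simp: preim_def V_def)
    have "\<beta> a p \<le> s p" unfolding s_def using QA(4) a A(1) by (intro member_le_sum) auto
    then show ?thesis using QA(8)[OF a] by linarith
  qed
  have s0: "0 \<le> s p" for p unfolding s_def using QA(4) by (intro sum_nonneg) auto
  define \<rho> where "\<rho> a p = \<beta> a p / s p" for a p
  have Ck\<beta>: "Ck_fun P k (preim V) (\<beta> a)" if "a \<in> A" for a
    using P.Ck_fun_subset[OF QA(3)[OF that]] by (auto simp: preim_def)
  have Ck\<rho>: "Ck_fun P k (preim V) (\<rho> a)" if "a \<in> A" for a
    unfolding \<rho>_def
  proof (rule P.Ck_fun_divide[OF oP Ck\<beta>[OF that]])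
    show "Ck_fun P k (preim V) s" unfolding s_def using Ck\<beta> by (intro P.Ck_fun_sum oP)
  qed (use s in fastforce)
  have part: "partition_of_unity P k (preim V) A ch \<rho>"
    unfolding partition_of_unity_def
  proof (intro conjI ballI)
    show "(\<Sum>a\<in>A. \<rho> a p) = 1" if "p \<in> preim V" for p
      using s[OF that] by (simp add: \<rho>_def sum_divide_distrib[symmetric] s_def)
    fix a assume a: "a \<in> A"
    show "\<exists>K. compactin (mtop P) K \<and> K \<subseteq> chart_dom (ch a) \<and> (\<forall>p\<in>topspace (mtop P) - K. \<rho> a p = 0)"
      using QA(2,5-7)[OF a] by (intro exI[of _ "K a"]) (auto simp: \<rho>_def)
  qed (use A(1) QA(1) Ck\<rho> in auto)
  define G where "G a g \<longleftrightarrow> Ck k (chart_map d ` V) g \<and>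
      (\<forall>h. Cc_on (chart_map d ` V) h \<longrightarrow>
        integral (chart_map d ` V) (\<lambda>y. h y * g y) = chart_integral \<mu> (ch a) (\<lambda>p. \<rho> a p * pull d V h p)) \<and>
      (\<forall>y\<in>chart_map d ` V. 0 \<le> g y) \<and> (\<forall>p\<in>N a. f p \<in> V \<longrightarrow> 0 < \<rho> a p \<longrightarrow> 0 < g (chart_map d (f p)))" for a g
  have "\<exists>g. G a g" if a: "a \<in> A" for a
  proof -
    have "\<forall>p. p \<notin> K a \<longrightarrow> \<rho> a p = 0" "\<forall>p. 0 \<le> \<rho> a p"
      using QA(4,7)[OF a] s0 by (auto simp: \<rho>_def)
    then show ?thesis
      using Qp[OF a, unfolded pushes_chart_forward_def, rule_format, OF V(1,3) Ck\<rho>[OF a] QA(5,6)[OF a]] unfolding G_def by blast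
  qed
  then obtain g where G: "\<And>a. a \<in> A \<Longrightarrow> G a (g a)" by metis
  have g: "\<And>a. a \<in> A \<Longrightarrow> Ck k (chart_map d ` V) (g a)"
    "\<And>a h. a \<in> A \<Longrightarrow> Cc_on (chart_map d ` V) h \<Longrightarrow>
      integral (chart_map d ` V) (\<lambda>y. h y * g a y) = chart_integral \<mu> (ch a) (\<lambda>p. \<rho> a p * pull d V h p)"
    "\<And>a y. a \<in> A \<Longrightarrow> y \<in> chart_map d ` V \<Longrightarrow> 0 \<le> g a y"
    "\<And>a p. a \<in> A \<Longrightarrow> p \<in> N a \<Longrightarrow> f p \<in> V \<Longrightarrow> 0 < \<rho> a p \<Longrightarrow> 0 < g a (chart_map d (f p))"
    using G unfolding G_def by blast+
  show ?thesis
  proof (rule that[OF V part])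
    show "Ck k (chart_map d ` V) (\<lambda>y. \<Sum>a\<in>A. g a y)" using g(1) by (intro Ck_sum oV)
    fix y assume y: "y \<in> chart_map d ` V"
    then obtain q' where q': "q' \<in> V" "y = chart_map d q'" by auto
    then have "q' \<in> f ` topspace (mtop P)" using surjective M.dom_subset[OF d] V(3) by blast
    then obtain p where p: "p \<in> topspace (mtop P)" "f p = q'" by auto
    then have "p \<in> preim V" using q' by (simp add: preim_def)
    then obtain a where a: "a \<in> A" "p \<in> N' a" using V0(3) by (auto simp: preim_def V_def)
    have "0 < \<rho> a p" using QA(8)[OF a] s[OF \<open>p \<in> preim V\<close>] by (simp add: \<rho>_def)
    moreover have "p \<in> N a" using QA(6,7)[OF a(1)] QA(8)[OF a] by force
    ultimately have "0 < g a y" using g(4)[OF a(1), of p] p(2) q' by simp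
    moreover have "g a y \<le> (\<Sum>a\<in>A. g a y)" using g(3) y a(1) A(1) by (intro member_le_sum) auto
    ultimately show "0 < (\<Sum>a\<in>A. g a y)" by linarith
  next
    show "is_fibre_integral d V A ch \<rho> (\<lambda>y. \<Sum>a\<in>A. g a y)"
      unfolding is_fibre_integral_def
    proof (intro allI impI)
      fix h assume h: "Cc_on (chart_map d ` V) h"
      have "Cc_on (chart_map d ` V) (\<lambda>y. h y * g a y)" if "a \<in> A" for a
        using Cc_on_mult[OF Ck_continuous[OF g(1)[OF that]] h] by (simp add: mult.commute)
      from Cc_on_integrable[OF oV this]
      have "integral (chart_map d ` V) (\<lambda>y. \<Sum>a\<in>A. h y * g a y) = (\<Sum>a\<in>A. integral (chart_map d ` V) (\<lambda>y. h y * g a y))"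
        by (rule integral_sum[OF A(1)])
      then show "integral (chart_map d ` V) (\<lambda>y. h y * (\<Sum>a\<in>A. g a y)) = (\<Sum>a\<in>A. chart_integral \<mu> (ch a) (\<lambda>p. \<rho> a p * pull d V h p))"
        using g(2)[OF _ h] by (simp add: sum_distrib_left)
    qed
  qed
qed

end

context proper_submersion
begin

section \<open>The push-forward density\<close>

text \<open>
  Both functions have the same integrals against bumps supported in \<open>V \<inter> V'\<close>: on \<open>P\<close> these integrals are
  those of one function with respect to two partitions of unity. The case \<open>d = d'\<close> is uniqueness.
\<close>

lemma fibre_density_transform:
  assumes d: "d \<in> atlas M" and d': "d' \<in> atlas M"
    and g: "fibre_density d V g" and g': "fibre_density d' V' g'" and q: "q \<in> V" "q \<in> V'"
  shows "g (chart_map d q) = density_factor M d d' q * g' (chart_map d' q)"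
proof -
  obtain B ch \<rho> where V: "openin (mtop M) V" "V \<subseteq> chart_dom d" and gc: "continuous_on (chart_map d ` V) g"
    and part: "partition_of_unity P 0 (preim V) B ch \<rho>"
    and "is_fibre_integral d V B ch \<rho> g"
    using g unfolding fibre_density_def by blast
  note int = this(5)[unfolded is_fibre_integral_def, rule_format]
  obtain B' ch' \<rho>' where V': "openin (mtop M) V'" "V' \<subseteq> chart_dom d'" and g'c: "continuous_on (chart_map d' ` V') g'"
    and part': "partition_of_unity P 0 (preim V') B' ch' \<rho>'"
    and "is_fibre_integral d' V' B' ch' \<rho>' g'"
    using g' unfolding fibre_density_def by blast
  note int' = this(5)[unfolded is_fibre_integral_def, rule_format]
  define W where "W = V \<inter> V'"
  have W: "openin (mtop M) W" "W \<subseteq> chart_dom d" "W \<subseteq> chart_dom d'"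
    using V V' by (auto simp: W_def)
  define T where "T x = chart_map d' (chart_inv d x)" for x
  let ?S = "chart_map d ` W"
  have oS: "open ?S" and oS': "open (chart_map d' ` W)"
    using M.open_image[OF d W(1)] M.open_image[OF d' W(1)] W(2,3) by (simp_all add: Int_absorb1)
  have TS: "T ` ?S = chart_map d' ` W" using W(2) d by (force simp: T_def image_image subset_iff)
  have ckT: "Ck k ?S (\<lambda>x. T x $ i)" for k i
    unfolding T_def by (rule Ck_subset[OF M.transition_Ck[OF d d']]) (use W in auto)
  have contT: "continuous_on ?S T" using ckT[of 0] by (intro continuous_on_components) auto
  have injT: "inj_on T ?S"
    using d M.inj_chart[OF d'] W by (auto simp: inj_on_def T_def subset_iff)
  define J where "J x = \<bar>det (jac T x)\<bar>" for x
  have contJ: "continuous_on ?S J"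
    unfolding J_def
  proof (intro continuous_on_rabs Ck_continuous[of 0 UNIV] Ck_det oS)
    show "Ck 0 ?S (\<lambda>x. jac T x $ i $ j)" for i j
      using Ck_partial[OF ckT[of "Suc 0" i], of j] by (simp add: jac_def del: Ck_on.simps)
  qed
  have ckg': "continuous_on ?S (\<lambda>x. g' (T x))"
    by (rule continuous_on_compose2[OF g'c contT], unfold TS) (auto simp: W_def)
  define D where "D x = g x - J x * g' (T x)" for x
  have gS: "continuous_on ?S g" using gc by (rule continuous_on_subset) (auto simp: W_def)
  have contD: "continuous_on ?S D"
    unfolding D_def by (intro continuous_on_diff continuous_on_mult gS contJ ckg')
  have "D (chart_map d q) = 0"
  proof (rule eq_0_if_integral_against_bumps_eq_0[OF oS contD, of _ 0])
    show "chart_map d q \<in> ?S" using q by (auto simp: W_def)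
    fix t K assume t: "Ck 0 UNIV t" and K: "compact K" "K \<subseteq> ?S" and t0: "\<And>x. x \<notin> K \<Longrightarrow> t x = 0"
    have contt: "continuous_on A t" for A using t continuous_on_subset by auto
    \<comment> \<open>the test function \<open>t\<close> in the chart \<open>d'\<close>\<close>
    define h' where "h' y = (if y \<in> chart_map d' ` W then t (chart_map d (chart_inv d' y)) else 0)" for y
    have CcV: "Cc_on (chart_map d ` V) t"
      by (rule Cc_onI[OF contt K(1)]) (use K t0 in \<open>auto simp: W_def\<close>)
    have CcS: "Cc_on ?S t" by (rule Cc_onI[OF contt K]) (use t0 in auto)
    have h'T: "h' (T x) = t x" if x: "x \<in> ?S" for x
    proof -
      obtain q' where q': "q' \<in> W" "x = chart_map d q'" using x by blast
      then have "T x = chart_map d' q'" "chart_inv d' (T x) = q'"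
        using W d d' by (auto simp: T_def subset_iff)
      then show ?thesis using q' by (simp add: h'_def)
    qed
    have contR: "continuous_on (chart_map d' ` W) (\<lambda>y. chart_map d (chart_inv d' y))"
    proof (rule continuous_on_components)
      show "continuous_on (chart_map d' ` W) (\<lambda>y. chart_map d (chart_inv d' y) $ i)" for i
        by (rule Ck_continuous[OF Ck_subset[OF M.transition_Ck[OF d' d, of 0]]]) (use W in auto)
    qed
    have Cch': "Cc_on (chart_map d' ` W) h'"
    proof (rule Cc_onI[of _ _ "T ` K"])
      have "continuous_on (chart_map d' ` W) (\<lambda>y. t (chart_map d (chart_inv d' y)))"
        by (rule continuous_on_compose2[OF contt[of UNIV] contR]) auto
      then show "continuous_on (chart_map d' ` W) h'"
        by (rule continuous_on_eq) (simp add: h'_def)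
      show "compact (T ` K)" using K contT by (intro compact_continuous_image) (auto intro: continuous_on_subset)
      show "T ` K \<subseteq> chart_map d' ` W" using K(2) TS by blast
      fix y assume "y \<in> chart_map d' ` W" "y \<notin> T ` K"
      then obtain x where "x \<in> ?S" "y = T x" "x \<notin> K" unfolding TS[symmetric] by blast
      then show "h' y = 0" using h'T t0 by simp
    qed
    have Cch'V: "Cc_on (chart_map d' ` V') h'"
      by (rule Cc_on_subset[OF Cch' _ oS']) (auto simp: W_def h'_def)
    define u where "u = pull d W t"
    have u: "supp_in P 0 (preim W) u"
      unfolding u_def by (rule pull_supp_in[OF d W(1,2) _ K]) (use contt t0 in auto)
    have uV: "pull d V t p = u p" and uV': "pull d' V' h' p = u p" for p
    proof -
      have inW: "q \<in> W" if "q \<in> chart_dom d" "chart_map d q \<in> K" for q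
      proof -
        obtain q' where "q' \<in> W" "chart_map d q = chart_map d q'" using K(2) \<open>chart_map d q \<in> K\<close> by blast
        then show ?thesis using M.inj_chart[OF d] that(1) W(2) by (metis inj_onD subsetD)
      qed
      show "pull d V t p = u p"
      proof (cases "f p \<in> W")
        case False
        then have "f p \<in> V \<Longrightarrow> t (chart_map d (f p)) = 0" using inW[of "f p"] V(2) t0 by blast
        then show ?thesis using False by (simp add: u_def pull_def)
      qed (simp add: u_def pull_def W_def)
      show "pull d' V' h' p = u p"
      proof (cases "f p \<in> W")
        case True
        then show ?thesis using W d' by (auto simp: u_def pull_def h'_def W_def)
      next
        case False
        have "chart_map d' (f p) \<notin> chart_map d' ` W" if "f p \<in> V'"
          using False W(3) V'(2) that by (subst inj_on_image_mem_iff[OF M.inj_chart[OF d']]) auto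
        then show ?thesis using False by (simp add: u_def pull_def h'_def)
      qed
    qed
    have pW: "preim W \<subseteq> preim V" "preim W \<subseteq> preim V'" by (auto simp: preim_def W_def)
    have "integral ?S (\<lambda>x. t x * g x) = integral (chart_map d ` V) (\<lambda>x. t x * g x)"
    proof -
      have "integral ?S (\<lambda>x. t x * g x) = integral UNIV (\<lambda>x. t x * g x)"
        by (rule integral_eq_integral_UNIV) (use t0 K(2) in auto)
      moreover have "integral (chart_map d ` V) (\<lambda>x. t x * g x) = integral UNIV (\<lambda>x. t x * g x)"
        by (rule integral_eq_integral_UNIV) (use t0 K(2) in \<open>auto simp: W_def\<close>)
      ultimately show ?thesis by simp
    qed
    also have "\<dots> = (\<Sum>b\<in>B. chart_integral \<mu> (ch b) (\<lambda>p. \<rho> b p * u p))"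
      by (simp add: int[OF CcV] uV)
    also have "\<dots> = (\<Sum>b\<in>B'. chart_integral \<mu> (ch' b) (\<lambda>p. \<rho>' b p * u p))"
      using P.partition_of_unity_subset[OF part pW(1)] P.partition_of_unity_subset[OF part' pW(2)]
      by (intro P.partition_integral_indep[OF _ _ openin_preim[OF W(1)] u]) auto
    also have "\<dots> = integral (chart_map d' ` V') (\<lambda>y. h' y * g' y)"
      by (simp add: int'[OF Cch'V] uV')
    also have "\<dots> = integral (T ` ?S) (\<lambda>y. h' y * g' y)"
    proof -
      have "integral (T ` ?S) (\<lambda>y. h' y * g' y) = integral UNIV (\<lambda>y. h' y * g' y)"
        by (rule integral_eq_integral_UNIV) (auto simp: h'_def TS)
      moreover have "integral (chart_map d' ` V') (\<lambda>y. h' y * g' y) = integral UNIV (\<lambda>y. h' y * g' y)"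
        by (rule integral_eq_integral_UNIV) (auto simp: h'_def W_def)
      ultimately show ?thesis by simp
    qed
    also have "\<dots> = integral ?S (\<lambda>x. \<bar>det (matrix ((*v) (jac T x)))\<bar> * (h' (T x) * g' (T x)))"
    proof (rule integral_change_of_variables_real[OF oS])
      show "(T has_derivative (*v) (jac T x)) (at x)" if "x \<in> ?S" for x
        by (rule has_derivative_jac[of 0, OF ckT oS that])
      have "continuous_on (chart_map d' ` W) g'" using g'c by (rule continuous_on_subset) (auto simp: W_def)
      from Cc_on_mult[OF this Cch'] show "(\<lambda>y. h' y * g' y) absolutely_integrable_on T ` ?S"
        unfolding TS by (intro Cc_on_absolutely_integrable oS') (simp add: mult.commute)
    qed (rule injT)
    also have "\<dots> = integral ?S (\<lambda>x. t x * (J x * g' (T x)))"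
      by (intro integral_cong) (simp add: h'T J_def)
    finally have eq: "integral ?S (\<lambda>x. t x * g x) = integral ?S (\<lambda>x. t x * (J x * g' (T x)))" .
    have "(\<lambda>x. t x * g x) integrable_on ?S" "(\<lambda>x. t x * (J x * g' (T x))) integrable_on ?S"
      using Cc_on_integrable[OF oS Cc_on_mult[OF gS CcS]]
        Cc_on_integrable[OF oS Cc_on_mult[OF continuous_on_mult[OF contJ ckg'] CcS]]
      by (simp_all add: mult_ac)
    then show "integral ?S (\<lambda>x. t x * D x) = 0"
      using eq by (simp add: D_def right_diff_distrib integral_diff)
  qed
  moreover have "J (chart_map d q) = density_factor M d d' q"
  proof -
    have "(\<chi> i j. jacobian d d' id q i j) = jac T (chart_map d q)"
      by (simp add: vec_eq_iff jacobian_def jac_def T_def)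
    then show ?thesis
      by (simp only: J_def density_factor_def M.coords UNIV_not_empty if_False)
  qed
  moreover have "T (chart_map d q) = chart_map d' q"
    using q V(2) d by (auto simp: T_def)
  ultimately show ?thesis by (simp add: D_def)
qed

definition pushforward_density :: "('b, 'n) density" where
  "pushforward_density d q = (SOME v. \<exists>V g. fibre_density d V g \<and> q \<in> V \<and> v = g (chart_map d q))"

lemma pushforward_density_eq:
  assumes d: "d \<in> atlas M" and g: "fibre_density d V g" and q: "q \<in> V"
  shows "pushforward_density d q = g (chart_map d q)"
proof -
  have "q \<in> chart_dom d" using g q by (auto simp: fibre_density_def)
  then have *: "g' (chart_map d q) = g (chart_map d q)" if "fibre_density d V' g'" "q \<in> V'" for V' g'
    using fibre_density_transform[OF d d that(1) g that(2) q] M.density_factor_same[OF d] by simp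
  show ?thesis
    unfolding pushforward_density_def
  proof (rule some_equality)
    show "\<exists>V' g'. fibre_density d V' g' \<and> q \<in> V' \<and> g (chart_map d q) = g' (chart_map d q)"
      using g q by blast
    show "\<exists>V' g'. fibre_density d V' g' \<and> q \<in> V' \<and> v = g' (chart_map d q) \<Longrightarrow> v = g (chart_map d q)" for v
      using * by metis
  qed
qed

lemma fibre_densityI:
  assumes "openin (mtop M) V" "V \<subseteq> chart_dom d" "Ck k (chart_map d ` V) g"
    and "partition_of_unity P k (preim V) B ch \<rho>" "is_fibre_integral d V B ch \<rho> g"
  shows "fibre_density d V g"
  using assms P.partition_of_unity_subset[OF assms(4), of "preim V" 0] Ck_continuous[OF assms(3)]
  unfolding fibre_density_def by blast

lemma fibre_density_exists:
  assumes d: "d \<in> atlas M" and q: "q \<in> chart_dom d"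
  obtains V g where "fibre_density d V g" "q \<in> V" "Ck k (chart_map d ` V) g" "\<And>y. y \<in> chart_map d ` V \<Longrightarrow> 0 < g y"
proof (rule fibre_integration[OF d q, of k])
  fix V g B ch \<rho>
  assume "openin (mtop M) V" "q \<in> V" "V \<subseteq> chart_dom d" "partition_of_unity P k (preim V) B ch \<rho>"
    "Ck k (chart_map d ` V) g" "\<And>y. y \<in> chart_map d ` V \<Longrightarrow> 0 < g y" "is_fibre_integral d V B ch \<rho> g"
  then show ?thesis by (intro that[of V g] fibre_densityI)
qed

lemma positive_pushforward_density: "positive_density M pushforward_density"
proof -
  have "smooth_on UNIV (chart_img d) (\<lambda>y. pushforward_density d (chart_inv d y))" if d: "d \<in> atlas M" for d
    unfolding smooth_on_def
  proof (intro allI Ck_local)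
    fix k y assume y: "y \<in> chart_img d"
    then have "chart_inv d y \<in> chart_dom d" by simp
    then obtain V g where fd: "fibre_density d V g" and yV: "chart_inv d y \<in> V" and g: "Ck k (chart_map d ` V) g"
      using fibre_density_exists[OF d] by blast
    have V: "openin (mtop M) V" "V \<subseteq> chart_dom d" using fd by (auto simp: fibre_density_def)
    have oV: "open (chart_map d ` V)" using M.open_image[OF d V(1)] V(2) by (simp add: Int_absorb1)
    have "Ck k (chart_map d ` V) (\<lambda>y. pushforward_density d (chart_inv d y))"
      using pushforward_density_eq[OF d fd] d V(2) g by (subst Ck_cong[OF oV, of _ g]) (auto simp: subset_iff)
    moreover have "y \<in> chart_map d ` V" using yV y by (metis M.map_inv image_eqI)
    ultimately show "\<exists>T. open T \<and> y \<in> T \<and> Ck k T (\<lambda>y. pushforward_density d (chart_inv d y))"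
      using oV by blast
  qed
  moreover have "pushforward_density c q = density_factor M c d q * pushforward_density d q"
    if c: "c \<in> atlas M" and d: "d \<in> atlas M" and q: "q \<in> chart_dom c" "q \<in> chart_dom d" for c d q
  proof -
    obtain V g where fd: "fibre_density c V g" "q \<in> V" using fibre_density_exists[OF c q(1)] by blast
    obtain V' g' where fd': "fibre_density d V' g'" "q \<in> V'" using fibre_density_exists[OF d q(2)] by blast
    show ?thesis
      using fibre_density_transform[OF c d fd(1) fd'(1) fd(2) fd'(2)] pushforward_density_eq[OF c fd]
        pushforward_density_eq[OF d fd'] by simp
  qed
  moreover have "0 < pushforward_density d q" if d: "d \<in> atlas M" and q: "q \<in> chart_dom d" for d q
  proof -
    obtain V g where fd: "fibre_density d V g" "q \<in> V" and pos: "\<And>y. y \<in> chart_map d ` V \<Longrightarrow> 0 < g y"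
      using fibre_density_exists[OF d q] by metis
    show ?thesis using pushforward_density_eq[OF d fd] pos fd(2) by simp
  qed
  ultimately show ?thesis
    unfolding positive_density_def smooth_density_def M.coords by blast
qed

end

section \<open>Invariance of the push-forward density\<close>

locale proper_poisson_submersion = proper_submersion P M f \<mu> + PP: full_poisson_manifold P \<pi>P + PM: full_poisson_manifold M \<pi>M
  for P :: "('a, 'm::{finite,wellorder}) manifold" and M :: "('b, 'n::{finite,wellorder}) manifold" and f \<mu> \<pi>P \<pi>M +
  assumes poisson_map: "poisson_map P \<pi>P M \<pi>M f"
    and invariant: "\<And>H c p. H \<in> smooth_functions P \<Longrightarrow> c \<in> atlas P \<Longrightarrow> p \<in> chart_dom c \<Longrightarrow>
      lie_derivative P (hamiltonian_vf P \<pi>P H) \<mu> c p = 0"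
begin

lemma smooth_functions_comp:
  assumes "h \<in> smooth_functions M"
  shows "(\<lambda>p. h (f p)) \<in> smooth_functions P"
proof -
  have "{p \<in> topspace (mtop P). f p \<in> topspace (mtop M)} = topspace (mtop P)"
    using continuous_map_image_subset_topspace[OF continuous] by auto
  then have *: "Ck_fun P k (topspace (mtop P)) (\<lambda>p. h (f p))" for k
    using Ck_fun_comp[OF openin_topspace M.smooth_functions_Ck[OF assms], of k] by simp
  have "Ck k (chart_img c) (\<lambda>x. h (f (chart_inv c x)))" if "c \<in> atlas P" for c k
    using P.Ck_fun_chart_img[OF * that, of k] P.dom_subset[OF that] by (simp add: Int_absorb2 chart_img_def)
  then show ?thesis by (simp add: smooth_functions_def smooth_on_def)
qed

lemma poisson_map_components:
  assumes "c \<in> atlas P" "d \<in> atlas M" "p \<in> chart_dom c" "f p \<in> chart_dom d"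
  shows "(\<Sum>k\<in>UNIV. \<Sum>l\<in>UNIV. jacobian c d f p i k * jacobian c d f p j l * \<pi>P c p k l) = \<pi>M d (f p) i j"
proof -
  have "\<forall>c\<in>atlas P. \<forall>d\<in>atlas M. \<forall>p\<in>chart_dom c. f p \<in> chart_dom d \<longrightarrow>
        (\<forall>i\<in>UNIV. \<forall>j\<in>UNIV.
           (\<Sum>k\<in>UNIV. \<Sum>l\<in>UNIV.
              jacobian c d f p i k * jacobian c d f p j l * \<pi>P c p k l) = \<pi>M d (f p) i j)"
    using poisson_map unfolding poisson_map_def P.coords M.coords by (elim conjE)
  from this[THEN bspec, OF assms(1), THEN bspec, OF assms(2), THEN bspec, OF assms(3), THEN mp, OF assms(4),
      THEN bspec, OF UNIV_I, THEN bspec, OF UNIV_I]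
  show ?thesis .
qed

text \<open>
  The divergence \<open>D\<close> of the Hamiltonian field of \<open>h\<close> is tested against a bump \<open>t\<close>. Integration by parts
  on \<open>M\<close> gives \<open>\<integral> t D = - \<integral> {h, t} g\<close>. The last integral is computed on \<open>P\<close>, where the pull-back of
  \<open>{h, t}\<close> is \<open>{h \<circ> f, t \<circ> f}\<close>, and vanishes there by the divergence theorem.
\<close>

lemma pushforward_divergence_eq_0:
  assumes d: "d \<in> atlas M" and V: "openin (mtop M) V" "V \<subseteq> chart_dom d"
    and part: "partition_of_unity P (Suc 0) (preim V) B ch \<rho>" and g: "Ck (Suc 0) (chart_map d ` V) g"
    and int: "is_fibre_integral d V B ch \<rho> g"
    and h: "h \<in> smooth_functions M" and y0: "y0 \<in> chart_map d ` V"
  shows "(\<Sum>j\<in>UNIV. partial_deriv j (\<lambda>y. hamiltonian_vf M \<pi>M h d (chart_inv d y) j * g y) y0) = 0"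
proof -
  let ?S = "chart_map d ` V"
  have oS: "open ?S" and img: "?S \<subseteq> chart_img d"
    using M.open_image[OF d V(1)] V(2) by (auto simp: Int_absorb1 chart_img_def)
  have SV: "chart_map d ` (chart_dom d \<inter> V) = ?S" using V(2) by (simp add: Int_absorb1)
  define H where "H p = h (f p)" for p
  have H: "H \<in> smooth_functions P" unfolding H_def by (rule smooth_functions_comp[OF h])
  interpret inv: invariant_density P \<mu> \<pi>P H
    by (unfold_locales) (use H invariant in auto)
  define X where "X j y = hamiltonian_vf M \<pi>M h d (chart_inv d y) j" for j y
  have CkX: "Ck (Suc 0) ?S (X j)" for j
    using M.Ck_fun_partial[OF d V(1) M.smooth_functions_Ck[OF h], of "Suc 0"]
      PM.bivector_Ck[OF d, of "Suc 0" V] unfolding X_def hamiltonian_vf_def SV M.coords by (intro Ck_sum Ck_mult oS)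
  have CkXg: "Ck (Suc 0) ?S (\<lambda>y. X j y * g y)" for j using CkX g by (rule Ck_mult[OF oS])
  define D where "D y = (\<Sum>j\<in>UNIV. partial_deriv j (\<lambda>y. X j y * g y) y)" for y
  have contD: "continuous_on ?S D"
    unfolding D_def using Ck_continuous[OF Ck_partial[OF CkXg]] by (intro continuous_on_sum) auto
  have "D y0 = 0"
  proof (rule eq_0_if_integral_against_bumps_eq_0[OF oS contD y0, of "Suc 0"])
    fix t K assume t: "Ck (Suc 0) UNIV t" and K: "compact K" "K \<subseteq> ?S" and t0: "\<And>x. x \<notin> K \<Longrightarrow> t x = 0"
    have tS: "Ck (Suc 0) ?S t" by (rule Ck_subset[OF t]) simp
    define v where "v j y = t y * (X j y * g y)" for j y
    \<comment> \<open>\<open>\<sigma>\<close> is the bracket \<open>{h, t}\<close> in the chart \<open>d\<close>.\<close>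
    define \<sigma> where "\<sigma> y = (\<Sum>j\<in>UNIV. partial_deriv j t y * X j y)" for y
    have Ckv: "Ck (Suc 0) ?S (v j)" for j unfolding v_def using tS CkXg by (rule Ck_mult[OF oS])
    have v0: "v j y = 0" if "y \<in> ?S" "y \<notin> K" for j y using t0 that by (simp add: v_def)
    have pd: "partial_deriv j (v j) y = partial_deriv j t y * (X j y * g y) + partial_deriv j (\<lambda>y. X j y * g y) y * t y"
      if "y \<in> ?S" for j y
      unfolding v_def by (rule partial_derivI) (rule has_partial_mult[OF Ck_has_partial[OF tS that] Ck_has_partial[OF CkXg that]])
    have Cct: "Cc_on ?S t" by (rule Cc_onI[OF Ck_continuous[OF tS] K]) (use t0 in auto)
    have Cc\<sigma>: "Cc_on ?S \<sigma>"
    proof -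
      have "Cc_on ?S (\<lambda>y. X j y * partial_deriv j t y)" for j
        using Ck_continuous[OF CkX] Cc_on_partial_deriv[OF oS tS K t0] by (rule Cc_on_mult)
      then show ?thesis unfolding \<sigma>_def by (intro Cc_on_sum) (simp add: mult.commute)
    qed
    have int\<sigma>: "(\<lambda>y. \<sigma> y * g y) integrable_on ?S" "(\<lambda>y. t y * D y) integrable_on ?S"
      using Cc_on_integrable[OF oS Cc_on_mult[OF Ck_continuous[OF g] Cc\<sigma>]]
        Cc_on_integrable[OF oS Cc_on_mult[OF contD Cct]] by (simp_all add: mult.commute)
    have "0 = (\<Sum>j\<in>UNIV. integral ?S (partial_deriv j (v j)))"
      using integral_partial_deriv_eq_0[OF oS Ckv K v0] by simp
    also have "\<dots> = integral ?S (\<lambda>y. \<Sum>j\<in>UNIV. partial_deriv j (v j) y)"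
      using Cc_on_integrable[OF oS Cc_on_partial_deriv[OF oS Ckv K v0]] by (intro integral_sum[symmetric]) auto
    also have "\<dots> = integral ?S (\<lambda>y. \<sigma> y * g y + t y * D y)"
      by (intro integral_cong) (simp add: pd sum.distrib \<sigma>_def D_def sum_distrib_left sum_distrib_right mult_ac)
    also have "\<dots> = integral ?S (\<lambda>y. \<sigma> y * g y) + integral ?S (\<lambda>y. t y * D y)"
      using int\<sigma> by (rule integral_add)
    also have "integral ?S (\<lambda>y. \<sigma> y * g y) = (\<Sum>b\<in>B. chart_integral \<mu> (ch b) (\<lambda>p. \<rho> b p * pull d V \<sigma> p))"
      by (rule int[unfolded is_fibre_integral_def, rule_format, OF Cc\<sigma>])
    also have "\<dots> = (\<Sum>b\<in>B. chart_integral \<mu> (ch b) (\<lambda>p. \<rho> b p * poisson_bracket P \<pi>P H (pull d V t) p))"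
    proof (intro sum.cong[OF refl] P.chart_integral_cong)
      fix b p assume "b \<in> B" and p: "p \<in> chart_dom (ch b)"
      then have c: "ch b \<in> atlas P" using part by (simp add: partition_of_unity_def)
      have pP: "p \<in> topspace (mtop P)" using P.dom_subset[OF c] p by auto
      have u: "supp_in P (Suc 0) (preim V) (pull d V t)"
        by (rule pull_supp_in[OF d V tS K]) (use t0 in auto)
      have oP: "openin (mtop P) (preim V)" by (rule openin_preim[OF V(1)])
      have "pull d V \<sigma> p = poisson_bracket P \<pi>P H (pull d V t) p"
      proof (cases "f p \<in> V")
        case True
        then have fd: "f p \<in> chart_dom d" and pV: "p \<in> preim V" using V(2) pP by (auto simp: preim_def)
        have "Ck (Suc 0) ?S (\<lambda>y. t (chart_map d (chart_inv d y)))"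
          by (subst Ck_cong[OF oS, of _ t]) (use tS img in auto)
        then have Ckt: "Ck_fun M (Suc 0) V (\<lambda>q. t (chart_map d q))" by (rule M.Ck_fun_chartI[OF d V])
        have "partial_deriv j t (chart_map d (f p)) = fun_partial d j (\<lambda>q. t (chart_map d q)) (f p)" for j
          unfolding fun_partial_def by (rule partial_deriv_cong[OF oS]) (use True img in auto)
        then have "\<sigma> (chart_map d (f p)) = (\<Sum>j\<in>UNIV. \<Sum>i\<in>UNIV. \<pi>M d (f p) i j * fun_partial d i h (f p) *
            fun_partial d j (\<lambda>q. t (chart_map d q)) (f p))"
          using d fd by (simp add: \<sigma>_def X_def hamiltonian_vf_def sum_distrib_left mult_ac)
        also have "\<dots> = chart_bracket \<pi>M d h (\<lambda>q. t (chart_map d q)) (f p)"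
          unfolding chart_bracket_def by (rule sum.swap)
        also have "\<dots> = chart_bracket \<pi>P (ch b) (\<lambda>p. h (f p)) (\<lambda>p. t (chart_map d (f p))) p"
          by (rule chart_bracket_comp[OF c d p fd V(1) True M.smooth_functions_Ck[OF h] Ckt, symmetric])
            (rule poisson_map_components[OF c d p fd])
        also have "\<dots> = chart_bracket \<pi>P (ch b) H (pull d V t) p"
        proof -
          have "fun_partial (ch b) j (\<lambda>p. t (chart_map d (f p))) p = fun_partial (ch b) j (pull d V t) p" for j
            by (rule P.fun_partial_cong[OF c oP]) (use p pV in \<open>auto simp: pull_def preim_def\<close>)
          then show ?thesis by (simp add: chart_bracket_def H_def[abs_def])
        qed
        also have "\<dots> = poisson_bracket P \<pi>P H (pull d V t) p"
          by (rule PP.poisson_bracket_chart[OF c p oP pV P.smooth_functions_Ck[OF H], symmetric])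
            (rule u[unfolded supp_in_def, THEN conjunct1])
        finally show ?thesis using True by (simp add: pull_def)
      next
        case False
        obtain L where L: "compactin (mtop P) L" "L \<subseteq> preim V" "\<forall>p\<in>topspace (mtop P) - L. pull d V t p = 0"
          using u by (auto simp: supp_in_def)
        have "poisson_bracket P \<pi>P H (pull d V t) p = 0"
          by (rule PP.poisson_bracket_eq_0[OF P.openin_Compl_compact[OF L(1)]]) (use L False pP in \<open>auto simp: preim_def\<close>)
        then show ?thesis using False by (simp add: pull_def)
      qed
      then show "\<rho> b p * pull d V \<sigma> p = \<rho> b p * poisson_bracket P \<pi>P H (pull d V t) p" by simp
    qed
    also have "\<dots> = 0"
      by (rule inv.partition_integral_bracket_eq_0[OF part openin_preim[OF V(1)] pull_supp_in[OF d V tS K]])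
        (use t0 in auto)
    finally show "integral ?S (\<lambda>y. t y * D y) = 0" by simp
  qed
  then show ?thesis by (simp add: D_def X_def)
qed

lemma pushforward_density_invariant:
  assumes h: "h \<in> smooth_functions M" and d: "d \<in> atlas M" and q: "q \<in> chart_dom d"
  shows "lie_derivative M (hamiltonian_vf M \<pi>M h) pushforward_density d q = 0"
proof (rule fibre_integration[OF d q, of "Suc 0"])
  fix V g B ch \<rho>
  assume V: "openin (mtop M) V" "q \<in> V" "V \<subseteq> chart_dom d"
    and part: "partition_of_unity P (Suc 0) (preim V) B ch \<rho>" and g: "Ck (Suc 0) (chart_map d ` V) g"
    and int: "is_fibre_integral d V B ch \<rho> g"
  have fd: "fibre_density d V g" by (rule fibre_densityI[OF V(1,3) g part int])
  have "fun_partial d j (\<lambda>q. hamiltonian_vf M \<pi>M h d q j * pushforward_density d q) q =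
      partial_deriv j (\<lambda>y. hamiltonian_vf M \<pi>M h d (chart_inv d y) j * g y) (chart_map d q)" for j
    unfolding fun_partial_def
    by (rule partial_deriv_cong[OF M.open_image[OF d V(1)]]) (use V q d pushforward_density_eq[OF d fd] in auto)
  then show ?thesis
    using pushforward_divergence_eq_0[OF d V(1,3) part g int h, of "chart_map d q"] V(2)
    by (simp add: lie_derivative_def)
qed

lemma unimodular_target: "unimodular M \<pi>M"
  unfolding unimodular_def using positive_pushforward_density pushforward_density_invariant by blast

end

section \<open>Unimodularity of the base\<close>

text \<open>
  In dimension \<open>0\<close> the Lie derivative is an empty sum.
\<close>

lemma unimodular_if_coords_empty:
  fixes M :: "('a, 'n::finite) manifold"
  assumes "coords M = {}"
  shows "unimodular M \<pi>"
proof -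
  have "Ck_on k {} S (\<lambda>x. 1)" for k and S :: "(real^'n) set" by (rule Ck_const)
  then show ?thesis
    unfolding unimodular_def positive_density_def smooth_density_def smooth_on_def
    by (intro exI[of _ "\<lambda>c p. 1"]) (simp add: assms density_factor_def lie_derivative_def)
qed

lemma unimodular_if_empty:
  fixes M :: "('a, 'n::finite) manifold"
  assumes "smooth_manifold M" "topspace (mtop M) = {}"
  shows "unimodular M \<pi>"
proof -
  have "chart_dom c = {}" if "c \<in> atlas M" for c
    using assms that by (auto simp: smooth_manifold_def)
  moreover have "Ck_on k I {} g" for k I and g :: "real^'n \<Rightarrow> real"
    by (induction k arbitrary: g) auto
  ultimately show ?thesis
    unfolding unimodular_def positive_density_def smooth_density_def smooth_on_def
    by (intro exI[of _ "\<lambda>c p. 1"]) (simp add: chart_img_def)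
qed

theorem proposition1:
  fixes P :: "('a, 'm::{finite,wellorder}) manifold"
    and M :: "('b, 'n::{finite,wellorder}) manifold"
    and \<pi>P :: "('a, 'm) bivector" and \<pi>M :: "('b, 'n) bivector"
    and f :: "'a \<Rightarrow> 'b"
  assumes "poisson_manifold P \<pi>P" and "poisson_manifold M \<pi>M"
    and "poisson_submersion P \<pi>P M \<pi>M f"
    and "f ` topspace (mtop P) = topspace (mtop M)"
    and "proper_map (mtop P) (mtop M) f"
    and "unimodular P \<pi>P"
  shows "unimodular M \<pi>M"
proof -
  have smP: "smooth_manifold P" "bivector_field P \<pi>P" and smM: "smooth_manifold M" "bivector_field M \<pi>M"
    using assms(1,2) by (auto simp: poisson_manifold_def)
  have sub: "submersion P M f" and pm: "poisson_map P \<pi>P M \<pi>M f" and sf: "smooth_map P M f"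
    using assms(3) by (auto simp: poisson_submersion_def poisson_map_def)
  \<comment> \<open>A nonempty manifold of dimension \<open>0\<close> admits no submersion onto one of positive dimension.\<close>
  consider "coords M = {}" | "topspace (mtop M) = {}" | "coords M = UNIV" "coords P = {}" "topspace (mtop M) \<noteq> {}"
    | "coords M = UNIV" "coords P = UNIV"
    using smP(1) smM(1) by (auto simp: smooth_manifold_def)
  then show ?thesis
  proof cases
    case 1
    then show ?thesis by (rule unimodular_if_coords_empty)
  next
    case 2
    with smM(1) show ?thesis by (rule unimodular_if_empty)
  next
    case 3
    from 3(3) obtain q where "q \<in> topspace (mtop M)" by blast
    moreover from this have "q \<in> f ` topspace (mtop P)" using assms(4) by blast
    ultimately obtain p where p: "p \<in> topspace (mtop P)" "f p \<in> topspace (mtop M)" by blast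
    obtain c where c: "c \<in> atlas P" "p \<in> chart_dom c"
      using p(1) smP(1) unfolding smooth_manifold_def by (metis UN_E)
    obtain d where d: "d \<in> atlas M" "f p \<in> chart_dom d"
      using p(2) smM(1) unfolding smooth_manifold_def by (metis UN_E)
    have "(1 :: real^'n::_) \<in> model_space (coords M)" using 3 by (simp add: model_space_def)
    then have "\<exists>v\<in>model_space (coords P). \<forall>i\<in>coords M. (\<Sum>j\<in>coords P. jacobian c d f p i j * v $ j) = (1 :: real^'n::_) $ i"
      using sub c d unfolding submersion_def by blast
    then show ?thesis using 3 by simp
  next
    case 4
    obtain \<mu> where \<mu>: "positive_density P \<mu>"
      "\<forall>h\<in>smooth_functions P. \<forall>c\<in>atlas P. \<forall>p\<in>chart_dom c. lie_derivative P (hamiltonian_vf P \<pi>P h) \<mu> c p = 0"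
      using assms(6) by (auto simp: unimodular_def)
    interpret proper_poisson_submersion P M f \<mu> \<pi>P \<pi>M
      by unfold_locales (use 4 smP smM sub sf pm assms(4,5) \<mu> in \<open>simp_all add: positive_density_def\<close>)
    show ?thesis by (rule unimodular_target)
  qed
qed

end
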